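(* Let $d(n)$ denote the number of positive divisors of the integer $n\ge 1$. For every real $p>1$, the sequence $(d(k))_{k\ge 1}$ is a good weight for the dominated ergodic theorem in $L^p$ and a good weight for the pointwise ergodic theorem in $L^p$.
   Context: A dynamical system $(X,\mathcal A,\nu,\tau)$ is a probability space $(X,\mathcal A,\nu)$ with a measurable transformation $\tau:X\to X$ preserving $\nu$. For a sequence of real numbers $(w_k)_{k\ge 1}$ put $W_n=\sum_{k=1}^n|w_k|$, where it is assumed that $W_n\ne 0$ and $W_n\to\infty$. The sequence $(w_k)_{k\ge1}$ is a good weight for the dominated ergodic theorem in $L^p$, $p>1$, if there exists $C_p>0$ such that for every dynamical system $(X,\mathcal A,\nu,\tau)$ and every $f\in L^p(\nu)$, $$\Big\|\sup_{n\ge 1}\frac{|\sum_{1\le k\le n} w_k f\circ\tau^k|}{W_n}\Big\|_p\le C_p\|f\|_p .$$ It is a good weight for the pointwise ergodic theorem in $L^p$ if for every dynamical system $(X,\mathcal A,\nu,\tau)$ and every $f\in L^p(\nu)$ the sequence $\big(\frac1{W_n}\sum_{1\le k\le n} w_k f\circ\tau^k\big)_n$ converges $\nu$-a.s. *)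

theory Defs
  imports "HOL-Probability.Probability"
begin

definition dynamical_system :: "'a measure \<Rightarrow> ('a \<Rightarrow> 'a) \<Rightarrow> bool" where
  "dynamical_system M \<tau> \<longleftrightarrow> prob_space M \<and> \<tau> \<in> M \<rightarrow>\<^sub>M M \<and> distr M M \<tau> = M"

(* Real powers on [0,\<infinity>]; only meant for exponents a > 0. *)
definition ennreal_powr :: "ennreal \<Rightarrow> real \<Rightarrow> ennreal" where
  "ennreal_powr x a = (if x = \<infinity> then \<infinity> else ennreal (enn2real x powr a))"

(* The L^p norm takes the absolute value as a [0,\<infinity>]-valued function, so that it makes
   sense (possibly as \<infinity>) for suprema that are not known to be finite anywhere. *)
definition Lp_norm :: "'a measure \<Rightarrow> real \<Rightarrow> ('a \<Rightarrow> ennreal) \<Rightarrow> ennreal" where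
  "Lp_norm M p g = ennreal_powr (\<integral>\<^sup>+ x. ennreal_powr (g x) p \<partial>M) (1 / p)"

definition Lp_space :: "'a measure \<Rightarrow> real \<Rightarrow> ('a \<Rightarrow> complex) set" where
  "Lp_space M p = {f \<in> borel_measurable M. Lp_norm M p (\<lambda>x. ennreal (norm (f x))) < \<infinity>}"

definition weight_sum :: "(nat \<Rightarrow> real) \<Rightarrow> nat \<Rightarrow> real" where
  "weight_sum w n = (\<Sum>k=1..n. \<bar>w k\<bar>)"

(* The standing assumption on weights. The value w 0 is never used. *)
definition weight_sequence :: "(nat \<Rightarrow> real) \<Rightarrow> bool" where
  "weight_sequence w \<longleftrightarrow>
     (\<forall>n\<ge>1. weight_sum w n \<noteq> 0) \<and> filterlim (weight_sum w) at_top sequentially"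

definition weighted_average ::
    "(nat \<Rightarrow> real) \<Rightarrow> ('a \<Rightarrow> 'a) \<Rightarrow> ('a \<Rightarrow> complex) \<Rightarrow> nat \<Rightarrow> 'a \<Rightarrow> complex" where
  "weighted_average w \<tau> f n x =
     (\<Sum>k=1..n. of_real (w k) * f ((\<tau> ^^ k) x)) / of_real (weight_sum w n)"

definition maximal_function ::
    "(nat \<Rightarrow> real) \<Rightarrow> ('a \<Rightarrow> 'a) \<Rightarrow> ('a \<Rightarrow> complex) \<Rightarrow> 'a \<Rightarrow> ennreal" where
  "maximal_function w \<tau> f x = (SUP n\<in>{1..}. ennreal (norm (weighted_average w \<tau> f n x)))"

definition dominated_with :: "'a itself \<Rightarrow> real \<Rightarrow> (nat \<Rightarrow> real) \<Rightarrow> real \<Rightarrow> bool" where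
  "dominated_with (X :: 'a itself) p w C \<longleftrightarrow>
     (\<forall>(M :: 'a measure) \<tau>. dynamical_system M \<tau> \<longrightarrow>
        (\<forall>f \<in> Lp_space M p.
           Lp_norm M p (maximal_function w \<tau> f)
             \<le> ennreal C * Lp_norm M p (\<lambda>x. ennreal (norm (f x)))))"

(* The constant C_p has to be the same for all dynamical systems, on whatever type they live.
   Writing "\<exists>C>0. dominated_with TYPE('a) p w C" would let it depend on the type 'a.
   Therefore C_p is chosen here once, by a term that does not mention 'a: it is an arbitrary
   positive constant that works for all systems carried by the sequence space nat => complex.
   By dominated_with_transfer below, such a constant works on every type; so the choice
   loses nothing (good_weight_dominatedI). *)
definition dominated_constant :: "real \<Rightarrow> (nat \<Rightarrow> real) \<Rightarrow> real" where
  "dominated_constant p w = (SOME C. 0 < C \<and> dominated_with TYPE(nat \<Rightarrow> complex) p w C)"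

definition good_weight_dominated :: "'a itself \<Rightarrow> real \<Rightarrow> (nat \<Rightarrow> real) \<Rightarrow> bool" where
  "good_weight_dominated (X :: 'a itself) p w \<longleftrightarrow>
     weight_sequence w \<and> 0 < dominated_constant p w \<and>
     dominated_with TYPE('a) p w (dominated_constant p w)"

definition good_weight_pointwise :: "'a itself \<Rightarrow> real \<Rightarrow> (nat \<Rightarrow> real) \<Rightarrow> bool" where
  "good_weight_pointwise (X :: 'a itself) p w \<longleftrightarrow>
     weight_sequence w \<and>
     (\<forall>(M :: 'a measure) \<tau>. dynamical_system M \<tau> \<longrightarrow>
        (\<forall>f \<in> Lp_space M p. AE x in M. convergent (\<lambda>n. weighted_average w \<tau> f n x)))"

definition divisor_count :: "nat \<Rightarrow> nat" where
  "divisor_count n = card {d. d dvd n}"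

lemma measurable_ennreal_powr [measurable]:
  "(\<lambda>x. ennreal_powr x a) \<in> borel_measurable borel"
  unfolding ennreal_powr_def by measurable

lemma measurable_weighted_average [measurable]:
  assumes "\<tau> \<in> M \<rightarrow>\<^sub>M M" "f \<in> borel_measurable M"
  shows "weighted_average w \<tau> f n \<in> borel_measurable M"
proof -
  have [measurable]: "(\<lambda>x. f ((\<tau> ^^ k) x)) \<in> borel_measurable M" for k
  proof -
    have "(\<tau> ^^ k) \<in> M \<rightarrow>\<^sub>M M"
      using assms(1) by (induction k) (auto intro: measurable_comp simp: id_def)
    then show ?thesis using assms(2) by (rule measurable_compose)
  qed
  show ?thesis unfolding weighted_average_def[abs_def] by measurable
qed

lemma measurable_maximal_function:
  assumes "\<tau> \<in> M \<rightarrow>\<^sub>M M" "f \<in> borel_measurable M"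
  shows "maximal_function w \<tau> f \<in> borel_measurable M"
  using measurable_weighted_average[OF assms, measurable]
  unfolding maximal_function_def[abs_def] by measurable

lemma Lp_norm_distr:
  assumes "\<Phi> \<in> M \<rightarrow>\<^sub>M N" "g \<in> borel_measurable N"
  shows "Lp_norm (distr M N \<Phi>) p g = Lp_norm M p (\<lambda>x. g (\<Phi> x))"
  using assms unfolding Lp_norm_def by (subst nn_integral_distr) auto

lemma dominated_with_transfer:
  assumes "dominated_with TYPE(nat \<Rightarrow> complex) p w C"
  shows "dominated_with TYPE('a) p w C"
  unfolding dominated_with_def
proof (intro allI impI ballI)
  fix M :: "'a measure" and \<tau> f
  assume sys: "dynamical_system M \<tau>" and f: "f \<in> Lp_space M p"
  have \<tau>[measurable]: "\<tau> \<in> M \<rightarrow>\<^sub>M M" and inv: "distr M M \<tau> = M"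
    using sys by (auto simp: dynamical_system_def)
  have f_meas[measurable]: "f \<in> borel_measurable M" using f by (auto simp: Lp_space_def)
  define P :: "(nat \<Rightarrow> complex) measure" where "P = PiM UNIV (\<lambda>_. borel)"
  define \<Phi> where "\<Phi> x = (\<lambda>k. f ((\<tau> ^^ k) x))" for x
  define S :: "(nat \<Rightarrow> complex) \<Rightarrow> (nat \<Rightarrow> complex)" where "S \<omega> = (\<lambda>k. \<omega> (Suc k))" for \<omega>
  define N where "N = distr M P \<Phi>"
  have iter: "(\<lambda>x. f ((\<tau> ^^ k) x)) \<in> borel_measurable M" for k
  proof -
    have "(\<tau> ^^ k) \<in> M \<rightarrow>\<^sub>M M"
      by (induction k) (auto intro: measurable_comp simp: id_def)
    then show ?thesis using f_meas by (rule measurable_compose)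
  qed
  have \<Phi>: "\<Phi> \<in> M \<rightarrow>\<^sub>M P"
    unfolding P_def \<Phi>_def by (intro measurable_PiM_single') (auto simp: iter)
  have S: "S \<in> P \<rightarrow>\<^sub>M P"
    unfolding P_def S_def by (intro measurable_PiM_single') auto
  have S\<Phi>: "S (\<Phi> x) = \<Phi> (\<tau> x)" for x
    by (simp add: S_def \<Phi>_def funpow_swap1)
  have coord: "(\<lambda>\<omega>. \<omega> 0) \<in> borel_measurable P"
    unfolding P_def by simp
  have setsN: "sets N = sets P" by (simp add: N_def)
  have "distr N N S = distr N P S" by (rule distr_cong) (simp_all add: N_def)
  also have "\<dots> = distr M P (S \<circ> \<Phi>)" unfolding N_def by (rule distr_distr[OF S \<Phi>])
  also have "S \<circ> \<Phi> = \<Phi> \<circ> \<tau>" by (auto simp: S\<Phi>)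
  also have "distr M P (\<Phi> \<circ> \<tau>) = distr (distr M M \<tau>) P \<Phi>"
    by (rule distr_distr[symmetric, OF \<Phi> \<tau>])
  also have "\<dots> = N" by (simp add: inv N_def)
  finally have invN: "distr N N S = N" .
  have S_N: "S \<in> N \<rightarrow>\<^sub>M N" using S by (simp cong: measurable_cong_sets add: setsN)
  have "prob_space N" unfolding N_def
    using sys \<Phi> by (auto simp: dynamical_system_def intro: prob_space.prob_space_distr)
  with S_N invN have sysN: "dynamical_system N S" by (simp add: dynamical_system_def)
  have coordN: "(\<lambda>\<omega>. \<omega> 0) \<in> borel_measurable N"
    using coord by (simp cong: measurable_cong_sets add: setsN)
  have norm_eq: "Lp_norm N p (\<lambda>\<omega>. ennreal (norm (\<omega> 0))) = Lp_norm M p (\<lambda>x. ennreal (norm (f x)))"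
    unfolding N_def using coord by (subst Lp_norm_distr[OF \<Phi>]) (simp_all add: \<Phi>_def)
  have S_iter: "(S ^^ k) \<omega> 0 = \<omega> k" for k \<omega>
  proof -
    have "(S ^^ k) \<omega> j = \<omega> (k + j)" for j
      by (induction k arbitrary: j) (simp_all add: S_def)
    then show ?thesis by simp
  qed
  have max_eq: "maximal_function w S (\<lambda>\<omega>. \<omega> 0) (\<Phi> x) = maximal_function w \<tau> f x" for x
    by (simp add: maximal_function_def weighted_average_def S_iter \<Phi>_def)
  have "maximal_function w S (\<lambda>\<omega>. \<omega> 0) \<in> borel_measurable P"
    by (rule measurable_maximal_function[OF S coord])
  then have "Lp_norm M p (maximal_function w \<tau> f) = Lp_norm N p (maximal_function w S (\<lambda>\<omega>. \<omega> 0))"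
    unfolding N_def by (subst Lp_norm_distr[OF \<Phi>]) (simp_all add: max_eq)
  also have "(\<lambda>\<omega>. \<omega> 0) \<in> Lp_space N p"
    using coordN f norm_eq by (auto simp: Lp_space_def)
  then have "Lp_norm N p (maximal_function w S (\<lambda>\<omega>. \<omega> 0))
      \<le> ennreal C * Lp_norm N p (\<lambda>\<omega>. ennreal (norm (\<omega> 0)))"
    using assms sysN unfolding dominated_with_def by blast
  finally show "Lp_norm M p (maximal_function w \<tau> f)
      \<le> ennreal C * Lp_norm M p (\<lambda>x. ennreal (norm (f x)))"
    by (simp add: norm_eq)
qed

lemma good_weight_dominatedI:
  assumes "weight_sequence w" "0 < C" "dominated_with TYPE(nat \<Rightarrow> complex) p w C"
  shows "good_weight_dominated TYPE('a) p w"
proof -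
  have "\<exists>C. 0 < C \<and> dominated_with TYPE(nat \<Rightarrow> complex) p w C" using assms by blast
  from someI_ex[OF this] show ?thesis
    using assms(1) dominated_with_transfer
    unfolding good_weight_dominated_def dominated_constant_def by blast
qed

end

theory Submission
  imports Defs "HOL-Number_Theory.Totient" "HOL-Library.Discrete_Functions" "HOL-Real_Asymp.Real_Asymp"
begin

text \<open>
  The proof is the circle method, with elementary substitutes for its analytic inputs. Write
  \<open>c\<^sub>q(k)\<close> for the Ramanujan sum and \<open>N = \<lfloor>\<surd>n\<rfloor>\<close>. For \<open>k \<le> n\<close> the number \<open>d(k)\<close> is at most twice the
  number of divisors of \<open>k\<close> up to \<open>N\<close>, and replacing \<open>d(k)\<close> by twice the latter on \<open>{1..n}\<close> costs a total
  mass of at most \<open>n\<close> (\<open>sum_divisor_surplus_le\<close>), which is negligible against \<open>\<Sum>\<^sub>k\<^sub>\<le>\<^sub>n d(k) \<sim> n log n\<close>.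
  The indicator of \<open>a dvd k\<close> is \<open>1/a\<close> times the sum of \<open>c\<^sub>q(k)\<close> over \<open>q dvd a\<close>. Hence the truncated
  divisor function, divided by \<open>harm N\<close>, is a sum over \<open>s\<close> of components
  (\<open>ramanujan_component\<close>), where the component \<open>s\<close> contains only the frequencies \<open>a/q\<close> with
  \<open>2\<^sup>s \<le> q < 2\<^sup>s\<^sup>+\<^sup>1\<close>, each with an amplitude of at most \<open>1/q\<close>.

  What makes the sum over \<open>s\<close> converge is that these frequencies are \<open>4\<^sup>-\<^sup>s\<^sup>-\<^sup>1\<close>-separated: as soon as
  \<open>n \<ge> 4\<^sup>s\<close>, an exponential sum of length \<open>n\<close> sees essentially one of them at a time, so the averaging
  operator of the component has norm \<open>O(s 2\<^sup>-\<^sup>s)\<close> on \<open>L\<^sup>2\<close> (\<open>component_average_L2\<close>). This gain is strong enough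
  to control the maximal function along a lacunary sequence of \<open>n\<close>: the component is periodic with period \<open>Q = (2\<^sup>s\<^sup>+\<^sup>1)!\<close>. Up to about \<open>Q\<^sup>2\<close> there are only \<open>O(s 2\<^sup>s)\<close> lacunary scales,
  because \<open>log Q = O(s 2\<^sup>s)\<close>, and an \<open>\<ell>\<^sup>2\<close>-sum over the scales loses only the square root of their
  number. Beyond that the averages are, up to a small tail, ergodic averages of \<open>T\<^sup>Q\<close>, which the maximal
  ergodic theorem controls. Together, the maximal function of the component decays geometrically in \<open>s\<close>
  on \<open>L\<^sup>2\<close> (\<open>component_max_L2\<close>, \<open>component_gain_bound\<close>). On \<open>L\<^sup>a\<close> with \<open>a > 1\<close> it grows at most
  polynomially in \<open>s\<close> (\<open>component_max_Lp\<close>), so that Marcinkiewicz interpolation yields geometric decay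
  on \<open>L\<^sup>p\<close> for all \<open>1 < p \<le> 2\<close> (\<open>component_max_decay\<close>), and the components can be summed. The
  exponents \<open>p > 2\<close> follow from \<open>p = 2\<close> by Jensen's inequality, as the weights are positive.

  For the convergence of the averages, each component converges almost everywhere by Birkhoff's
  theorem when \<open>f\<close> is bounded, and the maximal inequality supplies a summable majorant for the sum over
  \<open>s\<close>. This gives convergence along every lacunary sequence; the averages of a bounded function vary
  slowly enough to fill the gaps as the ratio of the sequence tends to \<open>1\<close>. The dominated ergodic
  theorem then extends the convergence from bounded functions to \<open>L\<^sup>p\<close>.
\<close>

section \<open>Exponentials and Ramanujan sums\<close>

definition e :: "real \<Rightarrow> complex" where
  "e t = cis (2 * pi * t)"

lemma e_add: "e (s + t) = e s * e t"
  by (simp add: e_def cis_mult algebra_simps)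

lemma norm_e [simp]: "norm (e t) = 1"
  by (simp add: e_def)

lemma e_nat_mult: "e (of_nat k * t) = e t ^ k"
  unfolding e_def Complex.DeMoivre by (rule arg_cong[of _ _ cis]) simp

lemma e_of_int [simp]: "e (of_int i) = 1"
  using cis_multiple_2pi[of "of_int i"] by (simp add: e_def)

lemma e_of_nat [simp]: "e (of_nat i) = 1"
  using e_of_int[of "int i"] by simp

lemma e_0 [simp]: "e 0 = 1"
  using e_of_int[of 0] by simp

lemma cnj_e: "cnj (e t) = e (- t)"
  by (simp add: e_def cis_cnj)

lemma e_frac: "e (frac t) = e t"
  using e_add[of "frac t" "of_int \<lfloor>t\<rfloor>"] by (simp add: frac_def)

lemma e_eq_1_iff: "e t = 1 \<longleftrightarrow> t \<in> \<int>"
proof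
  assume "e t = 1"
  then have "cos (2 * pi * t) = 1" by (simp add: e_def complex_eq_iff)
  then obtain n :: int where "2 * pi * t = of_int n * 2 * pi"
    by (auto simp: cos_one_2pi_int)
  then have "t = of_int n" by simp
  then show "t \<in> \<int>" by simp
qed (auto elim!: Ints_cases)

lemma sum_e_roots_of_unity:
  fixes P :: nat and t :: int
  assumes "P > 0"
  shows "(\<Sum>j<P. e (of_nat j * (of_int t / of_nat P))) = (if int P dvd t then of_nat P else 0)"
proof -
  define z where "z = e (of_int t / of_nat P)"
  have zP: "z ^ P = 1"
  proof -
    have "z ^ P = e (of_nat P * (of_int t / of_nat P))" unfolding z_def by (rule e_nat_mult[symmetric])
    also have "\<dots> = 1" using assms by simp
    finally show ?thesis .
  qed
  have S: "(\<Sum>j<P. e (of_nat j * (of_int t / of_nat P))) = (\<Sum>j<P. z ^ j)"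
    unfolding z_def by (simp only: e_nat_mult)
  have "z = 1 \<longleftrightarrow> int P dvd t"
  proof -
    have "real_of_int t / real P \<in> \<int> \<longleftrightarrow> int P dvd t"
    proof
      assume "real_of_int t / real P \<in> \<int>"
      then obtain m where "real_of_int t / real P = of_int m" by (auto elim: Ints_cases)
      then have "real_of_int t = of_int (m * int P)" using assms by (simp add: field_simps)
      then have "t = m * int P" by linarith
      then show "int P dvd t" by simp
    next
      assume "int P dvd t"
      then obtain m where "t = int P * m" by auto
      then show "real_of_int t / real P \<in> \<int>" using assms by simp
    qed
    then show ?thesis by (simp add: z_def e_eq_1_iff)
  qed
  then show ?thesis unfolding S using zP by (auto simp: sum_gp_strict)
qed

lemma sum_e_multiples:
  fixes a k :: nat
  assumes "a > 0"
  shows "(\<Sum>r\<in>{0<..a}. e (of_nat r * of_nat k / of_nat a)) = (if a dvd k then of_nat a else 0)"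
proof -
  have "(\<Sum>r\<in>{0<..a}. e (of_nat r * of_nat k / of_nat a)) = (\<Sum>r<a. e (of_nat r * (of_int (int k) / of_nat a)))"
  proof (rule sum.reindex_bij_witness[where i = "\<lambda>r. if r = 0 then a else r" and j = "\<lambda>r. if r = a then 0 else r"])
    fix r assume "r \<in> {0<..a}"
    then show "e (real (if r = a then 0 else r) * (real_of_int (int k) / real a)) = e (real r * real k / real a)"
      using assms by (auto simp: )
  qed (use assms in auto)
  also have "\<dots> = (if a dvd k then of_nat a else 0)"
    using sum_e_roots_of_unity[OF assms, of "int k"] by (simp del: of_int_of_nat_eq)
  finally show ?thesis .
qed

definition ramanujan_sum :: "nat \<Rightarrow> nat \<Rightarrow> complex" where
  "ramanujan_sum q k = (\<Sum>a\<in>totatives q. e (of_nat a * of_nat k / of_nat q))"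

text \<open>Every fraction \<open>r/a\<close> with \<open>0 < r \<le> a\<close> has a unique reduced form \<open>b/q\<close> with \<open>q dvd a\<close>; grouping the
  complete exponential sum by \<open>q\<close> gives the Ramanujan sums.\<close>
lemma sum_ramanujan_divisors:
  assumes "a > 0"
  shows "(\<Sum>q | q dvd a. ramanujan_sum q k) = (if a dvd k then of_nat a else 0)"
proof -
  let ?f = "\<lambda>r. e (of_nat r * of_nat k / of_nat a)"
  have fin: "finite {d. d dvd a}" using assms by simp
  have "(\<Sum>r\<in>{0<..a}. ?f r) = (\<Sum>d | d dvd a. \<Sum>r | r \<in> {0<..a} \<and> gcd r a = d. ?f r)"
    by (rule sum.group[symmetric]) (use fin in auto)
  also have "\<dots> = (\<Sum>d | d dvd a. ramanujan_sum (a div d) k)"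
  proof (rule sum.cong[OF refl])
    fix d assume "d \<in> {d. d dvd a}"
    then have d: "d dvd a" by simp
    then have "d > 0" using assms by (auto intro: Nat.gr0I)
    have "(\<Sum>r | r \<in> {0<..a} \<and> gcd r a = d. ?f r) = (\<Sum>b\<in>totatives (a div d). ?f (b * d))"
      by (rule sum.reindex_bij_betw[OF bij_betw_totatives_gcd_eq[OF d assms], symmetric])
    also have "\<dots> = ramanujan_sum (a div d) k"
      unfolding ramanujan_sum_def
      using d \<open>d > 0\<close> assms by (intro sum.cong arg_cong[where f=e]) (auto elim!: dvdE simp: field_simps)
    finally show "(\<Sum>r | r \<in> {0<..a} \<and> gcd r a = d. ?f r) = ramanujan_sum (a div d) k" .
  qed
  also have "\<dots> = (\<Sum>d | d dvd a. ramanujan_sum d k)"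
    by (rule sum.reindex_bij_witness[where i = "\<lambda>d. a div d" and j = "\<lambda>d. a div d"])
       (use assms in \<open>auto elim!: dvdE\<close>)
  finally show ?thesis using sum_e_multiples[OF assms, of k] by simp
qed

lemma norm_ramanujan_sum_le_self: "norm (ramanujan_sum q k) \<le> real q"
proof -
  have "norm (ramanujan_sum q k) \<le> (\<Sum>a\<in>totatives q. norm (e (of_nat a * of_nat k / of_nat q)))"
    unfolding ramanujan_sum_def by (rule norm_sum)
  also have "\<dots> = real (totient q)" by (simp add: totient_def)
  also have "\<dots> \<le> real q" by (simp add: totient_le)
  finally show ?thesis .
qed

lemma ramanujan_sum_periodic:
  assumes "q dvd Q" "q > 0"
  shows "ramanujan_sum q (k + i * Q) = ramanujan_sum q k"
  unfolding ramanujan_sum_def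
proof (rule sum.cong[OF refl])
  fix a
  obtain c where "Q = q * c" using assms(1) by auto
  then have "real a * real (k + i * Q) / real q = real a * real k / real q + real (a * i * c)"
    using assms(2) by (simp add: field_simps)
  then show "e (real a * real (k + i * Q) / real q) = e (real a * real k / real q)"
    by (simp only: e_add e_of_nat mult_1_right)
qed

lemma prod_primes_dvd:
  fixes U :: "nat set"
  assumes "finite U" "\<And>p. p \<in> U \<Longrightarrow> prime p" "\<And>p. p \<in> U \<Longrightarrow> p dvd a"
  shows "\<Prod>U dvd a"
  using assms
proof (induction U rule: finite_induct)
  case (insert p U)
  have "coprime p (\<Prod>U)"
    using insert by (intro prod_coprime_right) (auto intro!: primes_coprime)
  then show ?case using insert by (simp add: divides_mult)
qed simp

text \<open>Inclusion and exclusion over the prime factors of \<open>q\<close>, obtained by expanding \<open>\<Prod>(1 - [p dvd a])\<close>.\<close>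
lemma coprime_indicator_eq:
  fixes a q :: nat
  assumes "q > 0"
  shows "(if coprime a q then 1 else 0 :: complex) =
    (\<Sum>U\<in>Pow (prime_factors q). (-1) ^ card U * (if \<Prod>U dvd a then 1 else 0))"
proof -
  let ?P = "prime_factors q"
  let ?x = "\<lambda>p. if p dvd a then 1 else 0 :: complex"
  have "(\<Prod>p\<in>?P. 1 - ?x p) = (if coprime a q then 1 else 0)"
  proof (cases "coprime a q")
    case True
    then have "\<not> p dvd a" if "p \<in> ?P" for p
      using that by (metis in_prime_factors_iff coprime_common_divisor not_prime_unit)
    then show ?thesis using True by simp
  next
    case False
    then have "gcd a q \<noteq> 1" by (simp add: coprime_iff_gcd_eq_1)
    then obtain p where "prime p" "p dvd gcd a q"
      using prime_factor_nat by blast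
    then have "p \<in> ?P" "1 - ?x p = 0" using assms by (auto simp: in_prime_factors_iff)
    then have "(\<Prod>p\<in>?P. 1 - ?x p) = 0" by (intro prod_zero bexI[of _ p]) simp_all
    then show ?thesis using False by simp
  qed
  moreover have "(\<Prod>p\<in>?P. 1 - ?x p) = (\<Sum>U\<in>Pow ?P. (-1) ^ card U * (\<Prod>p\<in>U. ?x p) * (\<Prod>p\<in>?P - U. 1))"
    by (rule prod_diff_conv_sum) simp
  moreover have "(\<Prod>p\<in>U. ?x p) = (if \<Prod>U dvd a then 1 else 0)" if "U \<in> Pow ?P" for U
  proof -
    have fin: "finite U" using that by (meson PowD finite_set_mset finite_subset)
    have pr: "prime p" if "p \<in> U" for p using \<open>U \<in> Pow ?P\<close> that by auto
    show ?thesis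
    proof (cases "\<forall>p\<in>U. p dvd a")
      case True
      then show ?thesis using prod_primes_dvd[OF fin pr, of a] by simp
    next
      case False
      then obtain p where p: "p \<in> U" "\<not> p dvd a" by auto
      then have "(\<Prod>p\<in>U. ?x p) = 0" using fin by (intro prod_zero) auto
      moreover have "p dvd \<Prod>U" using p fin by (intro dvd_prod_eqI[where a = p]) auto
      then have "\<not> \<Prod>U dvd a" using p(2) dvd_trans by blast
      ultimately show ?thesis by simp
    qed
  qed
  ultimately show ?thesis by simp
qed

text \<open>By inclusion and exclusion, \<open>c\<^sub>q(k)\<close> is a signed sum of terms \<open>d [d dvd k]\<close> over distinct divisors \<open>d\<close>
  of \<open>q\<close>. The trivial bound \<open>q\<close> would be too weak close to the exponent \<open>1\<close>.\<close>
lemma norm_ramanujan_sum_le: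
  assumes "q > 0"
  shows "norm (ramanujan_sum q k) \<le> (\<Sum>d | d dvd q \<and> d dvd k. real d)"
proof -
  let ?P = "prime_factors q"
  let ?f = "\<lambda>a. e (of_nat a * of_nat k / of_nat q)"
  define g where "g d = (if d dvd k then real d else 0)" for d
  have pr: "prime p" if "U \<in> Pow ?P" "p \<in> U" for U p using that by auto
  have fin: "finite U" if "U \<in> Pow ?P" for U using that by (meson PowD finite_set_mset finite_subset)
  have dvd: "\<Prod>U dvd q" if "U \<in> Pow ?P" for U
    by (rule prod_primes_dvd) (use that fin in \<open>auto simp: in_prime_factors_iff\<close>)
  have pos: "\<Prod>U > 0" if "U \<in> Pow ?P" for U
    using dvd[OF that] assms by (metis dvd_0_left gr0I not_less0)
  have inner: "(\<Sum>a\<in>{0<..q}. (if \<Prod>U dvd a then 1 else 0) * ?f a) = of_real (g (q div \<Prod>U))"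
    if U: "U \<in> Pow ?P" for U
  proof -
    define D where "D = \<Prod>U"
    have D: "D dvd q" "D > 0" using dvd[OF U] pos[OF U] by (auto simp: D_def)
    then obtain c where q: "q = D * c" by auto
    then have c: "c > 0" using assms by simp
    have "(\<Sum>a\<in>{0<..q}. (if D dvd a then 1 else 0) * ?f a) = (\<Sum>a | a \<in> {0<..q} \<and> D dvd a. ?f a)"
      by (intro sum.mono_neutral_cong_right) auto
    also have "\<dots> = (\<Sum>b\<in>{0<..c}. e (of_nat b * of_nat k / of_nat c))"
      by (rule sum.reindex_bij_witness[where i = "\<lambda>b. D * b" and j = "\<lambda>a. a div D"])
         (use D c q in \<open>auto elim!: dvdE simp: field_simps\<close>)
    also have "\<dots> = of_real (g c)"
      using sum_e_multiples[OF c, of k] by (simp add: g_def)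
    finally show ?thesis using q D by (simp add: D_def)
  qed
  have "ramanujan_sum q k = (\<Sum>a\<in>{0<..q}. (if coprime a q then 1 else 0) * ?f a)"
    unfolding ramanujan_sum_def totatives_def by (intro sum.mono_neutral_cong_left) auto
  also have "\<dots> = (\<Sum>a\<in>{0<..q}. \<Sum>U\<in>Pow ?P. (-1) ^ card U * ((if \<Prod>U dvd a then 1 else 0) * ?f a))"
    by (simp only: coprime_indicator_eq[OF assms] sum_distrib_right mult.assoc)
  also have "\<dots> = (\<Sum>U\<in>Pow ?P. (-1) ^ card U * (\<Sum>a\<in>{0<..q}. (if \<Prod>U dvd a then 1 else 0) * ?f a))"
    by (subst sum.swap) (simp only: sum_distrib_left)
  also have "\<dots> = (\<Sum>U\<in>Pow ?P. (-1) ^ card U * of_real (g (q div \<Prod>U)))"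
    using inner by (intro sum.cong) auto
  finally have "norm (ramanujan_sum q k) \<le> (\<Sum>U\<in>Pow ?P. norm ((-1) ^ card U * of_real (g (q div \<Prod>U)) :: complex))"
    using norm_sum by metis
  also have "\<dots> = (\<Sum>U\<in>Pow ?P. g (q div \<Prod>U))"
    by (simp add: norm_mult norm_power g_def)
  also have "\<dots> = (\<Sum>d\<in>(\<lambda>U. q div \<Prod>U) ` Pow ?P. g d)"
  proof (rule sum.reindex[symmetric, unfolded o_def], rule inj_onI)
    fix U V assume UV: "U \<in> Pow ?P" "V \<in> Pow ?P" "q div \<Prod>U = q div \<Prod>V"
    have "\<Prod>U = \<Prod>V"
      using dvd[OF UV(1)] dvd[OF UV(2)] UV(3) assms
      by (metis dvd_mult_div_cancel dvd_div_eq_0_iff less_not_refl2 mult_cancel2)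
    moreover have *: "p \<in> U \<longleftrightarrow> prime p \<and> p dvd \<Prod>U" if U: "U \<in> Pow ?P" for U p
    proof
      assume "p \<in> U" then show "prime p \<and> p dvd \<Prod>U"
        using pr[OF U] fin[OF U] by (auto intro!: dvd_prod_eqI[where a = p])
    next
      assume p: "prime p \<and> p dvd \<Prod>U"
      then obtain r where "r \<in> U" "p dvd r" using fin[OF U] prime_dvd_prod_iff[of U p "\<lambda>x. x"] by auto
      then show "p \<in> U" using p pr[OF U] by (metis primes_dvd_imp_eq)
    qed
    ultimately show "U = V" using UV(1,2) by (simp add: set_eq_iff)
  qed
  also have "\<dots> \<le> (\<Sum>d | d dvd q. g d)"
  proof (rule sum_mono2)
    have "q div D dvd q" if "D dvd q" for D
      using that by (metis dvd_div_mult_self dvd_triv_left)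
    then show "(\<lambda>U. q div \<Prod>U) ` Pow ?P \<subseteq> {d. d dvd q}" using dvd by auto
  qed (use assms in \<open>auto simp: g_def\<close>)
  also have "\<dots> = (\<Sum>d | d dvd q \<and> d dvd k. real d)"
    unfolding g_def using assms by (intro sum.mono_neutral_cong_right) auto
  finally show ?thesis .
qed

lemma sum_multiples:
  fixes g :: "nat \<Rightarrow> 'b::comm_monoid_add"
  assumes "d \<ge> 1"
  shows "(\<Sum>k=1..n. if d dvd k then g k else 0) = (\<Sum>i<n div d. g (d * Suc i))"
proof -
  have "(\<Sum>k=1..n. if d dvd k then g k else 0) = (\<Sum>k | k \<in> {1..n} \<and> d dvd k. g k)"
    by (intro sum.mono_neutral_cong_right) auto
  also have "\<dots> = (\<Sum>i<n div d. g (d * Suc i))"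
  proof (rule sum.reindex_bij_witness[where i = "\<lambda>i. d * Suc i" and j = "\<lambda>k. k div d - 1"])
    fix k assume "k \<in> {k. k \<in> {1..n} \<and> d dvd k}"
    then obtain i where k: "k = d * i" "1 \<le> k" "k \<le> n" by auto
    then have "i \<ge> 1" by (cases i) auto
    moreover have "i \<le> n div d" using k assms by (simp add: less_eq_div_iff_mult_less_eq mult.commute)
    ultimately show "k div d - 1 \<in> {..<n div d}" "d * Suc (k div d - 1) = k"
      "g (d * Suc (k div d - 1)) = g k" using k assms by auto
  next
    fix i assume "i \<in> {..<n div d}"
    then have "d * Suc i \<le> n" using assms by (simp add: Suc_le_eq[symmetric] less_eq_div_iff_mult_less_eq mult.commute)
    then show "d * Suc i \<in> {k. k \<in> {1..n} \<and> d dvd k}" "d * Suc i div d - 1 = i" using assms by auto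
  qed
  finally show ?thesis .
qed

definition divisors_upto :: "nat \<Rightarrow> nat \<Rightarrow> nat" where
  "divisors_upto N k = card {a \<in> {1..N}. a dvd k}"

text \<open>The cut-off at \<open>u\<close> allows to describe the dependence of the components on the truncation point.\<close>
definition ramanujan_block :: "nat \<Rightarrow> nat \<Rightarrow> nat \<Rightarrow> complex" where
  "ramanujan_block s u k = (\<Sum>q\<in>{2^s..<2^Suc s} \<inter> {..u}. ramanujan_sum q k / of_nat q)"

lemma ramanujan_block_eq_0: "u < 2 ^ s \<Longrightarrow> ramanujan_block s u k = 0"
  unfolding ramanujan_block_def by (rule sum.neutral) auto

lemma sum_ramanujan_blocks:
  "(\<Sum>s<S. ramanujan_block s u k) = (\<Sum>q\<in>{1..<2^S} \<inter> {..u}. ramanujan_sum q k / of_nat q)"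
proof (induction S)
  case (Suc S)
  have "{1..<2^Suc S} \<inter> {..u} = ({1..<2^S} \<inter> {..u}) \<union> ({2^S..<2^Suc S} \<inter> {..u})"
    by (auto simp: not_less intro: order_trans[of _ "2 ^ S"])
  then show ?case using Suc
    by (simp only: sum.lessThan_Suc) (subst sum.union_disjoint, auto simp: ramanujan_block_def)
qed simp

lemma divisors_upto_conv_sum: "real (divisors_upto N k) = (\<Sum>a=1..N. if a dvd k then 1 else 0)"
proof -
  have "(\<Sum>a=1..N. if a dvd k then 1 else 0 :: real) = (\<Sum>a | a \<in> {1..N} \<and> a dvd k. 1)"
    by (intro sum.mono_neutral_cong_right) auto
  then show ?thesis by (simp add: divisors_upto_def)
qed

text \<open>Expanding \<open>[a dvd k]\<close> in Ramanujan sums and writing \<open>a = m q\<close>. The sum over \<open>m\<close> stays outside, because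
  its normalized form is a convex combination of cut-off sums over \<open>q\<close>.\<close>
lemma divisors_upto_ramanujan:
  "of_nat (divisors_upto N k) = (\<Sum>m=1..N. (\<Sum>q=1..N div m. ramanujan_sum q k / of_nat q) / of_nat m)"
proof -
  have "(of_nat (divisors_upto N k) :: complex) = of_real (\<Sum>a=1..N. if a dvd k then 1 else 0)"
    using divisors_upto_conv_sum[of N k] by (metis of_real_of_nat_eq)
  also have "\<dots> = (\<Sum>a=1..N. \<Sum>q | q dvd a. ramanujan_sum q k / of_nat a)"
  proof -
    have "(\<Sum>q | q dvd a. ramanujan_sum q k / of_nat a) = (if a dvd k then 1 else 0)" if "a \<in> {1..N}" for a
      using sum_ramanujan_divisors[of a k] that by (simp add: sum_divide_distrib[symmetric])
    then show ?thesis unfolding of_real_sum by (intro sum.cong) auto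
  qed
  also have "\<dots> = (\<Sum>(a, q)\<in>(SIGMA a:{1..N}. {q. q dvd a}). ramanujan_sum q k / of_nat a)"
    by (rule sum.Sigma) auto
  also have "\<dots> = (\<Sum>(m, q)\<in>(SIGMA m:{1..N}. {1..N div m}). ramanujan_sum q k / of_nat q / of_nat m)"
  proof (rule sum.reindex_bij_witness[where i = "\<lambda>(m, q). (m * q, q)" and j = "\<lambda>(a, q). (a div q, q)"])
    fix x assume "x \<in> (SIGMA a:{1..N}. {q. q dvd a})"
    then obtain a q where x: "x = (a, q)" "1 \<le> a" "a \<le> N" "q dvd a" by auto
    then obtain m where m: "a = q * m" by auto
    then have "q > 0" "m > 0" using x by (auto intro: Nat.gr0I)
    moreover have "q \<le> N div m" using x m \<open>m > 0\<close> by (simp add: less_eq_div_iff_mult_less_eq)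
    moreover have "m \<le> q * m" using \<open>q > 0\<close> by simp
    then have "m \<le> N" using x m by linarith
    ultimately show "(case case x of (a, q) \<Rightarrow> (a div q, q) of (m, q) \<Rightarrow> (m * q, q)) = x"
      "(case x of (a, q) \<Rightarrow> (a div q, q)) \<in> (SIGMA m:{1..N}. {1..N div m})"
      "(case case x of (a, q) \<Rightarrow> (a div q, q) of (m, q) \<Rightarrow> ramanujan_sum q k / of_nat q / of_nat m) =
         (case x of (a, q) \<Rightarrow> ramanujan_sum q k / of_nat a)"
      using x m by (auto simp: field_simps)
  next
    fix y assume "y \<in> (SIGMA m:{1..N}. {1..N div m})"
    then obtain m q where y: "y = (m, q)" "1 \<le> m" "m \<le> N" "1 \<le> q" "q \<le> N div m" by auto
    then have "m * q \<le> N" by (simp add: less_eq_div_iff_mult_less_eq mult.commute)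
    then show "(case case y of (m, q) \<Rightarrow> (m * q, q) of (a, q) \<Rightarrow> (a div q, q)) = y"
      "(case y of (m, q) \<Rightarrow> (m * q, q)) \<in> (SIGMA a:{1..N}. {q. q dvd a})"
      using y by auto
  qed
  also have "\<dots> = (\<Sum>m=1..N. (\<Sum>q=1..N div m. ramanujan_sum q k / of_nat q) / of_nat m)"
    by (subst sum.Sigma[symmetric]) (auto simp: sum_divide_distrib)
  finally show ?thesis .
qed

lemma norm_ramanujan_block_le_pow: "norm (ramanujan_block s u k) \<le> 2 ^ s"
proof -
  let ?A = "{2^s..<2^Suc s} \<inter> {..u} :: nat set"
  have "norm (ramanujan_block s u k) \<le> (\<Sum>q\<in>?A. norm (ramanujan_sum q k / of_nat q))"
    unfolding ramanujan_block_def by (rule norm_sum)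
  also have "\<dots> \<le> (\<Sum>q\<in>?A. 1)"
  proof (rule sum_mono)
    fix q :: nat assume "q \<in> ?A"
    then show "norm (ramanujan_sum q k / of_nat q) \<le> 1"
      using norm_ramanujan_sum_le_self[of q k] by (simp add: norm_divide divide_le_eq)
  qed
  also have "\<dots> \<le> real (card {2^s..<2^Suc s::nat})"
    by (simp only: sum_constant mult_1_right of_nat_le_iff) (rule card_mono, auto)
  finally show ?thesis by simp
qed

text \<open>Interchanging the sums over \<open>q\<close> and over the common divisors \<open>d\<close> of \<open>q\<close> and \<open>k\<close> leaves \<open>\<Sum> d/q\<close> over the
  multiples \<open>q\<close> of \<open>d\<close>, which is at most harmonic.\<close>
lemma norm_ramanujan_block_le:
  "norm (ramanujan_block s u k) \<le> harm (2 ^ Suc s) * real (divisors_upto (2 ^ Suc s) k)"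
proof -
  define D :: nat where "D = 2 ^ Suc s"
  let ?A = "{2^s..<2^Suc s} \<inter> {..u} :: nat set"
  have inner: "(\<Sum>q=1..D. if d dvd q then real d / real q else 0) \<le> harm D" if d: "d \<in> {1..D}" for d
  proof -
    have "real d / real (d * Suc i) = inverse (real (Suc i))" for i
      using d by (simp only: of_nat_mult) (subst nonzero_divide_mult_cancel_left, auto simp: inverse_eq_divide)
    then have "(\<Sum>q=1..D. if d dvd q then real d / real q else 0) = harm (D div d)"
      using d by (subst sum_multiples) (auto simp only: harm_altdef atLeastAtMost_iff)
    also have "\<dots> \<le> harm D" by (intro harm_mono div_le_dividend)
    finally show ?thesis .
  qed
  have "norm (ramanujan_block s u k) \<le> (\<Sum>q\<in>?A. norm (ramanujan_sum q k / of_nat q))"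
    unfolding ramanujan_block_def by (rule norm_sum)
  also have "\<dots> \<le> (\<Sum>q\<in>?A. \<Sum>d=1..D. if d dvd k then (if d dvd q then real d / real q else 0) else 0)"
  proof (rule sum_mono)
    fix q :: nat assume q: "q \<in> ?A"
    have q0: "q > 0" using q by (auto intro: Nat.gr0I)
    have "norm (ramanujan_sum q k / of_nat q) \<le> (\<Sum>d | d dvd q \<and> d dvd k. real d) / real q"
      using norm_ramanujan_sum_le[OF q0, of k] by (simp add: norm_divide divide_right_mono)
    also have "\<dots> = (\<Sum>d | d dvd q \<and> d dvd k. real d / real q)"
      by (rule sum_divide_distrib)
    also have "\<dots> = (\<Sum>d=1..D. if d dvd k then (if d dvd q then real d / real q else 0) else 0)"
    proof (rule sum.mono_neutral_cong_left)
      show "{d. d dvd q \<and> d dvd k} \<subseteq> {1..D}"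
      proof
        fix d assume "d \<in> {d. d dvd q \<and> d dvd k}"
        then have "d \<le> q" "d > 0" using q0 by (auto intro: dvd_imp_le Nat.gr0I)
        then show "d \<in> {1..D}" using q by (simp add: D_def)
      qed
    qed auto
    finally show "norm (ramanujan_sum q k / of_nat q) \<le> (\<Sum>d=1..D. if d dvd k then (if d dvd q then real d / real q else 0) else 0)" .
  qed
  also have "\<dots> \<le> (\<Sum>q=1..D. \<Sum>d=1..D. if d dvd k then (if d dvd q then real d / real q else 0) else 0)"
    by (rule sum_mono2) (auto simp: D_def Suc_le_eq intro: less_le_trans[of 0 "2^s"] intro!: sum_nonneg)
  also have "\<dots> = (\<Sum>d=1..D. \<Sum>q=1..D. if d dvd k then (if d dvd q then real d / real q else 0) else 0)"
    by (rule sum.swap)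
  also have "\<dots> = (\<Sum>d=1..D. if d dvd k then (\<Sum>q=1..D. if d dvd q then real d / real q else 0) else 0)"
    by (intro sum.cong) auto
  also have "\<dots> \<le> (\<Sum>d=1..D. if d dvd k then harm D else 0)"
    using inner by (intro sum_mono) auto
  also have "\<dots> = harm D * real (divisors_upto D k)"
    unfolding divisors_upto_conv_sum sum_distrib_left by (intro sum.cong) auto
  finally show ?thesis by (simp only: D_def)
qed

lemma ramanujan_block_periodic:
  "ramanujan_block s u (k + i * fact (2 ^ Suc s)) = ramanujan_block s u k"
  unfolding ramanujan_block_def
proof (rule sum.cong[OF refl])
  fix q :: nat assume "q \<in> {2^s..<2^Suc s} \<inter> {..u}"
  then have q: "q > 0" "q \<le> 2 ^ Suc s" by (auto intro: Nat.gr0I)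
  have "q dvd fact (2 ^ Suc s)" using q by (intro dvd_fact) auto
  then show "ramanujan_sum q (k + i * fact (2 ^ Suc s)) / of_nat q = ramanujan_sum q k / of_nat q"
    using ramanujan_sum_periodic q by simp
qed

section \<open>Exponential sums over separated frequencies\<close>

lemma sin_pi_ge: 
  assumes "0 \<le> y" "y \<le> 1/2"
  shows "sin (pi * y) \<ge> y"
proof (cases "y \<le> 1/3")
  case True
  have "\<exists>z. 0 \<le> z \<and> z \<le> y \<and> sin (pi * y) - sin (pi * 0) = (y - 0) * (pi * cos (pi * z))"
  proof (cases "y = 0")
    case False
    then have "0 < y" using assms by simp
    have "\<exists>z>0. z < y \<and> sin (pi * y) - sin (pi * 0) = (y - 0) * (pi * cos (pi * z))"
      by (rule MVT2[OF \<open>0 < y\<close>]) (auto intro!: derivative_eq_intros)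
    then show ?thesis by (meson less_imp_le)
  qed auto
  then obtain z where z: "0 \<le> z" "z \<le> y" "sin (pi * y) = y * (pi * cos (pi * z))" by auto
  have "cos (pi * z) \<ge> cos (pi / 3)"
    using z True by (intro cos_monotone_0_pi_le) (auto simp: field_simps)
  then have "cos (pi * z) \<ge> 1/2" by (simp add: cos_60)
  then have "pi * cos (pi * z) \<ge> 2 * (1/2)"
    using pi_ge_two by (intro mult_mono) auto
  then show ?thesis using z(3) assms(1) by (simp add: mult_left_mono[of 1 _ y, simplified])
next
  case False
  have "sin (pi * y) \<ge> sin (pi / 6)"
    using False assms by (intro sin_monotone_2pi_le) (auto simp: field_simps)
  then show ?thesis using assms by (simp add: sin_30)
qed

lemma sin_pi_frac_ge:
  assumes "0 \<le> y" "y \<le> 1"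
  shows "sin (pi * y) \<ge> min y (1 - y)"
proof (cases "y \<le> 1/2")
  case False
  have "sin (pi * (1 - y)) = sin (pi * y)" by (simp add: algebra_simps sin_diff)
  then show ?thesis using sin_pi_ge[of "1 - y"] False assms by simp
qed (use sin_pi_ge assms in auto)

lemma norm_e_minus_1: "norm (e t - 1) = 2 * \<bar>sin (pi * t)\<bar>"
proof -
  have "(norm (e t - 1))\<^sup>2 = (cos (2 * pi * t) - 1)\<^sup>2 + (sin (2 * pi * t))\<^sup>2"
    by (simp add: e_def cmod_power2)
  also have "\<dots> = (cos (2 * pi * t))\<^sup>2 + (sin (2 * pi * t))\<^sup>2 + 1 - 2 * cos (2 * pi * t)"
    by (simp add: power2_eq_square algebra_simps)
  also have "\<dots> = 2 - 2 * cos (2 * (pi * t))" by (simp add: mult.assoc)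
  also have "\<dots> = (2 * \<bar>sin (pi * t)\<bar>)\<^sup>2"
    by (simp only: cos_double_sin) (simp add: power_mult_distrib)
  finally show ?thesis by (rule power2_eq_imp_eq) auto
qed

text \<open>The geometric sum, with \<open>\<bar>e \<beta> - 1\<bar> = 2 \<bar>sin \<pi>\<beta>\<bar>\<close> bounded below by the distance of \<open>\<beta>\<close> to the integers.\<close>
lemma norm_sum_e_le:
  assumes "y = frac \<beta>"
  shows "norm (\<Sum>k=1..n. e (of_nat k * \<beta>)) \<le> real n"
    and "0 < y \<Longrightarrow> norm (\<Sum>k=1..n. e (of_nat k * \<beta>)) \<le> 1 / min y (1 - y)"
proof -
  have "norm (\<Sum>k=1..n. e (of_nat k * \<beta>)) \<le> (\<Sum>k=1..n. norm (e (of_nat k * \<beta>)))" by (rule norm_sum)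
  then show "norm (\<Sum>k=1..n. e (of_nat k * \<beta>)) \<le> real n" by simp
next
  assume "0 < y"
  have y1: "y < 1" using assms by (simp add: frac_lt_1)
  define z where "z = e \<beta>"
  have z: "z = e y" by (simp add: z_def assms e_frac)
  have m: "sin (pi * y) \<ge> min y (1 - y)" "min y (1 - y) > 0"
    using sin_pi_frac_ge[of y] \<open>0 < y\<close> y1 by auto
  have zn: "norm (z - 1) \<ge> 2 * min y (1 - y)"
    using m by (simp add: z norm_e_minus_1)
  have "(z - 1) * (\<Sum>k=1..n. z ^ k) = z ^ Suc n - z"
    by (induction n) (auto simp: algebra_simps)
  then have "norm (z - 1) * norm (\<Sum>k=1..n. z ^ k) = norm (z ^ Suc n - z)"
    by (metis norm_mult)
  also have "\<dots> \<le> norm (z ^ Suc n) + norm z" by (rule norm_triangle_ineq4)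
  also have "\<dots> = 2" by (simp add: z norm_mult norm_power)
  finally have *: "norm (z - 1) * norm (\<Sum>k=1..n. z ^ k) \<le> 2" .
  have "2 * min y (1 - y) * norm (\<Sum>k=1..n. z ^ k) \<le> norm (z - 1) * norm (\<Sum>k=1..n. z ^ k)"
    using zn by (intro mult_right_mono) auto
  with * have "min y (1 - y) * norm (\<Sum>k=1..n. z ^ k) \<le> 1" by simp
  then show "norm (\<Sum>k=1..n. e (of_nat k * \<beta>)) \<le> 1 / min y (1 - y)"
    unfolding e_nat_mult z_def[symmetric] pos_le_divide_eq[OF m(2)] by (simp add: mult.commute)
qed

text \<open>Cut the unit interval into \<open>K\<close> buckets of equal length. By the separation each bucket contains at most
  one of the frequencies, and a frequency in the \<open>b\<close>-th bucket from the nearer end, counted from \<open>0\<close>, contributes at most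
  \<open>K/b\<close>, or \<open>n\<close> if \<open>b = 0\<close>.\<close>
lemma sum_separated_e_le:
  fixes K n :: nat and y :: "'i \<Rightarrow> real"
  assumes "finite \<Theta>" "K > 0"
  assumes sep: "\<And>i j. i \<in> \<Theta> \<Longrightarrow> j \<in> \<Theta> \<Longrightarrow> i \<noteq> j \<Longrightarrow> \<bar>frac (\<beta> i) - frac (\<beta> j)\<bar> * real K \<ge> 1"
  shows "(\<Sum>i\<in>\<Theta>. norm (\<Sum>k=1..n. e (of_nat k * \<beta> i))) \<le> 2 * (real n + real K * harm K)"
proof -
  define G where "G b = (if b = 0 then real n else real K / real b)" for b
  define bucket where "bucket i = nat \<lfloor>real K * frac (\<beta> i)\<rfloor>" for i
  have G0: "G b \<ge> 0" for b by (simp add: G_def)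
  have bk: "real (bucket i) \<le> real K * frac (\<beta> i)" "real K * frac (\<beta> i) < real (bucket i) + 1" "bucket i < K" for i
  proof -
    have "0 \<le> real K * frac (\<beta> i)" by simp
    then show a: "real (bucket i) \<le> real K * frac (\<beta> i)" "real K * frac (\<beta> i) < real (bucket i) + 1"
      unfolding bucket_def by linarith+
    have "real K * frac (\<beta> i) < real K * 1" using frac_lt_1[of "\<beta> i"] \<open>K > 0\<close> by (intro mult_strict_left_mono) auto
    then show "bucket i < K" using a by linarith
  qed
  have inj: "inj_on bucket \<Theta>"
  proof (rule inj_onI, rule ccontr)
    fix i j assume ij: "i \<in> \<Theta>" "j \<in> \<Theta>" "bucket i = bucket j" "i \<noteq> j"
    have "\<bar>real K * frac (\<beta> i) - real K * frac (\<beta> j)\<bar> < 1"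
      using bk(1,2)[of i] bk(1,2)[of j] ij(3) by linarith
    moreover have "\<bar>real K * frac (\<beta> i) - real K * frac (\<beta> j)\<bar> = \<bar>frac (\<beta> i) - frac (\<beta> j)\<bar> * real K"
      by (simp add: abs_mult right_diff_distrib[symmetric])
    ultimately show False using sep[OF ij(1,2,4)] by simp
  qed
  have term_le: "norm (\<Sum>k=1..n. e (of_nat k * \<beta> i)) \<le> G (bucket i) + G (K - 1 - bucket i)" for i
  proof -
    define y where "y = frac (\<beta> i)"
    have y: "0 \<le> y" "y < 1" by (auto simp: y_def frac_lt_1)
    note S = norm_sum_e_le[OF y_def, of n]
    show ?thesis
    proof (cases "y \<le> 1/2")
      case True
      show ?thesis
      proof (cases "bucket i = 0")
        case False
        have "1 \<le> real (bucket i)" using False by simp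
        then have "0 < real K * y" using bk(1)[of i] unfolding y_def by linarith
        then have "y > 0" using y by (simp add: zero_less_mult_iff)
        have "norm (\<Sum>k=1..n. e (of_nat k * \<beta> i)) \<le> 1 / y" using S(2)[OF \<open>y > 0\<close>] True by simp
        also have "\<dots> \<le> real K / real (bucket i)"
          using bk(1)[of i] False \<open>y > 0\<close> by (simp add: y_def field_simps)
        finally show ?thesis using False G0[of "K - 1 - bucket i"] by (simp add: G_def)
      qed (use S(1) G0[of "K - 1 - bucket i"] in \<open>auto simp: G_def\<close>)
    next
      case F: False
      show ?thesis
      proof (cases "K - 1 - bucket i = 0")
        case False
        have r: "real (K - 1 - bucket i) = real K - 1 - real (bucket i)" using bk(3)[of i] by linarith
        have "norm (\<Sum>k=1..n. e (of_nat k * \<beta> i)) \<le> 1 / (1 - y)" using S(2) F by simp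
        also have "\<dots> \<le> real K / real (K - 1 - bucket i)"
        proof -
          have "real (K - 1 - bucket i) \<le> real K * (1 - y)"
            unfolding r using bk(2)[of i] by (simp add: y_def right_diff_distrib)
          then show ?thesis using False y by (simp add: field_simps)
        qed
        finally show ?thesis using False G0[of "bucket i"] by (simp add: G_def)
      qed (use S(1) G0[of "bucket i"] in \<open>auto simp: G_def\<close>)
    qed
  qed
  have sumG: "(\<Sum>b<K. G b) \<le> real n + real K * harm K"
  proof -
    have "(\<Sum>b<K. G b) \<le> (\<Sum>b\<in>{0..K}. G b)" by (intro sum_mono2) (auto simp: G0)
    also have "\<dots> = G 0 + (\<Sum>b\<in>{1..K}. G b)" by (simp add: sum.atLeast_Suc_atMost)
    also have "(\<Sum>b\<in>{1..K}. G b) = real K * harm K"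
      by (simp add: G_def harm_def sum_distrib_left divide_inverse)
    finally show ?thesis by (simp add: G_def)
  qed
  have "(\<Sum>i\<in>\<Theta>. norm (\<Sum>k=1..n. e (of_nat k * \<beta> i))) \<le> (\<Sum>i\<in>\<Theta>. G (bucket i) + G (K - 1 - bucket i))"
    by (rule sum_mono) (rule term_le)
  also have "\<dots> = (\<Sum>b\<in>bucket ` \<Theta>. G b + G (K - 1 - b))"
    by (simp add: sum.reindex[OF inj])
  also have "\<dots> \<le> (\<Sum>b<K. G b + G (K - 1 - b))"
    using bk(3) by (intro sum_mono2) (auto simp: G0)
  also have "\<dots> = 2 * (\<Sum>b<K. G b)"
    using sum.nat_diff_reindex[of G K] by (simp add: sum.distrib)
  also have "\<dots> \<le> 2 * (real n + real K * harm K)"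
    using sumG by (intro mult_left_mono) auto
  finally show ?thesis .
qed

lemma harm_pow2_le: "harm (2 ^ m) \<le> real m + 1"
proof (induction m)
  case (Suc m)
  have "harm (2 ^ Suc m) = harm (2 ^ m) + (\<Sum>k\<in>{2^m<..2^Suc m}. inverse (real k))"
  proof -
    have "{1..2 ^ Suc m} = {1..2 ^ m} \<union> {2 ^ m<..2 ^ Suc m :: nat}" by (auto intro: order_trans[of _ "2 ^ m"])
    then show ?thesis unfolding harm_def by (simp only:) (subst sum.union_disjoint, auto)
  qed
  also have "(\<Sum>k\<in>{2^m<..2^Suc m}. inverse (real k)) \<le> (\<Sum>k\<in>{2^m<..2^Suc m::nat}. inverse (2 ^ m))"
  proof (rule sum_mono)
    fix k assume "k \<in> {2^m<..2^Suc m::nat}"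
    then have "2 ^ m < k" by simp
    then have "real (2 ^ m) \<le> real k" by linarith
    then show "inverse (real k) \<le> inverse (2 ^ m)" by (intro le_imp_inverse_le) auto
  qed
  also have "\<dots> = 1" by simp
  finally show ?case using Suc by simp
qed (simp add: harm_def)

text \<open>After multiplication by \<open>q q'\<close> the difference is an integer, and it is not zero because distinct reduced
  fractions in \<open>(0,1]\<close> differ modulo \<open>1\<close>.\<close>
lemma fractions_separated:
  fixes a a' q q' :: nat
  assumes "a \<in> totatives q" "a' \<in> totatives q'" "(q, a) \<noteq> (q', a')" "q > 0" "q' > 0"
  shows "\<bar>frac (\<alpha> + real a / real q) - frac (\<alpha> + real a' / real q')\<bar> * (real q * real q') \<ge> 1"
proof -
  define i where "i = \<lfloor>\<alpha> + real a' / real q'\<rfloor> - \<lfloor>\<alpha> + real a / real q\<rfloor>"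
  define N where "N = int a * int q' - int a' * int q + i * int q * int q'"
  have eq: "(frac (\<alpha> + real a / real q) - frac (\<alpha> + real a' / real q')) * (real q * real q') = of_int N"
    using assms by (simp add: frac_def N_def i_def field_simps)
  have "N \<noteq> 0"
  proof
    assume "N = 0"
    then have N0: "int a * int q' + i * int q * int q' = int a' * int q" by (simp add: N_def)
    have a: "0 < a" "a \<le> q" "coprime a q" "0 < a'" "a' \<le> q'" "coprime a' q'"
      using assms by (auto simp: in_totatives_iff)
    have "i = 0"
    proof (rule ccontr)
      assume "i \<noteq> 0"
      then consider "i \<ge> 1" | "i \<le> -1" by linarith
      then show False
      proof cases
        case 1
        have "1 * (int q * int q') \<le> i * (int q * int q')" using 1 by (intro mult_right_mono) auto
        moreover have "int a' * int q \<le> int q' * int q" using a by (intro mult_right_mono) auto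
        moreover have "int a * int q' > 0" using a assms by simp
        ultimately show False using N0 by (simp add: mult_ac)
      next
        case 2
        have "i * (int q * int q') \<le> -1 * (int q * int q')" using 2 by (intro mult_right_mono) auto
        moreover have "int a * int q' \<le> int q * int q'" using a by (intro mult_right_mono) auto
        moreover have "int a' * int q > 0" using a assms by simp
        ultimately show False using N0 by (simp add: mult_ac)
      qed
    qed
    then have E: "a * q' = a' * q" using N0 by (simp flip: of_nat_mult)
    then have "q dvd q'" "q' dvd q" using a
      by (metis coprime_commute coprime_dvd_mult_right_iff dvd_triv_right,
          metis coprime_commute coprime_dvd_mult_right_iff dvd_triv_right)
    then have "q = q'" by (rule dvd_antisym)
    then show False using E assms by simp
  qed
  then have "1 \<le> \<bar>N\<bar>" by linarith
  then have "1 \<le> \<bar>real_of_int N\<bar>" by linarith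
  then show ?thesis unfolding eq[symmetric] using assms by (simp add: abs_mult)
qed

text \<open>The decay \<open>O(s 2\<^sup>-\<^sup>s)\<close> of the operator norms; the constants are those which the bucket argument gives.\<close>
definition block_gain :: "nat \<Rightarrow> real" where
  "block_gain s = (16 * real s + 26) / 2 ^ s"

text \<open>The amplitudes are at most \<open>2\<^sup>-\<^sup>s\<close>, and the fractions with denominators below \<open>2\<^sup>s\<^sup>+\<^sup>1\<close> are
  \<open>4\<^sup>-\<^sup>s\<^sup>-\<^sup>1\<close>-separated, so that \<open>K = 4\<^sup>s\<^sup>+\<^sup>1 \<le> 4 n\<close> buckets suffice.\<close>
lemma norm_ramanujan_block_exponential_sum_le:
  assumes "4 ^ s \<le> n"
  shows "norm (\<Sum>k=1..n. ramanujan_block s u k * e (of_nat k * \<alpha>)) \<le> block_gain s * real n"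
proof -
  define K :: nat where "K = 4 ^ Suc s"
  let ?A = "{2^s..<2^Suc s} \<inter> {..u} :: nat set"
  define \<Theta> where "\<Theta> = (SIGMA q:?A. totatives q)"
  have fin: "finite \<Theta>" by (simp add: \<Theta>_def)
  have qpos: "q > 0" if "q \<in> ?A" for q using that by (auto intro: Nat.gr0I)
  let ?S = "\<lambda>\<beta>. \<Sum>k=1..n. e (of_nat k * \<beta>)"
  have "(\<Sum>k=1..n. ramanujan_block s u k * e (of_nat k * \<alpha>)) =
      (\<Sum>k=1..n. \<Sum>(q, a)\<in>\<Theta>. e (of_nat k * (\<alpha> + real a / real q)) / of_nat q)"
  proof (rule sum.cong[OF refl])
    fix k
    have "ramanujan_block s u k * e (of_nat k * \<alpha>) =
        (\<Sum>q\<in>?A. \<Sum>a\<in>totatives q. e (of_nat a * of_nat k / of_nat q) * e (of_nat k * \<alpha>) / of_nat q)"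
      by (simp add: ramanujan_block_def ramanujan_sum_def sum_distrib_right sum_divide_distrib)
    also have "\<dots> = (\<Sum>q\<in>?A. \<Sum>a\<in>totatives q. e (of_nat k * (\<alpha> + real a / real q)) / of_nat q)"
      by (simp add: e_add[symmetric] algebra_simps)
    also have "\<dots> = (\<Sum>(q, a)\<in>\<Theta>. e (of_nat k * (\<alpha> + real a / real q)) / of_nat q)"
      unfolding \<Theta>_def by (rule sum.Sigma) auto
    finally show "ramanujan_block s u k * e (of_nat k * \<alpha>) = (\<Sum>(q, a)\<in>\<Theta>. e (of_nat k * (\<alpha> + real a / real q)) / of_nat q)" .
  qed
  also have "\<dots> = (\<Sum>(q, a)\<in>\<Theta>. ?S (\<alpha> + real a / real q) / of_nat q)"
    by (subst sum.swap) (simp add: split_def sum_divide_distrib)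
  also have "norm \<dots> \<le> (\<Sum>x\<in>\<Theta>. norm (case x of (q, a) \<Rightarrow> ?S (\<alpha> + real a / real q) / of_nat q))"
    by (rule norm_sum)
  also have "\<dots> \<le> (\<Sum>x\<in>\<Theta>. norm (?S (\<alpha> + real (snd x) / real (fst x))) / 2 ^ s)"
  proof (rule sum_mono)
    fix x assume "x \<in> \<Theta>"
    then have "2 ^ s \<le> fst x" by (auto simp: \<Theta>_def)
    then have "real (2 ^ s) \<le> real (fst x)" by (simp only: of_nat_le_iff)
    moreover have "(0::real) < 2 ^ s" by simp
    ultimately have "0 < real (fst x)" "2 ^ s \<le> real (fst x)" unfolding of_nat_power of_nat_numeral by linarith+
    then show "norm (case x of (q, a) \<Rightarrow> ?S (\<alpha> + real a / real q) / of_nat q) \<le>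
        norm (?S (\<alpha> + real (snd x) / real (fst x))) / 2 ^ s"
      by (auto simp: split_def norm_divide intro!: divide_left_mono)
  qed
  also have "\<dots> = (\<Sum>x\<in>\<Theta>. norm (?S (\<alpha> + real (snd x) / real (fst x)))) / 2 ^ s"
    by (simp add: sum_divide_distrib)
  also have "\<dots> \<le> 2 * (real n + real K * harm K) / 2 ^ s"
  proof (intro divide_right_mono sum_separated_e_le fin)
    fix i j assume ij: "i \<in> \<Theta>" "j \<in> \<Theta>" "i \<noteq> j"
    obtain q a where i: "i = (q, a)" "q \<in> ?A" "a \<in> totatives q" using ij by (auto simp: \<Theta>_def)
    obtain q' a' where j: "j = (q', a')" "q' \<in> ?A" "a' \<in> totatives q'" using ij by (auto simp: \<Theta>_def)
    have "q * q' \<le> 2 ^ Suc s * 2 ^ Suc s" using i j by (intro mult_mono) auto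
    also have "\<dots> = K" by (simp add: K_def power_mult_distrib[symmetric])
    finally have K: "real q * real q' \<le> real K" by (metis of_nat_le_iff of_nat_mult)
    have "1 \<le> \<bar>frac (\<alpha> + real a / real q) - frac (\<alpha> + real a' / real q')\<bar> * (real q * real q')"
      by (rule fractions_separated) (use i j ij qpos in auto)
    also have "\<dots> \<le> \<bar>frac (\<alpha> + real a / real q) - frac (\<alpha> + real a' / real q')\<bar> * real K"
      by (rule mult_left_mono[OF K]) simp
    finally show "1 \<le> \<bar>frac (\<alpha> + real (snd i) / real (fst i)) - frac (\<alpha> + real (snd j) / real (fst j))\<bar> * real K"
      using i j by simp
  qed (auto simp: K_def)
  also have "\<dots> \<le> 2 * (real n + (4 * real n) * (2 * real s + 3)) / 2 ^ s"
  proof -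
    have "4 ^ Suc s = (2 ^ (2 * s + 2) :: nat)" by (simp add: power_mult)
    then have "harm K \<le> 2 * real s + 3" using harm_pow2_le[of "2 * s + 2"] by (simp add: K_def)
    moreover have "real K \<le> 4 * real n"
    proof -
      have "real (4 ^ s) \<le> real n" using assms by (simp only: of_nat_le_iff)
      then show ?thesis by (simp add: K_def)
    qed
    ultimately have "real K * harm K \<le> (4 * real n) * (2 * real s + 3)"
      by (intro mult_mono) (auto simp: harm_nonneg)
    then show ?thesis by (intro divide_right_mono mult_left_mono add_left_mono) auto
  qed
  also have "\<dots> = block_gain s * real n" by (simp add: block_gain_def field_simps)
  finally show ?thesis .
qed

section \<open>Transference through the discrete Fourier transform\<close>

lemma dft_parseval:
  assumes "P > 0"
  shows "(\<Sum>j<P. (norm (\<Sum>m<P. a m * e (of_nat j * (of_nat m / of_nat P))))\<^sup>2) = real P * (\<Sum>m<P. (norm (a m))\<^sup>2)"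
proof -
  let ?e = "\<lambda>j m. e (of_nat j * (of_nat m / of_nat P))"
  have orth: "(\<Sum>j<P. ?e j m * cnj (?e j m')) = (if m = m' then of_nat P else 0)" if "m < P" "m' < P" for m m'
  proof -
    have "?e j m * cnj (?e j m') = e (of_nat j * (of_int (int m - int m') / of_nat P))" for j
      by (simp add: cnj_e e_add[symmetric] algebra_simps diff_divide_distrib)
    moreover have "int P dvd int m - int m' \<longleftrightarrow> m = m'"
    proof
      assume "int P dvd int m - int m'"
      then show "m = m'" using that dvd_imp_le_int[of "int m - int m'" "int P"] by (cases "m = m'") auto
    qed auto
    ultimately show ?thesis using sum_e_roots_of_unity[OF assms, of "int m - int m'"] by simp
  qed
  have "of_real (\<Sum>j<P. (norm (\<Sum>m<P. a m * ?e j m))\<^sup>2) =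
      (\<Sum>j<P. (\<Sum>m<P. a m * ?e j m) * cnj (\<Sum>m<P. a m * ?e j m))"
    by (simp only: of_real_sum complex_norm_square)
  also have "\<dots> = (\<Sum>j<P. \<Sum>m<P. \<Sum>m'<P. a m * cnj (a m') * (?e j m * cnj (?e j m')))"
    by (simp add: sum_product mult_ac)
  also have "\<dots> = (\<Sum>m<P. \<Sum>m'<P. a m * cnj (a m') * (\<Sum>j<P. ?e j m * cnj (?e j m')))"
    by (subst sum.swap, rule sum.cong[OF refl], subst sum.swap) (simp only: sum_distrib_left)
  also have "\<dots> = (\<Sum>m<P. \<Sum>m'<P. if m = m' then a m * cnj (a m') * of_nat P else 0)"
  proof (intro sum.cong refl)
    fix m m' assume "m \<in> {..<P}" "m' \<in> {..<P}"
    then have mm: "m < P" "m' < P" by auto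
    show "a m * cnj (a m') * (\<Sum>j<P. ?e j m * cnj (?e j m')) = (if m = m' then a m * cnj (a m') * of_nat P else 0)"
      unfolding orth[OF mm] by simp
  qed
  also have "\<dots> = (\<Sum>m<P. a m * cnj (a m) * of_nat P)"
    by simp
  also have "\<dots> = of_real (real P * (\<Sum>m<P. (norm (a m))\<^sup>2))"
    by (simp only: of_real_mult of_real_sum complex_norm_square sum_distrib_left of_real_of_nat_eq mult_ac)
  finally show ?thesis by (simp only: of_real_eq_iff)
qed

lemma dft_inversion:
  assumes "j < P"
  shows "(\<Sum>m<P. (\<Sum>i<P. F i * e (- (of_nat i * (of_nat m / of_nat P)))) * e (of_nat j * (of_nat m / of_nat P))) = of_nat P * F j"
proof -
  have P: "P > 0" using assms by simp
  have "(\<Sum>m<P. (\<Sum>i<P. F i * e (- (of_nat i * (of_nat m / of_nat P)))) * e (of_nat j * (of_nat m / of_nat P))) =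
      (\<Sum>i<P. \<Sum>m<P. F i * e (of_nat m * (of_int (int j - int i) / of_nat P)))"
  proof (subst sum.swap, rule sum.cong[OF refl])
    fix m
    have "e (- (of_nat i * (of_nat m / of_nat P))) * e (of_nat j * (of_nat m / of_nat P)) =
        e (of_nat m * (of_int (int j - int i) / of_nat P))" for i
      unfolding e_add[symmetric] by (rule arg_cong[of _ _ e]) (simp add: algebra_simps diff_divide_distrib)
    then show "(\<Sum>i<P. F i * e (- (of_nat i * (of_nat m / of_nat P)))) * e (of_nat j * (of_nat m / of_nat P)) =
        (\<Sum>i<P. F i * e (of_nat m * (of_int (int j - int i) / of_nat P)))"
      by (simp only: sum_distrib_right mult.assoc)
  qed
  also have "\<dots> = (\<Sum>i<P. F i * (if i = j then of_nat P else 0))"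
  proof (rule sum.cong[OF refl])
    fix i assume "i \<in> {..<P}"
    then have "int P dvd int j - int i \<longleftrightarrow> i = j"
      using assms dvd_imp_le_int[of "int j - int i" "int P"] by (cases "i = j") auto
    then show "(\<Sum>m<P. F i * e (of_nat m * (of_int (int j - int i) / of_nat P))) = F i * (if i = j then of_nat P else 0)"
      using sum_e_roots_of_unity[OF P, of "int j - int i"] by (simp only: sum_distrib_left[symmetric])
  qed
  also have "\<dots> = of_nat P * F j" using assms by (simp add: if_distrib mult.commute cong: if_cong)
  finally show ?thesis .
qed

text \<open>A finite form of the fact that a convolution operator on \<open>\<ell>\<^sup>2(\<int>)\<close> is bounded by the supremum of its
  multiplier. On \<open>L\<close> shifts of length \<open>n\<close>, the convolution coincides with the cyclic one modulo
  \<open>L + n + 1\<close>, where Parseval's identity applies.\<close>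
lemma convolution_square_bound:
  fixes c F :: "nat \<Rightarrow> complex"
  assumes B: "\<And>\<alpha>. norm (\<Sum>k=1..n. c k * e (of_nat k * \<alpha>)) \<le> B"
  shows "(\<Sum>j<L. (norm (\<Sum>k=1..n. c k * F (j + k)))\<^sup>2) \<le> B\<^sup>2 * (\<Sum>j<L + n + 1. (norm (F j))\<^sup>2)"
proof -
  \<comment> \<open>No index \<open>j + k\<close> with \<open>j < L\<close> and \<open>k \<le> n\<close> wraps around modulo \<open>P\<close>.\<close>
  define P where "P = L + n + 1"
  have P: "P > 0" by (simp add: P_def)
  let ?e = "\<lambda>j m. e (of_nat j * (of_nat m / of_nat P))"
  define a where "a m = (\<Sum>i<P. F i * e (- (of_nat i * (of_nat m / of_nat P))))" for m
  define h where "h m = (\<Sum>k=1..n. c k * ?e k m)" for m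
  define G where "G j = (\<Sum>m<P. (h m * a m) * ?e j m)" for j
  have B0: "B \<ge> 0" using B[of 0] norm_ge_zero order_trans by blast
  have G: "G j = of_nat P * (\<Sum>k=1..n. c k * F (j + k))" if "j < L" for j
  proof -
    have "G j = (\<Sum>m<P. \<Sum>k=1..n. c k * (a m * ?e (j + k) m))"
      by (simp add: G_def h_def sum_distrib_right sum_distrib_left e_add algebra_simps add_divide_distrib)
    also have "\<dots> = (\<Sum>k=1..n. c k * (\<Sum>m<P. a m * ?e (j + k) m))"
      by (subst sum.swap) (simp only: sum_distrib_left)
    also have "\<dots> = (\<Sum>k=1..n. c k * (of_nat P * F (j + k)))"
    proof (rule sum.cong[OF refl])
      fix k assume "k \<in> {1..n}"
      then have "j + k < P" using that by (simp add: P_def)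
      from dft_inversion[OF this, of F]
      show "c k * (\<Sum>m<P. a m * ?e (j + k) m) = c k * (of_nat P * F (j + k))"
        unfolding a_def by simp
    qed
    finally show ?thesis by (simp add: sum_distrib_left mult_ac)
  qed
  have aF: "(real P)\<^sup>2 * (\<Sum>j<P. (norm (F j))\<^sup>2) = real P * (\<Sum>m<P. (norm (a m))\<^sup>2)"
  proof -
    have "real P * (\<Sum>m<P. (norm (a m))\<^sup>2) = (\<Sum>j<P. (norm (\<Sum>m<P. a m * ?e j m))\<^sup>2)"
      by (rule dft_parseval[OF P, symmetric])
    also have "\<dots> = (\<Sum>j<P. (norm (of_nat P * F j))\<^sup>2)"
      unfolding a_def by (intro sum.cong refl) (subst dft_inversion, auto)
    finally show ?thesis by (simp add: norm_mult power_mult_distrib sum_distrib_left)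
  qed
  have "(real P)\<^sup>2 * (\<Sum>j<L. (norm (\<Sum>k=1..n. c k * F (j + k)))\<^sup>2) = (\<Sum>j<L. (norm (G j))\<^sup>2)"
    unfolding sum_distrib_left[of "(real P)\<^sup>2"]
    by (rule sum.cong[OF refl]) (subst G, auto simp: norm_mult power_mult_distrib)
  also have "\<dots> \<le> (\<Sum>j<P. (norm (G j))\<^sup>2)" by (intro sum_mono2) (auto simp: P_def)
  also have "\<dots> = real P * (\<Sum>m<P. (norm (h m * a m))\<^sup>2)" unfolding G_def by (rule dft_parseval[OF P])
  also have "\<dots> \<le> real P * (\<Sum>m<P. B\<^sup>2 * (norm (a m))\<^sup>2)"
  proof (intro mult_left_mono sum_mono)
    fix m
    have "norm (h m) \<le> B" unfolding h_def by (rule B)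
    then show "(norm (h m * a m))\<^sup>2 \<le> B\<^sup>2 * (norm (a m))\<^sup>2"
      by (simp add: norm_mult power_mult_distrib mult_right_mono power_mono)
  qed simp
  also have "\<dots> = B\<^sup>2 * ((real P)\<^sup>2 * (\<Sum>j<P. (norm (F j))\<^sup>2))"
    unfolding aF by (simp add: sum_distrib_left mult_ac)
  also have "\<dots> = (real P)\<^sup>2 * (B\<^sup>2 * (\<Sum>j<P. (norm (F j))\<^sup>2))" by simp
  finally show ?thesis using P by (simp add: P_def)
qed

section \<open>Powers, means and real interpolation\<close>

lemma ennreal_powr_ennreal: "0 \<le> y \<Longrightarrow> ennreal_powr (ennreal y) a = ennreal (y powr a)"
  by (simp add: ennreal_powr_def)

lemma ennreal_powr_mono:
  assumes "x \<le> y" "a > 0"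
  shows "ennreal_powr x a \<le> ennreal_powr y a"
proof (cases y)
  case (real r)
  then obtain s where "x = ennreal s" "0 \<le> s" using assms by (cases x) (auto simp: top_unique)
  then show ?thesis using assms real by (auto simp: ennreal_powr_ennreal intro!: ennreal_leI powr_mono2)
qed (simp add: ennreal_powr_def)

lemma ennreal_powr_mult:
  assumes "0 < c" "a > 0"
  shows "ennreal_powr (ennreal c * y) a = ennreal (c powr a) * ennreal_powr y a"
proof (cases y)
  case (real r)
  then show ?thesis using assms
    by (simp add: ennreal_powr_ennreal ennreal_mult[symmetric] powr_mult)
qed (use assms in \<open>simp add: ennreal_powr_def ennreal_mult_top\<close>)

lemma ennreal_powr_powr:
  assumes "a > 0" "b > 0"
  shows "ennreal_powr (ennreal_powr x a) b = ennreal_powr x (a * b)"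
  by (cases x) (auto simp: ennreal_powr_ennreal powr_powr, simp add: ennreal_powr_def)

lemma ennreal_powr_1: "ennreal_powr x 1 = x"
  by (cases x) (auto simp: ennreal_powr_ennreal, simp add: ennreal_powr_def)

text \<open>Jensen's inequality, applied to the indices where both the weight and the value are positive, so that the
  total weight can be divided out.\<close>
lemma weighted_power_mean:
  fixes w y :: "'i \<Rightarrow> real"
  assumes "finite I" "\<And>i. i \<in> I \<Longrightarrow> 0 \<le> w i" "\<And>i. i \<in> I \<Longrightarrow> 0 \<le> y i" "r \<ge> 1"
  shows "(\<Sum>i\<in>I. w i * y i) powr r \<le> (\<Sum>i\<in>I. w i) powr (r - 1) * (\<Sum>i\<in>I. w i * y i powr r)"
proof -
  define J where "J = {i\<in>I. w i > 0 \<and> y i > 0}"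
  have J: "finite J" "J \<subseteq> I" using assms by (auto simp: J_def)
  have eq: "(\<Sum>i\<in>I. w i * y i) = (\<Sum>i\<in>J. w i * y i)"
    using assms by (intro sum.mono_neutral_right) (force simp: J_def)+
  have rhs: "0 \<le> (\<Sum>i\<in>I. w i) powr (r - 1) * (\<Sum>i\<in>I. w i * y i powr r)"
    using assms by (intro mult_nonneg_nonneg sum_nonneg) auto
  show ?thesis
  proof (cases "J = {}")
    case True
    then show ?thesis using rhs assms unfolding eq by simp
  next
    case False
    define W where "W = (\<Sum>i\<in>J. w i)"
    have W: "W > 0" unfolding W_def using J False by (intro sum_pos) (auto simp: J_def)
    have "(\<Sum>i\<in>J. (w i / W) *\<^sub>R y i) powr r \<le> (\<Sum>i\<in>J. (w i / W) * (y i powr r))"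
    proof (rule convex_on_sum[OF J(1) False powr_convex[OF assms(4)]])
      show "(\<Sum>i\<in>J. w i / W) = 1" using W by (simp add: W_def sum_divide_distrib[symmetric])
    qed (use W in \<open>auto simp: J_def\<close>)
    then have *: "((\<Sum>i\<in>J. w i * y i) / W) powr r \<le> (\<Sum>i\<in>J. w i * y i powr r) / W"
      by (simp add: sum_divide_distrib)
    have "(\<Sum>i\<in>J. w i * y i) powr r = W powr r * ((\<Sum>i\<in>J. w i * y i) / W) powr r"
      using W by (subst powr_mult[symmetric]) (auto simp: J_def intro!: divide_nonneg_pos sum_nonneg)
    also have "\<dots> \<le> W powr r * ((\<Sum>i\<in>J. w i * y i powr r) / W)"
      using * by (intro mult_left_mono) auto
    also have "\<dots> = W powr (r - 1) * (\<Sum>i\<in>J. w i * y i powr r)"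
      using W by (simp add: powr_diff)
    also have "\<dots> \<le> (\<Sum>i\<in>I. w i) powr (r - 1) * (\<Sum>i\<in>I. w i * y i powr r)"
    proof (intro mult_mono powr_mono2 sum_mono2)
      show "W \<le> (\<Sum>i\<in>I. w i)" unfolding W_def using J assms by (intro sum_mono2) auto
    qed (use assms J W in \<open>auto intro!: sum_nonneg simp: J_def\<close>)
    finally show ?thesis unfolding eq .
  qed
qed

lemma weighted_power_mean_ennreal:
  fixes Y :: "'i \<Rightarrow> ennreal"
  assumes "finite I" "I \<noteq> {}" "\<And>i. i \<in> I \<Longrightarrow> 0 < w i" "r \<ge> 1"
  shows "ennreal_powr (\<Sum>i\<in>I. ennreal (w i) * Y i) r
    \<le> ennreal ((\<Sum>i\<in>I. w i) powr (r - 1)) * (\<Sum>i\<in>I. ennreal (w i) * ennreal_powr (Y i) r)"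
proof (cases "\<exists>i\<in>I. Y i = \<infinity>")
  case True
  then obtain i where i: "i \<in> I" "Y i = \<infinity>" by auto
  have "ennreal (w i) * ennreal_powr (Y i) r = \<infinity>" using i assms(3)[OF i(1)] by (simp add: ennreal_powr_def ennreal_mult_top)
  then have "(\<Sum>i\<in>I. ennreal (w i) * ennreal_powr (Y i) r) = \<infinity>"
    by (subst sum.remove[OF assms(1) i(1)]) simp
  moreover have "(\<Sum>i\<in>I. w i) > 0" using assms by (intro sum_pos) auto
  ultimately show ?thesis by (simp add: ennreal_mult_top)
next
  case False
  define y where "y i = enn2real (Y i)" for i
  have Y: "Y i = ennreal (y i)" if "i \<in> I" for i using False that by (simp add: y_def less_top)
  have y: "y i \<ge> 0" for i by (simp add: y_def)
  have w: "w i \<ge> 0" if "i \<in> I" for i using assms(3)[OF that] by simp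
  have "(\<Sum>i\<in>I. ennreal (w i) * Y i) = ennreal (\<Sum>i\<in>I. w i * y i)"
    using w y by (simp add: Y ennreal_mult[symmetric] sum_ennreal)
  moreover have "(\<Sum>i\<in>I. ennreal (w i) * ennreal_powr (Y i) r) = ennreal (\<Sum>i\<in>I. w i * y i powr r)"
    using w y by (simp add: Y ennreal_powr_ennreal ennreal_mult[symmetric] sum_ennreal)
  ultimately show ?thesis
    using weighted_power_mean[of I w y r] assms w y
    by (simp add: ennreal_powr_ennreal sum_nonneg ennreal_mult[symmetric] ennreal_leI)
qed

text \<open>A cheap replacement for Minkowski's inequality: \<open>t\<^sub>s\<close> is at most \<open>w\<^sub>s\<close> times the supremum of the
  \<open>t\<^sub>s / w\<^sub>s\<close>, whose power is at most the sum of the powers. The loss \<open>w\<^sub>s\<^sup>-\<^sup>p\<close> is harmless for a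
  geometrically decaying family.\<close>
lemma ennreal_powr_suminf_le:
  fixes t :: "nat \<Rightarrow> ennreal"
  assumes "\<And>s. 0 < w s" "(\<Sum>s. ennreal (w s)) \<le> 1" "p > 0"
  shows "ennreal_powr (\<Sum>s. t s) p \<le> (\<Sum>s. ennreal (w s powr (-p)) * ennreal_powr (t s) p)"
proof (cases "\<Sum>s. ennreal (w s powr (-p)) * ennreal_powr (t s) p")
  case (real r)
  have "t s \<le> ennreal (w s) * ennreal (r powr (1/p))" for s
  proof -
    have "ennreal (w s powr (-p)) * ennreal_powr (t s) p \<le> (\<Sum>s. ennreal (w s powr (-p)) * ennreal_powr (t s) p)"
      using sum_le_suminf[of "\<lambda>s. ennreal (w s powr (-p)) * ennreal_powr (t s) p" "{s}"] by simp
    then have *: "ennreal (w s powr (-p)) * ennreal_powr (t s) p \<le> ennreal r" using real by simp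
    show ?thesis
    proof (cases "t s")
      case top
      have "w s powr (-p) > 0" using assms(1)[of s] by simp
      then show ?thesis using * top by (simp add: ennreal_powr_def ennreal_mult_top top_unique)
    next
      case t: (real \<tau>)
      then have "w s powr (-p) * \<tau> powr p \<le> r"
        using * real by (simp add: ennreal_powr_ennreal ennreal_mult[symmetric])
      then have "\<tau> powr p \<le> w s powr p * r"
        using assms(1)[of s] by (simp add: powr_minus field_simps)
      then have "(\<tau> powr p) powr (1/p) \<le> (w s powr p * r) powr (1/p)"
        using assms by (intro powr_mono2) auto
      then have "\<tau> \<le> w s * r powr (1/p)"
        using assms(1)[of s] assms(3) t real by (simp add: powr_powr powr_mult)
      then show ?thesis using t real assms(1)[of s] by (simp add: ennreal_mult[symmetric] ennreal_leI)
    qed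
  qed
  then have "(\<Sum>s. t s) \<le> (\<Sum>s. ennreal (w s) * ennreal (r powr (1/p)))"
    by (intro suminf_le) auto
  also have "\<dots> = (\<Sum>s. ennreal (w s)) * ennreal (r powr (1/p))" by (rule ennreal_suminf_multc)
  also have "\<dots> \<le> 1 * ennreal (r powr (1/p))" by (intro mult_right_mono assms(2)) simp
  finally have "(\<Sum>s. t s) \<le> ennreal (r powr (1/p))" by simp
  from ennreal_powr_mono[OF this assms(3)] show ?thesis
    using real assms(3) by (simp add: ennreal_powr_ennreal powr_powr)
qed simp

lemma nn_integral_powr_below:
  assumes "a > -1" "y \<ge> 0"
  shows "(\<integral>\<^sup>+ l. ennreal (l powr a) * indicator {0..y} l \<partial>lborel) = ennreal (y powr (a + 1) / (a + 1))"
  by (rule nn_integral_has_integral_lebesgue'[OF _ has_integral_powr_from_0]) (use assms in auto)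

lemma nn_integral_powr_above:
  assumes "a < -1" "y > 0"
  shows "(\<integral>\<^sup>+ l. ennreal (l powr a) * indicator {y..} l \<partial>lborel) = ennreal (- (y powr (a + 1)) / (a + 1))"
  by (rule nn_integral_has_integral_lebesgue'[OF _ has_integral_powr_to_inf]) (use assms in auto)

text \<open>The end points \<open>0\<close> and \<open>y\<close> are removed as a null set.\<close>
lemma powr_le_layer_integral:
  assumes "p > 0" "0 \<le> y" "ennreal y \<le> g"
  shows "ennreal (y powr p) \<le> (\<integral>\<^sup>+ l. ennreal (p * l powr (p - 1)) * indicator {0<..} l * indicator {l. ennreal l < g} l \<partial>lborel)"
proof -
  have "(\<integral>\<^sup>+ l. ennreal p * (ennreal (l powr (p - 1)) * indicator {0..y} l) \<partial>lborel) =
      ennreal p * (\<integral>\<^sup>+ l. ennreal (l powr (p - 1)) * indicator {0..y} l \<partial>lborel)"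
    by (rule nn_integral_cmult) measurable
  also have "(\<integral>\<^sup>+ l. ennreal (l powr (p - 1)) * indicator {0..y} l \<partial>lborel) = ennreal (y powr p / p)"
    using nn_integral_powr_below[of "p - 1" y] assms by simp
  also have "ennreal p * ennreal (y powr p / p) = ennreal (y powr p)"
    using assms by (simp add: ennreal_mult[symmetric])
  finally have "ennreal (y powr p) = (\<integral>\<^sup>+ l. ennreal p * (ennreal (l powr (p - 1)) * indicator {0..y} l) \<partial>lborel)" ..
  also have "\<dots> \<le> (\<integral>\<^sup>+ l. ennreal (p * l powr (p - 1)) * indicator {0<..} l * indicator {l. ennreal l < g} l \<partial>lborel)"
  proof (rule nn_integral_mono_AE)
    show "AE l in lborel. ennreal p * (ennreal (l powr (p - 1)) * indicator {0..y} l) \<le>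
        ennreal (p * l powr (p - 1)) * indicator {0<..} l * indicator {l. ennreal l < g} l"
      using AE_lborel_singleton[of 0] AE_lborel_singleton[of y]
    proof eventually_elim
      fix l :: real assume "l \<noteq> 0" "l \<noteq> y"
      show "ennreal p * (ennreal (l powr (p - 1)) * indicator {0..y} l) \<le>
        ennreal (p * l powr (p - 1)) * indicator {0<..} l * indicator {l. ennreal l < g} l"
      proof (cases "l \<in> {0..y}")
        case True
        then have l: "0 < l" "l < y" using \<open>l \<noteq> 0\<close> \<open>l \<noteq> y\<close> by auto
        have "ennreal l < ennreal y" using l by (simp add: ennreal_less_iff)
        then have "ennreal l < g" using assms(3) by (rule less_le_trans)
        then show ?thesis using True l assms by (simp add: ennreal_mult)
      qed simp
    qed
  qed
  finally show ?thesis .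
qed

lemma ennreal_powr_le_layer_integral:
  assumes "p > 0"
  shows "ennreal_powr g p \<le> (\<integral>\<^sup>+ l. ennreal (p * l powr (p - 1)) * indicator {0<..} l * indicator {l. ennreal l < g} l \<partial>lborel)"
proof -
  define R where "R = (\<integral>\<^sup>+ l. ennreal (p * l powr (p - 1)) * indicator {0<..} l * indicator {l. ennreal l < g} l \<partial>lborel)"
  have R: "ennreal (y powr p) \<le> R" if "0 \<le> y" "ennreal y \<le> g" for y
    unfolding R_def by (rule powr_le_layer_integral) (use that assms in auto)
  have "ennreal_powr g p \<le> R"
  proof (cases g)
    case (real y)
    then show ?thesis using R[of y] by (simp add: ennreal_powr_ennreal)
  next
    case top
    have "R = \<infinity>"
    proof (rule ccontr)
      assume "R \<noteq> \<infinity>"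
      then obtain r where r: "R = ennreal r" "0 \<le> r" by (cases R) auto
      have "ennreal (((r + 1) powr (1/p)) powr p) \<le> ennreal r" using R[of "(r + 1) powr (1/p)"] top r by simp
      then show False using r assms by (simp add: powr_powr)
    qed
    then show ?thesis by simp
  qed
  then show ?thesis by (simp only: R_def)
qed

lemma layer_cake_le:
  assumes "sigma_finite_measure M" and [measurable]: "g \<in> borel_measurable M" and "p > 0"
  shows "(\<integral>\<^sup>+ x. ennreal_powr (g x) p \<partial>M) \<le>
    (\<integral>\<^sup>+ l. ennreal (p * l powr (p - 1)) * indicator {0<..} l * emeasure M {x \<in> space M. ennreal l < g x} \<partial>lborel)"
proof -
  interpret sigma_finite_measure M by fact
  interpret pair_sigma_finite M lborel ..
  have "(\<integral>\<^sup>+ x. ennreal_powr (g x) p \<partial>M) \<le>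
      (\<integral>\<^sup>+ x. (\<integral>\<^sup>+ l. ennreal (p * l powr (p - 1)) * indicator {0<..} l * indicator {l. ennreal l < g x} l \<partial>lborel) \<partial>M)"
    by (intro nn_integral_mono ennreal_powr_le_layer_integral assms)
  also have "\<dots> = (\<integral>\<^sup>+ l. (\<integral>\<^sup>+ x. ennreal (p * l powr (p - 1)) * indicator {0<..} l * indicator {l. ennreal l < g x} l \<partial>M) \<partial>lborel)"
    by (rule Fubini'[symmetric]) measurable
  also have "\<dots> = (\<integral>\<^sup>+ l. ennreal (p * l powr (p - 1)) * indicator {0<..} l * emeasure M {x \<in> space M. ennreal l < g x} \<partial>lborel)"
  proof (rule nn_integral_cong)
    fix l :: real
    have "(\<integral>\<^sup>+ x. ennreal (p * l powr (p - 1)) * indicator {0<..} l * indicator {l. ennreal l < g x} l \<partial>M) =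
        (\<integral>\<^sup>+ x. ennreal (p * l powr (p - 1)) * indicator {0<..} l * indicator {x \<in> space M. ennreal l < g x} x \<partial>M)"
      by (intro nn_integral_cong) (auto simp: indicator_def)
    also have "\<dots> = ennreal (p * l powr (p - 1)) * indicator {0<..} l * emeasure M {x \<in> space M. ennreal l < g x}"
      by (subst nn_integral_cmult) auto
    finally show "(\<integral>\<^sup>+ x. ennreal (p * l powr (p - 1)) * indicator {0<..} l * indicator {l. ennreal l < g x} l \<partial>M) =
        ennreal (p * l powr (p - 1)) * indicator {0<..} l * emeasure M {x \<in> space M. ennreal l < g x}" .
  qed
  finally show ?thesis .
qed

text \<open>Real interpolation, stated on the level of distribution functions so that the same lemma serves the
  Hardy-Littlewood type argument (\<open>L = 0\<close>) and the Marcinkiewicz argument. Insert the hypothesis into the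
  layer cake formula and exchange the order of integration; \<open>a < p\<close> makes the inner integral over
  \<open>l < f/c\<close> converge at \<open>0\<close>, and \<open>p < b\<close> makes the one over \<open>l \<ge> f/c\<close> converge at infinity. The free
  cut-off ratio \<open>c\<close> is what later balances the two terms.\<close>
lemma interpolation:
  assumes "sigma_finite_measure M" and [measurable]: "g \<in> borel_measurable M" "f \<in> borel_measurable M"
    and f0: "\<And>x. x \<in> space M \<Longrightarrow> 0 \<le> f x"
    and ab: "0 < a" "a < p" "p < b" and c: "c > 0" "K \<ge> 0" "L \<ge> 0"
    and distr: "\<And>l. l > 0 \<Longrightarrow> emeasure M {x \<in> space M. ennreal l < g x} \<le>
      ennreal (K * l powr (-a)) * (\<integral>\<^sup>+ x. ennreal (f x powr a) * indicator {x. c * l < f x} x \<partial>M) +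
      ennreal (L * l powr (-b)) * (\<integral>\<^sup>+ x. ennreal (f x powr b) * indicator {x. f x \<le> c * l} x \<partial>M)"
  shows "(\<integral>\<^sup>+ x. ennreal_powr (g x) p \<partial>M) \<le>
    ennreal (K * c powr (a - p) * p / (p - a) + L * c powr (b - p) * p / (b - p)) * (\<integral>\<^sup>+ x. ennreal (f x powr p) \<partial>M)"
proof -
  interpret sigma_finite_measure M by fact
  interpret pair_sigma_finite M lborel ..
  have p: "p > 0" using ab by simp
  define h1 where "h1 x l = ennreal (f x powr a) * (ennreal (p * K) * (ennreal (l powr (p - 1 - a)) * indicator {0<..} l * indicator {x. c * l < f x} x))" for x l
  define h2 where "h2 x l = ennreal (f x powr b) * (ennreal (p * L) * (ennreal (l powr (p - 1 - b)) * indicator {0<..} l * indicator {x. f x \<le> c * l} x))" for x l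
  have [measurable]: "case_prod h1 \<in> borel_measurable (M \<Otimes>\<^sub>M lborel)" "case_prod h2 \<in> borel_measurable (M \<Otimes>\<^sub>M lborel)"
    unfolding h1_def h2_def split_beta' by measurable
  have "(\<integral>\<^sup>+ x. ennreal_powr (g x) p \<partial>M) \<le>
    (\<integral>\<^sup>+ l. ennreal (p * l powr (p - 1)) * indicator {0<..} l * emeasure M {x \<in> space M. ennreal l < g x} \<partial>lborel)"
    by (rule layer_cake_le) (use assms p in auto)
  also have "\<dots> \<le> (\<integral>\<^sup>+ l. (\<integral>\<^sup>+ x. h1 x l + h2 x l \<partial>M) \<partial>lborel)"
  proof (rule nn_integral_mono)
    fix l :: real
    show "ennreal (p * l powr (p - 1)) * indicator {0<..} l * emeasure M {x \<in> space M. ennreal l < g x} \<le> (\<integral>\<^sup>+ x. h1 x l + h2 x l \<partial>M)"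
    proof (cases "l > 0")
      case True
      have e1: "ennreal (p * l powr (p - 1)) * ennreal (K * l powr (-a)) = ennreal (p * K) * ennreal (l powr (p - 1 - a))"
      proof -
        have "(p * l powr (p - 1)) * (K * l powr (-a)) = (p * K) * (l powr (p - 1) * l powr (-a))" by simp
        also have "l powr (p - 1) * l powr (-a) = l powr (p - 1 - a)" by (simp add: powr_add[symmetric])
        finally show ?thesis using p c by (subst (1 2) ennreal_mult[symmetric]) auto
      qed
      have e2: "ennreal (p * l powr (p - 1)) * ennreal (L * l powr (-b)) = ennreal (p * L) * ennreal (l powr (p - 1 - b))"
      proof -
        have "(p * l powr (p - 1)) * (L * l powr (-b)) = (p * L) * (l powr (p - 1) * l powr (-b))" by simp
        also have "l powr (p - 1) * l powr (-b) = l powr (p - 1 - b)" by (simp add: powr_add[symmetric])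
        finally show ?thesis using p c by (subst (1 2) ennreal_mult[symmetric]) auto
      qed
      have "ennreal (p * l powr (p - 1)) * indicator {0<..} l * emeasure M {x \<in> space M. ennreal l < g x} \<le>
        ennreal (p * l powr (p - 1)) * (ennreal (K * l powr (-a)) * (\<integral>\<^sup>+ x. ennreal (f x powr a) * indicator {x. c * l < f x} x \<partial>M) +
        ennreal (L * l powr (-b)) * (\<integral>\<^sup>+ x. ennreal (f x powr b) * indicator {x. f x \<le> c * l} x \<partial>M))"
        using distr[OF True] True by (auto intro!: mult_left_mono)
      also have "\<dots> = ennreal (p * K) * ennreal (l powr (p - 1 - a)) * (\<integral>\<^sup>+ x. ennreal (f x powr a) * indicator {x. c * l < f x} x \<partial>M) +
          ennreal (p * L) * ennreal (l powr (p - 1 - b)) * (\<integral>\<^sup>+ x. ennreal (f x powr b) * indicator {x. f x \<le> c * l} x \<partial>M)"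
        by (simp only: distrib_left mult.assoc[symmetric] e1 e2)
      also have "\<dots> = (\<integral>\<^sup>+ x. h1 x l \<partial>M) + (\<integral>\<^sup>+ x. h2 x l \<partial>M)"
        using True unfolding h1_def h2_def
        by (subst (1 2) nn_integral_cmult[symmetric], measurable) (auto intro!: arg_cong2[of _ _ _ _ "(+)"] nn_integral_cong simp: mult_ac)
      also have "\<dots> = (\<integral>\<^sup>+ x. h1 x l + h2 x l \<partial>M)"
        by (rule nn_integral_add[symmetric]) (auto simp: h1_def h2_def)
      finally show ?thesis .
    qed simp
  qed
  also have "\<dots> = (\<integral>\<^sup>+ x. (\<integral>\<^sup>+ l. h1 x l + h2 x l \<partial>lborel) \<partial>M)"
    by (rule Fubini') measurable
  also have "\<dots> \<le> (\<integral>\<^sup>+ x. ennreal (K * c powr (a - p) * p / (p - a) + L * c powr (b - p) * p / (b - p)) * ennreal (f x powr p) \<partial>M)"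
  proof (rule nn_integral_mono)
    fix x assume x: "x \<in> space M"
    have fx: "0 \<le> f x" by (rule f0[OF x])
    have "(\<integral>\<^sup>+ l. h1 x l \<partial>lborel) \<le> (\<integral>\<^sup>+ l. ennreal (f x powr a * (p * K)) * (ennreal (l powr (p - 1 - a)) * indicator {0..f x / c} l) \<partial>lborel)"
      using p c by (intro nn_integral_mono) (auto simp: h1_def indicator_def ennreal_mult field_simps)
    also have "\<dots> = ennreal (f x powr a * (p * K)) * ennreal ((f x / c) powr (p - 1 - a + 1) / (p - 1 - a + 1))"
      using ab fx c by (subst nn_integral_cmult, measurable) (subst nn_integral_powr_below, auto)
    also have "\<dots> = ennreal (K * c powr (a - p) * p / (p - a) * f x powr p)"
    proof (cases "f x = 0")
      case False
      then have "f x powr a * (p * K) * ((f x / c) powr (p - a) / (p - a)) = K * c powr (a - p) * p / (p - a) * f x powr p"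
        using fx c ab by (simp add: powr_divide powr_diff field_simps)
      then show ?thesis using p c ab by (simp add: ennreal_mult[symmetric])
    qed simp
    finally have 1: "(\<integral>\<^sup>+ l. h1 x l \<partial>lborel) \<le> ennreal (K * c powr (a - p) * p / (p - a) * f x powr p)" .
    have 2: "(\<integral>\<^sup>+ l. h2 x l \<partial>lborel) \<le> ennreal (L * c powr (b - p) * p / (b - p) * f x powr p)"
    proof (cases "f x = 0")
      case False
      then have fp: "f x > 0" using fx by simp
      have "(\<integral>\<^sup>+ l. h2 x l \<partial>lborel) \<le> (\<integral>\<^sup>+ l. ennreal (f x powr b * (p * L)) * (ennreal (l powr (p - 1 - b)) * indicator {f x / c..} l) \<partial>lborel)"
        using p c by (intro nn_integral_mono) (auto simp: h2_def indicator_def ennreal_mult field_simps)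
      also have "\<dots> = ennreal (f x powr b * (p * L)) * ennreal (- ((f x / c) powr (p - 1 - b + 1)) / (p - 1 - b + 1))"
        using ab fp c by (subst nn_integral_cmult, measurable) (subst nn_integral_powr_above, auto)
      also have "\<dots> = ennreal (f x powr b * (p * L)) * ennreal ((f x / c) powr (p - b) / (b - p))"
      proof -
        have "- ((f x / c) powr (p - 1 - b + 1)) / (p - 1 - b + 1) = (f x / c) powr (p - b) / (b - p)"
          using ab by (simp add: divide_simps) (simp add: algebra_simps)
        then show ?thesis by simp
      qed
      also have "\<dots> = ennreal (L * c powr (b - p) * p / (b - p) * f x powr p)"
      proof -
        have "f x powr b * (p * L) * ((f x / c) powr (p - b) / (b - p)) = L * c powr (b - p) * p / (b - p) * f x powr p"
          using fp c ab by (simp add: powr_divide powr_diff field_simps)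
        then show ?thesis using p c ab by (simp add: ennreal_mult[symmetric])
      qed
      finally show ?thesis .
    qed (simp add: h2_def)
    have "(\<integral>\<^sup>+ l. h1 x l + h2 x l \<partial>lborel) = (\<integral>\<^sup>+ l. h1 x l \<partial>lborel) + (\<integral>\<^sup>+ l. h2 x l \<partial>lborel)"
      by (rule nn_integral_add) (auto simp: h1_def h2_def)
    also have "\<dots> \<le> ennreal (K * c powr (a - p) * p / (p - a) * f x powr p) + ennreal (L * c powr (b - p) * p / (b - p) * f x powr p)"
      by (intro add_mono 1 2)
    also have "\<dots> = ennreal (K * c powr (a - p) * p / (p - a) + L * c powr (b - p) * p / (b - p)) * ennreal (f x powr p)"
      using p c ab by (simp add: ennreal_plus[symmetric] ennreal_mult[symmetric] distrib_right del: ennreal_plus)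
    finally show "(\<integral>\<^sup>+ l. h1 x l + h2 x l \<partial>lborel) \<le>
      ennreal (K * c powr (a - p) * p / (p - a) + L * c powr (b - p) * p / (b - p)) * ennreal (f x powr p)" .
  qed
  also have "\<dots> = ennreal (K * c powr (a - p) * p / (p - a) + L * c powr (b - p) * p / (b - p)) * (\<integral>\<^sup>+ x. ennreal (f x powr p) \<partial>M)"
    by (rule nn_integral_cmult) measurable
  finally show ?thesis .
qed

lemma chebyshev_powr:
  assumes [measurable]: "g \<in> borel_measurable M" and "l > 0" "a > 0"
  shows "emeasure M {x \<in> space M. ennreal l < g x} \<le> ennreal (l powr (-a)) * (\<integral>\<^sup>+ x. ennreal_powr (g x) a \<partial>M)"
proof -
  have "emeasure M {x \<in> space M. ennreal l < g x} \<le> emeasure M {x \<in> space M. 1 \<le> ennreal (l powr (-a)) * ennreal_powr (g x) a}"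
  proof (rule emeasure_mono)
    show "{x \<in> space M. ennreal l < g x} \<subseteq> {x \<in> space M. 1 \<le> ennreal (l powr (-a)) * ennreal_powr (g x) a}"
    proof safe
      fix x assume "ennreal l < g x"
      then have "ennreal_powr (ennreal l) a \<le> ennreal_powr (g x) a" using assms by (intro ennreal_powr_mono) auto
      then have "ennreal (l powr (-a)) * ennreal (l powr a) \<le> ennreal (l powr (-a)) * ennreal_powr (g x) a"
        using assms by (intro mult_left_mono) (auto simp: ennreal_powr_ennreal)
      then show "1 \<le> ennreal (l powr (-a)) * ennreal_powr (g x) a"
        using assms by (simp add: ennreal_mult[symmetric] powr_add[symmetric])
    qed
  qed measurable
  also have "\<dots> \<le> ennreal (l powr (-a)) * (\<integral>\<^sup>+ x. ennreal_powr (g x) a * indicator (space M) x \<partial>M)"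
    by (rule nn_integral_Markov_inequality) auto
  also have "(\<integral>\<^sup>+ x. ennreal_powr (g x) a * indicator (space M) x \<partial>M) = (\<integral>\<^sup>+ x. ennreal_powr (g x) a \<partial>M)"
    by (intro nn_integral_cong) simp
  finally show ?thesis .
qed

section \<open>Maximal and pointwise ergodic theorems\<close>

lemma dynamical_systemD:
  assumes "dynamical_system M T"
  shows "prob_space M" "T \<in> M \<rightarrow>\<^sub>M M" "distr M M T = M" "sigma_finite_measure M"
  using assms by (auto simp: dynamical_system_def dest: prob_space_imp_sigma_finite)

lemma measurable_funpow:
  assumes "T \<in> M \<rightarrow>\<^sub>M M"
  shows "(T ^^ k) \<in> M \<rightarrow>\<^sub>M M"
  using assms by (induction k) (auto intro: measurable_comp simp: id_def)

lemma dynamical_system_funpow: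
  assumes "dynamical_system M T"
  shows "dynamical_system M (T ^^ k)"
proof -
  have T: "T \<in> M \<rightarrow>\<^sub>M M" and inv: "distr M M T = M" using dynamical_systemD[OF assms] by auto
  have "distr M M (T ^^ k) = M"
  proof (induction k)
    case 0
    then show ?case by (simp add: id_def)
  next
    case (Suc k)
    have "distr M M (T ^^ Suc k) = distr (distr M M (T ^^ k)) M T"
      using T measurable_funpow[OF T, of k] by (simp add: distr_distr)
    then show ?case unfolding Suc inv .
  qed
  then show ?thesis using assms measurable_funpow[OF T] by (simp add: dynamical_system_def)
qed

lemma nn_integral_invariant:
  assumes "dynamical_system M T" "h \<in> borel_measurable M"
  shows "(\<integral>\<^sup>+ x. h ((T ^^ k) x) \<partial>M) = (\<integral>\<^sup>+ x. h x \<partial>M)"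
proof -
  have *: "dynamical_system M (T ^^ k)" by (rule dynamical_system_funpow[OF assms(1)])
  have "(\<integral>\<^sup>+ x. h x \<partial>M) = (\<integral>\<^sup>+ x. h x \<partial>distr M M (T ^^ k))"
    using dynamical_systemD(3)[OF *] by simp
  also have "\<dots> = (\<integral>\<^sup>+ x. h ((T ^^ k) x) \<partial>M)"
    using dynamical_systemD(2)[OF *] assms(2) by (intro nn_integral_distr) auto
  finally show ?thesis ..
qed

text \<open>The maximum of the partial orbit sums \<open>\<Sum>\<^sub>i\<^sub><\<^sub>k F (T\<^sup>i x)\<close> over \<open>0 \<le> k \<le> n\<close>. The recursion is the identity
  on which Garsia's argument rests.\<close>
fun max_partial_sum :: "('a \<Rightarrow> 'a) \<Rightarrow> ('a \<Rightarrow> real) \<Rightarrow> nat \<Rightarrow> 'a \<Rightarrow> real" where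
  "max_partial_sum T F 0 x = 0"
| "max_partial_sum T F (Suc n) x = max 0 (F x + max_partial_sum T F n (T x))"

lemma max_partial_sum_nonneg: "0 \<le> max_partial_sum T F n x"
  by (cases n) auto

lemma max_partial_sum_mono: "max_partial_sum T F n x \<le> max_partial_sum T F (Suc n) x"
proof (induction n arbitrary: x)
  case (Suc n)
  show ?case using Suc[of "T x"] by (auto intro!: max.mono)
qed auto

lemma sum_orbit_Suc: "(\<Sum>i<Suc k. F ((T ^^ i) x)) = F x + (\<Sum>i<k. F ((T ^^ i) (T x)))"
  by (subst sum.lessThan_Suc_shift) (simp add: funpow_swap1)

lemma max_partial_sum_ge: "k \<le> n \<Longrightarrow> (\<Sum>i<k. F ((T ^^ i) x)) \<le> max_partial_sum T F n x"
proof (induction n arbitrary: k x)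
  case (Suc n)
  show ?case
  proof (cases k)
    case (Suc k')
    then show ?thesis using Suc.IH[of k' "T x"] Suc.prems by (simp only: sum_orbit_Suc) auto
  qed auto
qed auto

lemma max_partial_sum_attained: "\<exists>k\<le>n. max_partial_sum T F n x = (\<Sum>i<k. F ((T ^^ i) x))"
proof (induction n arbitrary: x)
  case (Suc n)
  obtain k where k: "k \<le> n" "max_partial_sum T F n (T x) = (\<Sum>i<k. F ((T ^^ i) (T x)))"
    using Suc by blast
  show ?case
  proof (cases "F x + max_partial_sum T F n (T x) \<le> 0")
    case True
    then show ?thesis by (intro exI[of _ 0]) auto
  next
    case False
    then show ?thesis using k by (intro exI[of _ "Suc k"]) (simp only: sum_orbit_Suc, auto)
  qed
qed auto

text \<open>Garsia's argument. Where the maximum \<open>m\<^sub>n\<close> of the partial sums is positive, \<open>m\<^sub>n \<le> F + m\<^sub>n \<circ> T\<close>, and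
  elsewhere \<open>m\<^sub>n - m\<^sub>n \<circ> T \<le> 0\<close>; by invariance \<open>m\<^sub>n - m\<^sub>n \<circ> T\<close> has integral \<open>0\<close>. Then let \<open>n\<close> tend to
  infinity.\<close>
theorem maximal_ergodic:
  fixes F :: "'a \<Rightarrow> real"
  assumes sys: "dynamical_system M T" and F: "integrable M F"
  shows "0 \<le> (\<integral>x. indicator {x. \<exists>n. 0 < (\<Sum>i<n. F ((T ^^ i) x))} x * F x \<partial>M)"
proof -
  note [measurable] = dynamical_systemD(2)[OF sys] borel_measurable_integrable[OF F]
  let ?m = "max_partial_sum T F"
  have [measurable]: "?m n \<in> borel_measurable M" for n
    by (induction n) (simp_all add: measurable_compose[OF dynamical_systemD(2)[OF sys]])
  have compT: "integrable M (\<lambda>x. h (T x)) \<and> (\<integral>x. h (T x) \<partial>M) = (\<integral>x. h x \<partial>M)" if h: "integrable M h" for h :: "'a \<Rightarrow> real"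
  proof -
    have "integrable (distr M M T) h" using h dynamical_systemD(3)[OF sys] by simp
    moreover have "(\<integral>x. h x \<partial>M) = (\<integral>x. h x \<partial>distr M M T)" using dynamical_systemD(3)[OF sys] by simp
    ultimately show ?thesis using h by (subst (asm) integrable_distr_eq) (auto simp: integral_distr)
  qed
  have int: "integrable M (?m n)" for n
  proof (induction n)
    case (Suc n)
    have "integrable M (\<lambda>x. F x + ?m n (T x))" using F compT[OF Suc] by auto
    then show ?case by (simp add: integrable_max)
  qed simp
  let ?E = "{x. \<exists>n. 0 < (\<Sum>i<n. F ((T ^^ i) x))}"
  have E: "x \<in> ?E \<longleftrightarrow> (\<exists>n. 0 < ?m n x)" for x
  proof
    assume "x \<in> ?E"
    then obtain n where n: "0 < (\<Sum>i<n. F ((T ^^ i) x))" by auto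
    have "0 < ?m n x" by (rule less_le_trans[OF n max_partial_sum_ge]) simp
    then show "\<exists>n. 0 < ?m n x" ..
  next
    assume "\<exists>n. 0 < ?m n x"
    then obtain n where n: "0 < ?m n x" ..
    obtain k where "?m n x = (\<Sum>i<k. F ((T ^^ i) x))" using max_partial_sum_attained[of n T F x] by blast
    then have "0 < (\<Sum>i<k. F ((T ^^ i) x))" using n by simp
    then show "x \<in> ?E" by blast
  qed
  have mono: "?m m x \<le> ?m n x" if "m \<le> n" for m n x
    by (rule lift_Suc_mono_le[of "\<lambda>n. ?m n x", OF max_partial_sum_mono that])
  have lim: "(\<lambda>n. \<integral>x. indicator {x. 0 < ?m n x} x * F x \<partial>M) \<longlonglongrightarrow> (\<integral>x. indicator ?E x * F x \<partial>M)"
  proof (rule integral_dominated_convergence[where w = "\<lambda>x. norm (F x)"])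
    show "AE x in M. (\<lambda>n. indicator {x. 0 < ?m n x} x * F x) \<longlonglongrightarrow> indicator ?E x * F x"
    proof (rule AE_I2)
      fix x
      show "(\<lambda>n. indicator {x. 0 < ?m n x} x * F x) \<longlonglongrightarrow> indicator ?E x * F x"
      proof (cases "x \<in> ?E")
        case True
        then obtain N where N: "0 < ?m N x" using E by auto
        have "\<forall>\<^sub>F n in sequentially. indicator {x. 0 < ?m n x} x * F x = indicator ?E x * F x"
          using eventually_ge_at_top[of N]
        proof eventually_elim
          case (elim n)
          then have "0 < ?m n x" using N mono[of N n x] by linarith
          then show ?case using True by (simp add: indicator_def)
        qed
        then show ?thesis by (rule tendsto_eventually)
      next
        case False
        then have "\<not> 0 < ?m n x" for n using E by auto
        then show ?thesis using False by (simp add: indicator_def)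
      qed
    qed
    show "AE x in M. norm (indicator {x. 0 < ?m n x} x * F x) \<le> norm (F x)" for n
      by (auto simp: indicator_def)
    show "(\<lambda>x. indicator ?E x * F x) \<in> borel_measurable M"
    proof -
      have "(\<lambda>x. indicator {x. \<exists>n. 0 < ?m n x} x * F x) \<in> borel_measurable M" by measurable
      moreover have "{x. \<exists>n. 0 < ?m n x} = ?E" using E by blast
      ultimately show ?thesis by simp
    qed
  qed (use F in auto)
  have "0 \<le> (\<integral>x. indicator {x. 0 < ?m n x} x * F x \<partial>M)" for n
  proof -
    have "0 = (\<integral>x. ?m n x - ?m n (T x) \<partial>M)"
      using compT[OF int[of n]] int[of n] by simp
    also have "\<dots> \<le> (\<integral>x. indicator {x. 0 < ?m n x} x * F x \<partial>M)"
    proof (rule integral_mono)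
      show "integrable M (\<lambda>x. ?m n x - ?m n (T x))" using compT[OF int[of n]] int[of n] by auto
      show "integrable M (\<lambda>x. indicator {x. 0 < ?m n x} x * F x)"
        by (rule Bochner_Integration.integrable_bound[OF F]) (auto simp: indicator_def)
      fix x
      show "?m n x - ?m n (T x) \<le> indicator {x. 0 < ?m n x} x * F x"
      proof (cases "0 < ?m n x")
        case True
        then obtain n' where n: "n = Suc n'" by (cases n) auto
        then have "?m n x = F x + ?m n' (T x)" using True by (auto simp: max_def split: if_splits)
        also have "\<dots> \<le> F x + ?m n (T x)" using max_partial_sum_mono[of T F n' "T x"] unfolding n by simp
        finally show ?thesis using True by simp
      qed (use max_partial_sum_nonneg[of T F n x] max_partial_sum_nonneg[of T F n "T x"] in auto)
    qed
    finally show ?thesis .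
  qed
  then show ?thesis by (intro LIMSEQ_le_const[OF lim]) auto
qed

definition ergodic_max :: "('a \<Rightarrow> 'a) \<Rightarrow> ('a \<Rightarrow> real) \<Rightarrow> 'a \<Rightarrow> ennreal" where
  "ergodic_max T g x = (SUP m\<in>{1..}. ennreal ((\<Sum>i<m. g ((T ^^ i) x)) / real m))"

lemma measurable_ergodic_max:
  assumes T: "T \<in> M \<rightarrow>\<^sub>M M" and g: "g \<in> borel_measurable M"
  shows "ergodic_max T g \<in> borel_measurable M"
proof -
  have [measurable]: "(\<lambda>x. g ((T ^^ i) x)) \<in> borel_measurable M" for i
    by (rule measurable_compose[OF measurable_funpow[OF T] g])
  show ?thesis unfolding ergodic_max_def[abs_def] by measurable
qed

lemma ergodic_max_ge:
  "m \<ge> 1 \<Longrightarrow> ennreal ((\<Sum>i<m. g ((T ^^ i) x)) / real m) \<le> ergodic_max T g x"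
  unfolding ergodic_max_def by (rule SUP_upper) simp

text \<open>The set in question is where some partial orbit sum of \<open>g - l\<close> is positive.\<close>
lemma ergodic_max_weak:
  assumes sys: "dynamical_system M T" and g[measurable]: "g \<in> borel_measurable M"
    and g0: "\<And>x. 0 \<le> g x" and l: "l > 0"
  shows "ennreal l * emeasure M {x \<in> space M. ennreal l < ergodic_max T g x} \<le> (\<integral>\<^sup>+ x. ennreal (g x) \<partial>M)"
proof (cases "(\<integral>\<^sup>+ x. ennreal (g x) \<partial>M) = \<infinity>")
  case False
  interpret prob_space M using dynamical_systemD(1)[OF sys] .
  have gi: "integrable M g" using False g0 by (intro integrableI_nonneg) (auto simp: less_top)
  let ?F = "\<lambda>x. g x - l"
  have F: "integrable M ?F" using gi by auto
  let ?E = "{x. \<exists>n. 0 < (\<Sum>i<n. ?F ((T ^^ i) x))}"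
  \<comment> \<open>A positive partial sum is not the empty one, so the index may start at \<open>0\<close>.\<close>
  have E: "x \<in> ?E \<longleftrightarrow> ennreal l < ergodic_max T g x" for x
  proof -
    have "ennreal l < ergodic_max T g x \<longleftrightarrow> (\<exists>m\<ge>1. ennreal l < ennreal ((\<Sum>i<m. g ((T ^^ i) x)) / real m))"
      unfolding ergodic_max_def less_SUP_iff by auto
    also have "\<dots> \<longleftrightarrow> (\<exists>m\<ge>1. real m * l < (\<Sum>i<m. g ((T ^^ i) x)))"
      using l by (intro ex_cong1 conj_cong refl) (auto simp: ennreal_less_iff field_simps)
    also have "\<dots> \<longleftrightarrow> (\<exists>m. 0 < (\<Sum>i<m. ?F ((T ^^ i) x)))"
    proof -
      have "(\<Sum>i<m. ?F ((T ^^ i) x)) = (\<Sum>i<m. g ((T ^^ i) x)) - real m * l" for m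
        by (simp add: sum_subtractf)
      moreover have "(real m * l < (\<Sum>i<m. g ((T ^^ i) x))) \<Longrightarrow> 1 \<le> m" for m by (cases m) auto
      ultimately show ?thesis by auto
    qed
    finally show ?thesis by simp
  qed
  let ?A = "{x \<in> space M. ennreal l < ergodic_max T g x}"
  have A[measurable]: "?A \<in> sets M"
    using measurable_ergodic_max[OF dynamical_systemD(2)[OF sys] g, measurable] by measurable
  have "0 \<le> (\<integral>x. indicator ?E x * ?F x \<partial>M)" by (rule maximal_ergodic[OF sys F])
  also have "\<dots> = (\<integral>x. indicator ?A x * ?F x \<partial>M)"
    using E by (intro Bochner_Integration.integral_cong refl) (auto simp: indicator_def)
  also have "\<dots> = (\<integral>x. indicator ?A x * g x \<partial>M) - (\<integral>x. indicator ?A x * l \<partial>M)"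
  proof (subst Bochner_Integration.integral_diff[symmetric])
    show "integrable M (\<lambda>x. indicator ?A x * g x)"
      by (rule Bochner_Integration.integrable_bound[OF gi]) (auto simp: indicator_def)
    show "integrable M (\<lambda>x. indicator ?A x * l)"
      by (rule Bochner_Integration.integrable_bound[of M "\<lambda>_. l"]) (auto simp: indicator_def)
  qed (simp add: right_diff_distrib)
  also have "(\<integral>x. indicator ?A x * l \<partial>M) = l * measure M ?A"
    using A by simp
  also have "(\<integral>x. indicator ?A x * g x \<partial>M) \<le> (\<integral>x. g x \<partial>M)"
  proof (rule integral_mono)
    show "integrable M (\<lambda>x. indicator ?A x * g x)"
      by (rule Bochner_Integration.integrable_bound[OF gi]) (auto simp: indicator_def)
  qed (use gi g0 in \<open>auto simp: indicator_def\<close>)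
  finally have "l * measure M ?A \<le> (\<integral>x. g x \<partial>M)" by simp
  then have "ennreal (l * measure M ?A) \<le> ennreal (\<integral>x. g x \<partial>M)" by (rule ennreal_leI)
  also have "ennreal (\<integral>x. g x \<partial>M) = (\<integral>\<^sup>+ x. ennreal (g x) \<partial>M)"
    using gi g0 by (intro nn_integral_eq_integral[symmetric]) auto
  finally show ?thesis using l by (simp add: ennreal_mult emeasure_eq_measure)
qed simp

text \<open>Values of \<open>g\<close> up to \<open>l/2\<close> contribute at most \<open>l/2\<close> to any average.\<close>
lemma ergodic_max_weak_truncated:
  assumes sys: "dynamical_system M T" and g[measurable]: "g \<in> borel_measurable M"
    and g0: "\<And>x. 0 \<le> g x" and l: "l > 0"
  shows "emeasure M {x \<in> space M. ennreal l < ergodic_max T g x}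
    \<le> ennreal (2 / l) * (\<integral>\<^sup>+ x. ennreal (g x) * indicator {x. l / 2 < g x} x \<partial>M)"
proof -
  define h where "h x = g x * indicator {x. l / 2 < g x} x" for x
  have h[measurable]: "h \<in> borel_measurable M" unfolding h_def by measurable
  have h0: "0 \<le> h x" for x by (simp add: h_def g0)
  have gh: "g x \<le> h x + l / 2" for x using l by (auto simp: h_def indicator_def)
  have sub: "ennreal (l / 2) < ergodic_max T h x" if gx: "ennreal l < ergodic_max T g x" for x
  proof -
    obtain m where m: "m \<ge> 1" "ennreal l < ennreal ((\<Sum>i<m. g ((T ^^ i) x)) / real m)"
      using gx unfolding ergodic_max_def less_SUP_iff by auto
    have "l < (\<Sum>i<m. g ((T ^^ i) x)) / real m" using m l by (auto simp: ennreal_less_iff)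
    also have "\<dots> \<le> (\<Sum>i<m. h ((T ^^ i) x) + l / 2) / real m"
      by (intro divide_right_mono sum_mono gh) simp
    also have "\<dots> = (\<Sum>i<m. h ((T ^^ i) x)) / real m + l / 2"
      using m by (simp add: sum.distrib add_divide_distrib)
    finally have "l / 2 < (\<Sum>i<m. h ((T ^^ i) x)) / real m" by linarith
    then have "ennreal (l / 2) < ennreal ((\<Sum>i<m. h ((T ^^ i) x)) / real m)"
      using l by (simp only: ennreal_less_iff)
    then show ?thesis using ergodic_max_ge[OF m(1)] by (rule less_le_trans)
  qed
  let ?A = "{x \<in> space M. ennreal (l / 2) < ergodic_max T h x}"
  have "emeasure M {x \<in> space M. ennreal l < ergodic_max T g x} \<le> emeasure M ?A"
    using measurable_ergodic_max[OF dynamical_systemD(2)[OF sys] h, measurable]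
    by (intro emeasure_mono) (use sub in auto)
  also have "\<dots> = ennreal (2 / l) * (ennreal (l / 2) * emeasure M ?A)"
    using l by (simp add: mult.assoc[symmetric] ennreal_mult[symmetric])
  also have "\<dots> \<le> ennreal (2 / l) * (\<integral>\<^sup>+ x. ennreal (h x) \<partial>M)"
    using l by (intro mult_left_mono ergodic_max_weak[OF sys h h0]) auto
  also have "(\<integral>\<^sup>+ x. ennreal (h x) \<partial>M) = (\<integral>\<^sup>+ x. ennreal (g x) * indicator {x. l / 2 < g x} x \<partial>M)"
    by (intro nn_integral_cong) (auto simp: h_def indicator_def)
  finally show ?thesis .
qed

text \<open>The value of the interpolation constant for \<open>K = 2\<close>, \<open>a = 1\<close>, \<open>c = 1/2\<close>, \<open>L = 0\<close>.\<close>
definition ergodic_const :: "real \<Rightarrow> real" where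
  "ergodic_const p = 2 * (1/2) powr (1 - p) * p / (p - 1)"

lemma ergodic_max_strong:
  assumes sys: "dynamical_system M T" and g[measurable]: "g \<in> borel_measurable M"
    and g0: "\<And>x. 0 \<le> g x" and p: "p > 1"
  shows "(\<integral>\<^sup>+ x. ennreal_powr (ergodic_max T g x) p \<partial>M) \<le> ennreal (ergodic_const p) * (\<integral>\<^sup>+ x. ennreal (g x powr p) \<partial>M)"
proof -
  have "(\<integral>\<^sup>+ x. ennreal_powr (ergodic_max T g x) p \<partial>M) \<le>
    ennreal (2 * (1/2) powr (1 - p) * p / (p - 1) + 0 * (1/2) powr ((p + 1) - p) * p / ((p + 1) - p)) * (\<integral>\<^sup>+ x. ennreal (g x powr p) \<partial>M)"
  proof (rule interpolation)
    fix l :: real assume l: "l > 0"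
    have e: "2 * l powr - 1 = 2 / l" "1 / 2 * l = l / 2" using l by (simp_all add: powr_minus_divide)
    have g1: "g x powr 1 = g x" for x using g0[of x] by simp
    have "emeasure M {x \<in> space M. ennreal l < ergodic_max T g x}
      \<le> ennreal (2 / l) * (\<integral>\<^sup>+ x. ennreal (g x) * indicator {x. l / 2 < g x} x \<partial>M)"
      by (rule ergodic_max_weak_truncated[OF sys g g0 l])
    then show "emeasure M {x \<in> space M. ennreal l < ergodic_max T g x} \<le>
      ennreal (2 * l powr - 1) * (\<integral>\<^sup>+ x. ennreal (g x powr 1) * indicator {x. 1 / 2 * l < g x} x \<partial>M) +
      ennreal (0 * l powr - (p + 1)) * (\<integral>\<^sup>+ x. ennreal (g x powr (p + 1)) * indicator {x. g x \<le> 1 / 2 * l} x \<partial>M)"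
      by (simp only: e g1 mult_zero_left ennreal_0 add_0_right)
  qed (use p g0 dynamical_systemD[OF sys] measurable_ergodic_max[OF dynamical_systemD(2)[OF sys] g] in auto)
  then show ?thesis by (simp add: ergodic_const_def)
qed

text \<open>The averages at \<open>T x\<close> and the shifted averages at \<open>x\<close> differ by \<open>O(1/n)\<close>.\<close>
lemma birkhoff_limits_invariant:
  fixes g :: "'a \<Rightarrow> real" and T :: "'a \<Rightarrow> 'a"
  defines "A \<equiv> \<lambda>x n. ereal ((\<Sum>i<n. g ((T ^^ i) x)) / real n)"
  assumes bd: "\<And>x. \<bar>g x\<bar> \<le> B"
  shows "limsup (A (T x)) = limsup (A x)" "liminf (A (T x)) = liminf (A x)"
proof -
  define d where "d n = ((\<Sum>i<n. g ((T ^^ i) (T x))) / real n) - ((\<Sum>i<n+1. g ((T ^^ i) x)) / real (n+1))" for n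
  have "d \<longlonglongrightarrow> 0"
  proof (rule Lim_null_comparison)
    show "(\<lambda>n. 2 * B / real n) \<longlonglongrightarrow> 0" by real_asymp
    show "\<forall>\<^sub>F n in sequentially. norm (d n) \<le> 2 * B / real n"
      using eventually_gt_at_top[of 0]
    proof eventually_elim
      case (elim n)
      define S where "S = (\<Sum>i<n. g ((T ^^ i) (T x)))"
      have S: "\<bar>S\<bar> \<le> real n * B"
      proof -
        have "\<bar>S\<bar> \<le> (\<Sum>i<n. \<bar>g ((T ^^ i) (T x))\<bar>)" unfolding S_def by (rule sum_abs)
        also have "\<dots> \<le> (\<Sum>i<n. B)" by (intro sum_mono bd)
        finally show ?thesis by simp
      qed
      have "d n = S / real n - (g x + S) / real (n + 1)"
        unfolding d_def S_def Suc_eq_plus1[symmetric] sum_orbit_Suc by simp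
      also have "\<dots> = (S / real n - g x) / real (n + 1)"
        using elim by (simp add: field_simps)
      finally have "\<bar>d n\<bar> = \<bar>S / real n - g x\<bar> / real (n + 1)" by (simp add: abs_divide)
      also have "\<dots> \<le> (2 * B) / real (n + 1)"
      proof (rule divide_right_mono)
        have "\<bar>S / real n\<bar> \<le> B" using S elim by (simp add: abs_divide field_simps)
        then show "\<bar>S / real n - g x\<bar> \<le> 2 * B" using bd[of x] by linarith
      qed simp
      also have "\<dots> \<le> 2 * B / real n"
        using elim bd[of x] by (intro divide_left_mono) auto
      finally show ?case by simp
    qed
  qed
  then have lim: "(\<lambda>n. ereal (d n)) \<longlonglongrightarrow> 0" unfolding zero_ereal_def by simp
  have eq: "A (T x) = (\<lambda>n. ereal (d n) + A x (n + 1))"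
    unfolding A_def d_def by auto
  show "limsup (A (T x)) = limsup (A x)"
    unfolding eq using ereal_limsup_lim_add[OF lim, of "\<lambda>n. A x (n + 1)"] limsup_shift[of "A x"] by simp
  show "liminf (A (T x)) = liminf (A x)"
    unfolding eq using ereal_liminf_lim_add[OF lim, of "\<lambda>n. A x (n + 1)"] liminf_shift[of "A x"] by simp
qed

text \<open>Apply the maximal ergodic theorem to \<open>F\<close> restricted to \<open>E\<close>: by invariance its orbit sums are those of \<open>F\<close>
  on \<open>E\<close> and vanish off \<open>E\<close>.\<close>
lemma maximal_ergodic_invariant_set:
  fixes F :: "'a \<Rightarrow> real"
  assumes sys: "dynamical_system M T" and F: "integrable M F" and E: "E \<in> sets M"
    and inv: "\<And>x. x \<in> space M \<Longrightarrow> T x \<in> E \<longleftrightarrow> x \<in> E"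
    and pos: "\<And>x. x \<in> E \<Longrightarrow> \<exists>n. 0 < (\<Sum>i<n. F ((T ^^ i) x))"
  shows "0 \<le> (\<integral>x. indicator E x * F x \<partial>M)"
proof -
  let ?G = "\<lambda>x. indicator E x * F x"
  have G: "integrable M ?G"
    by (rule Bochner_Integration.integrable_bound[OF F])
       (use E borel_measurable_integrable[OF F] in \<open>auto simp: indicator_def\<close>)
  have "0 \<le> (\<integral>x. indicator {x. \<exists>n. 0 < (\<Sum>i<n. ?G ((T ^^ i) x))} x * ?G x \<partial>M)"
    by (rule maximal_ergodic[OF sys G])
  also have "\<dots> = (\<integral>x. ?G x \<partial>M)"
  proof (intro Bochner_Integration.integral_cong refl)
    fix x assume x: "x \<in> space M"
    have iter: "(T ^^ i) x \<in> E \<longleftrightarrow> x \<in> E" for i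
    proof (induction i)
      case (Suc i)
      have "(T ^^ i) x \<in> space M"
        using measurable_space[OF measurable_funpow[OF dynamical_systemD(2)[OF sys]] x] .
      then show ?case using inv[of "(T ^^ i) x"] Suc by simp
    qed simp
    show "indicator {x. \<exists>n. 0 < (\<Sum>i<n. ?G ((T ^^ i) x))} x * ?G x = ?G x"
    proof (cases "x \<in> E")
      case True
      then have "(\<Sum>i<n. ?G ((T ^^ i) x)) = (\<Sum>i<n. F ((T ^^ i) x))" for n using iter by simp
      then show ?thesis using pos[OF True] by simp
    qed simp
  qed
  finally show ?thesis .
qed

text \<open>If \<open>a < b\<close>, the set where the lower limit is below \<open>a\<close> and the upper limit above \<open>b\<close> is invariant. The
  maximal ergodic theorem on this set, for \<open>g - b\<close> and for \<open>a - g\<close>, shows that \<open>a - b\<close> has a nonnegative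
  integral over it, so it is a null set.\<close>
theorem birkhoff_bounded_real:
  fixes g :: "'a \<Rightarrow> real"
  assumes sys: "dynamical_system M T" and g[measurable]: "g \<in> borel_measurable M" and bd: "\<And>x. \<bar>g x\<bar> \<le> B"
  shows "AE x in M. convergent (\<lambda>n. (\<Sum>i<n. g ((T ^^ i) x)) / real n)"
proof -
  interpret prob_space M using dynamical_systemD(1)[OF sys] .
  note T = dynamical_systemD(2)[OF sys]
  define A where "A x n = (\<Sum>i<n. g ((T ^^ i) x)) / real n" for x n
  have [measurable]: "(\<lambda>x. g ((T ^^ i) x)) \<in> borel_measurable M" for i
    by (rule measurable_compose[OF measurable_funpow[OF T] g])
  have [measurable]: "(\<lambda>x. A x n) \<in> borel_measurable M" for n unfolding A_def by measurable
  let ?S = "\<lambda>x. limsup (\<lambda>n. ereal (A x n))" and ?I = "\<lambda>x. liminf (\<lambda>n. ereal (A x n))"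
  have gi: "integrable M g" by (rule integrable_const_bound[of _ B]) (use bd in auto)
  have inv: "?S (T x) = ?S x" "?I (T x) = ?I x" for x
    using birkhoff_limits_invariant[of g B T x] bd unfolding A_def by auto
  have null: "AE x in M. \<not> (?I x < ereal a \<and> ereal b < ?S x)" if ab: "a < b" for a b
  proof -
    define E where "E = {x \<in> space M. ?I x < ereal a \<and> ereal b < ?S x}"
    have E[measurable]: "E \<in> sets M" unfolding E_def by measurable
    have Einv: "T x \<in> E \<longleftrightarrow> x \<in> E" if "x \<in> space M" for x
      using inv that measurable_space[OF T that] by (simp add: E_def)
    have 1: "0 \<le> (\<integral>x. indicator E x * (g x - b) \<partial>M)"
    proof (rule maximal_ergodic_invariant_set[OF sys _ E Einv])
      fix x assume "x \<in> E"
      then have "ereal b < ?S x" by (simp add: E_def)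
      also have "?S x \<le> (SUP n\<in>{1..}. ereal (A x n))"
        unfolding limsup_INF_SUP by (rule INF_lower) simp
      finally obtain n where n: "n > 0" "b < A x n" by (auto simp: less_SUP_iff Suc_le_eq)
      then have "0 < (\<Sum>i<n. g ((T ^^ i) x) - b)" by (simp add: A_def sum_subtractf field_simps)
      then show "\<exists>n. 0 < (\<Sum>i<n. g ((T ^^ i) x) - b)" ..
    qed (use gi in auto)
    have 2: "0 \<le> (\<integral>x. indicator E x * (a - g x) \<partial>M)"
    proof (rule maximal_ergodic_invariant_set[OF sys _ E Einv])
      fix x assume "x \<in> E"
      then have "?I x < ereal a" by (simp add: E_def)
      then have "\<exists>n>0. ereal (A x n) < ereal a" by (rule liminf_upper_bound)
      then obtain n where n: "n > 0" "A x n < a" by auto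
      then have "0 < (\<Sum>i<n. a - g ((T ^^ i) x))" by (simp add: A_def sum_subtractf field_simps)
      then show "\<exists>n. 0 < (\<Sum>i<n. a - g ((T ^^ i) x))" ..
    qed (use gi in auto)
    have i: "integrable M (\<lambda>x. indicator E x * (g x - b))" "integrable M (\<lambda>x. indicator E x * (a - g x))"
      by (rule Bochner_Integration.integrable_bound[of M "\<lambda>x. \<bar>g x\<bar> + \<bar>a\<bar> + \<bar>b\<bar>"];
          use gi in \<open>auto simp: indicator_def\<close>)+
    have "0 \<le> (\<integral>x. indicator E x * (g x - b) + indicator E x * (a - g x) \<partial>M)"
      using 1 2 i by (subst Bochner_Integration.integral_add) auto
    also have "\<dots> = (\<integral>x. indicator E x * (a - b) \<partial>M)"
      by (intro Bochner_Integration.integral_cong) (auto simp: algebra_simps)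
    also have "\<dots> = measure M E * (a - b)" using E by simp
    finally have "measure M E = 0" using ab measure_nonneg[of M E] by (simp add: zero_le_mult_iff)
    then have "emeasure M E = 0" by (simp add: emeasure_eq_measure)
    then have "AE x in M. x \<notin> E" using E by (intro AE_not_in) (auto simp: null_sets_def)
    then show ?thesis by (auto simp: E_def)
  qed
  have "AE x in M. \<forall>a b :: rat. a < b \<longrightarrow> \<not> (?I x < ereal (of_rat a) \<and> ereal (of_rat b) < ?S x)"
    unfolding AE_all_countable
  proof (intro allI)
    fix a b :: rat
    show "AE x in M. a < b \<longrightarrow> \<not> (?I x < ereal (of_rat a) \<and> ereal (of_rat b) < ?S x)"
      using null[of "of_rat a" "of_rat b"] by (cases "a < b") (auto simp: of_rat_less)
  qed
  then show ?thesis
  proof (rule AE_mp, intro AE_I2 impI)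
    fix x assume *: "\<forall>a b :: rat. a < b \<longrightarrow> \<not> (?I x < ereal (of_rat a) \<and> ereal (of_rat b) < ?S x)"
    have "?I x = ?S x"
    proof (rule antisym)
      show "?I x \<le> ?S x" by (rule Liminf_le_Limsup) simp
      show "?S x \<le> ?I x"
      proof (rule ccontr)
        assume "\<not> ?S x \<le> ?I x"
        then have lt: "?I x < ?S x" by simp
        obtain c where c: "?I x < ereal c" "ereal c < ?S x" using ereal_dense2[OF lt] by auto
        obtain c' where c': "ereal c < ereal c'" "ereal c' < ?S x" using ereal_dense2[OF c(2)] by auto
        obtain c'' where c'': "ereal c' < ereal c''" "ereal c'' < ?S x" using ereal_dense2[OF c'(2)] by auto
        have "c < c'" "c' < c''" using c' c'' by auto
        then obtain a b :: rat where ab: "c < of_rat a" "of_rat a < c'" "c' < of_rat b" "of_rat b < c''"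
          using of_rat_dense by meson
        have "real_of_rat a < real_of_rat b" using ab by linarith
        then have "a < b" by (simp add: of_rat_less)
        moreover have "?I x < ereal (of_rat a)" by (rule less_trans[OF c(1)]) (use ab in simp)
        moreover have "ereal (of_rat b) < ?S x" by (rule less_trans[OF _ c''(2)]) (use ab in simp)
        ultimately show False using * by blast
      qed
    qed
    then obtain L where L: "(\<lambda>n. ereal (A x n)) \<longlonglongrightarrow> L"
      using tendsto_iff_Liminf_eq_Limsup[of sequentially "\<lambda>n. ereal (A x n)"] by auto
    have A: "\<bar>A x n\<bar> \<le> B" for n
    proof (cases "n = 0")
      case False
      have "\<bar>\<Sum>i<n. g ((T ^^ i) x)\<bar> \<le> (\<Sum>i<n. \<bar>g ((T ^^ i) x)\<bar>)" by (rule sum_abs)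
      also have "\<dots> \<le> (\<Sum>i<n. B)" by (intro sum_mono bd)
      finally show ?thesis using False by (simp add: A_def abs_divide field_simps)
    qed (use bd[of x] in \<open>simp add: A_def\<close>)
    have "ereal (- B) \<le> L" by (rule LIMSEQ_le_const[OF L]) (use A in \<open>auto simp: abs_le_iff minus_le_iff\<close>)
    moreover have "L \<le> ereal B" by (rule LIMSEQ_le_const2[OF L]) (use A in \<open>auto simp: abs_le_iff\<close>)
    ultimately obtain l where "L = ereal l" by (cases L) auto
    then have "A x \<longlonglongrightarrow> l" using L by simp
    then show "convergent (\<lambda>n. (\<Sum>i<n. g ((T ^^ i) x)) / real n)"
      unfolding A_def convergent_def by blast
  qed
qed

theorem birkhoff_bounded:
  fixes g :: "'a \<Rightarrow> complex"
  assumes sys: "dynamical_system M T" and g[measurable]: "g \<in> borel_measurable M" and bd: "\<And>x. norm (g x) \<le> B"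
  shows "AE x in M. convergent (\<lambda>n. (\<Sum>i<n. g ((T ^^ i) x)) / of_nat n)"
proof -
  have "AE x in M. convergent (\<lambda>n. (\<Sum>i<n. Re (g ((T ^^ i) x))) / real n)"
    by (rule birkhoff_bounded_real[OF sys, of "\<lambda>x. Re (g x)" B])
       (use bd abs_Re_le_cmod order_trans in \<open>auto, blast\<close>)
  moreover have "AE x in M. convergent (\<lambda>n. (\<Sum>i<n. Im (g ((T ^^ i) x))) / real n)"
    by (rule birkhoff_bounded_real[OF sys, of "\<lambda>x. Im (g x)" B])
       (use bd abs_Im_le_cmod order_trans in \<open>auto, blast\<close>)
  ultimately show ?thesis
  proof eventually_elim
    case (elim x)
    then obtain a b where "(\<lambda>n. (\<Sum>i<n. Re (g ((T ^^ i) x))) / real n) \<longlonglongrightarrow> a"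
      "(\<lambda>n. (\<Sum>i<n. Im (g ((T ^^ i) x))) / real n) \<longlonglongrightarrow> b"
      by (auto simp: convergent_def)
    then have "(\<lambda>n. (\<Sum>i<n. g ((T ^^ i) x)) / of_nat n) \<longlonglongrightarrow> Complex a b"
      by (intro tendsto_complex_iff[THEN iffD2]) simp
    then show ?case by (auto simp: convergent_def)
  qed
qed

section \<open>Dyadic components of the truncated divisor function\<close>

text \<open>A convex combination, with weights proportional to \<open>1/m\<close>, of cut-off blocks. All bounds that hold for
  blocks uniformly in the cut-off therefore pass to components with the same constants.\<close>
definition ramanujan_component :: "nat \<Rightarrow> nat \<Rightarrow> nat \<Rightarrow> complex" where
  "ramanujan_component s N k = (\<Sum>m=1..N. ramanujan_block s (N div m) k / of_nat m) / of_real (harm N)"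

lemma norm_harmonic_mean_le:
  fixes v :: "nat \<Rightarrow> complex"
  assumes "\<And>m. m \<in> {1..N} \<Longrightarrow> norm (v m) \<le> C" "0 \<le> C"
  shows "norm ((\<Sum>m=1..N. v m / of_nat m) / of_real (harm N)) \<le> C"
proof (cases "N = 0")
  case False
  then have h: "harm N > (0::real)" by simp
  have "norm (\<Sum>m=1..N. v m / of_nat m) \<le> (\<Sum>m=1..N. C * inverse (real m))"
    by (rule sum_norm_le) (use assms(1) in \<open>auto simp: norm_divide divide_inverse[symmetric] intro!: divide_right_mono\<close>)
  also have "\<dots> = C * harm N" by (simp add: harm_def sum_distrib_left)
  finally show ?thesis using h by (simp add: norm_divide pos_divide_le_eq)
qed (use assms in simp)

lemma ramanujan_component_eq_0:
  assumes "N < 2 ^ s"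
  shows "ramanujan_component s N k = 0"
proof -
  have "ramanujan_block s (N div m) k = 0" for m
    by (rule ramanujan_block_eq_0) (rule le_less_trans[OF div_le_dividend assms])
  then show ?thesis by (simp add: ramanujan_component_def)
qed

lemma sum_ramanujan_components:
  assumes "N < 2 ^ S"
  shows "(\<Sum>s<S. ramanujan_component s N k) = of_nat (divisors_upto N k) / of_real (harm N)"
proof -
  have "(\<Sum>s<S. ramanujan_component s N k) =
      (\<Sum>m=1..N. (\<Sum>s<S. ramanujan_block s (N div m) k) / of_nat m) / of_real (harm N)"
    unfolding ramanujan_component_def sum_divide_distrib[symmetric]
    by (subst sum.swap) (simp add: sum_divide_distrib)
  moreover have blocks: "(\<Sum>s<S. ramanujan_block s (N div m) k) = (\<Sum>q=1..N div m. ramanujan_sum q k / of_nat q)" for m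
  proof -
    have "{1..<2^S} \<inter> {..N div m} = {1..N div m}"
      using le_less_trans[OF div_le_dividend[of N m] assms] by auto
    then show ?thesis by (simp only: sum_ramanujan_blocks)
  qed
  ultimately show ?thesis by (simp only: divisors_upto_ramanujan blocks)
qed

lemma norm_ramanujan_component_le:
  "norm (ramanujan_component s N k) \<le> harm (2 ^ Suc s) * real (divisors_upto (2 ^ Suc s) k)"
  unfolding ramanujan_component_def
  by (intro norm_harmonic_mean_le norm_ramanujan_block_le mult_nonneg_nonneg harm_nonneg) simp

lemma block_gain_pos: "block_gain s > 0"
  by (simp add: block_gain_def add_nonneg_pos)

lemma norm_ramanujan_component_exponential_sum_le:
  assumes "4 ^ s \<le> n"
  shows "norm (\<Sum>k=1..n. ramanujan_component s N k * e (of_nat k * \<alpha>)) \<le> block_gain s * real n"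
proof -
  have "(\<Sum>k=1..n. ramanujan_component s N k * e (of_nat k * \<alpha>)) =
    (\<Sum>m=1..N. (\<Sum>k=1..n. ramanujan_block s (N div m) k * e (of_nat k * \<alpha>)) / of_nat m) / of_real (harm N)"
    unfolding ramanujan_component_def sum_divide_distrib sum_distrib_right
    by (subst sum.swap) simp
  also have "norm \<dots> \<le> block_gain s * real n"
    using less_imp_le[OF block_gain_pos] by (intro norm_harmonic_mean_le norm_ramanujan_block_exponential_sum_le assms) auto
  finally show ?thesis .
qed

section \<open>Weighted averages along orbits\<close>

definition orbit_average :: "('a \<Rightarrow> 'a) \<Rightarrow> ('a \<Rightarrow> complex) \<Rightarrow> (nat \<Rightarrow> complex) \<Rightarrow> nat \<Rightarrow> 'a \<Rightarrow> complex" where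
  "orbit_average T f c n x = (\<Sum>k=1..n. c k * f ((T ^^ k) x)) / of_nat n"

lemma measurable_iterate:
  assumes "T \<in> M \<rightarrow>\<^sub>M M" "f \<in> borel_measurable M"
  shows "(\<lambda>x. f ((T ^^ k) x)) \<in> borel_measurable M"
  by (rule measurable_compose[OF measurable_funpow[OF assms(1)] assms(2)])

lemma measurable_orbit_average:
  assumes "T \<in> M \<rightarrow>\<^sub>M M" "f \<in> borel_measurable M"
  shows "(\<lambda>x. orbit_average T f c n x) \<in> borel_measurable M"
  using measurable_iterate[OF assms, measurable] unfolding orbit_average_def by measurable

text \<open>Removes the boundary effect \<open>c\<close> of the transference argument by averaging over longer and longer orbits.\<close>
lemma ennreal_le_by_ratio_limit:
  assumes "\<And>L::nat. L > 0 \<Longrightarrow> ennreal (real L) * V \<le> ennreal (D * (real L + c)) * I" and "D > 0" "c \<ge> 0"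
  shows "V \<le> ennreal D * I"
proof (cases I)
  case (real i)
  have V: "V \<noteq> \<infinity>"
  proof
    assume "V = \<infinity>"
    then show False using assms(1)[of 1] assms(2,3) real by (simp add: ennreal_mult_top top_unique ennreal_mult[symmetric])
  qed
  then obtain v where v: "V = ennreal v" "0 \<le> v" by (cases V) auto
  have "v \<le> D * i"
  proof (rule LIMSEQ_le_const)
    show "(\<lambda>L. D * (1 + c / real L) * i) \<longlonglongrightarrow> D * i"
    proof -
      have "(\<lambda>L. D * (1 + c / real L) * i) \<longlonglongrightarrow> D * (1 + 0) * i"
        by (intro tendsto_intros lim_const_over_n)
      then show ?thesis by simp
    qed
    have "v \<le> D * (1 + c / real L) * i" if "L > 0" for L
    proof -
      have "ennreal (real L * v) \<le> ennreal (D * (real L + c) * i)"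
        using assms(1)[OF that] assms(2,3) v real by (simp add: ennreal_mult)
      then have "real L * v \<le> D * (real L + c) * i"
        using assms real by (subst (asm) ennreal_le_iff) auto
      then show ?thesis using that by (simp add: field_simps)
    qed
    then show "\<exists>N. \<forall>L\<ge>N. v \<le> D * (1 + c / real L) * i" by (intro exI[of _ 1]) auto
  qed
  then show ?thesis using v real assms(2) by (simp add: ennreal_mult[symmetric] ennreal_leI)
qed (use assms in \<open>simp add: ennreal_mult_top\<close>)

text \<open>Calderon's transference: the bound on the multiplier controls the averages along orbit segments of length
  \<open>L\<close>, invariance of the measure makes all points of the segment equivalent, and \<open>L\<close> tends to infinity.\<close>
lemma orbit_average_L2:
  assumes sys: "dynamical_system M T" and f[measurable]: "f \<in> borel_measurable M"
    and B: "B > 0" "\<And>\<alpha>. norm (\<Sum>k=1..n. c k * e (of_nat k * \<alpha>)) \<le> B * real n" and n: "n \<ge> 1"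
  shows "(\<integral>\<^sup>+ x. ennreal ((norm (orbit_average T f c n x))\<^sup>2) \<partial>M) \<le> ennreal (B\<^sup>2) * (\<integral>\<^sup>+ x. ennreal ((norm (f x))\<^sup>2) \<partial>M)"
proof -
  note T[measurable] = dynamical_systemD(2)[OF sys]
  note [measurable] = measurable_orbit_average[OF T f] measurable_iterate[OF T f]
  let ?A = "\<lambda>x. orbit_average T f c n x"
  define V where "V = (\<integral>\<^sup>+ x. ennreal ((norm (?A x))\<^sup>2) \<partial>M)"
  define I where "I = (\<integral>\<^sup>+ x. ennreal ((norm (f x))\<^sup>2) \<partial>M)"
  have "V \<le> ennreal (B\<^sup>2) * I"
  proof (rule ennreal_le_by_ratio_limit)
    fix L :: nat assume "L > 0"
    have iterA: "(\<integral>\<^sup>+ x. ennreal ((norm (?A ((T ^^ j) x)))\<^sup>2) \<partial>M) = V" for j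
      unfolding V_def by (rule nn_integral_invariant[OF sys, of "\<lambda>x. ennreal ((norm (?A x))\<^sup>2)"]) measurable
    have iterf: "(\<integral>\<^sup>+ x. ennreal ((norm (f ((T ^^ j) x)))\<^sup>2) \<partial>M) = I" for j
      unfolding I_def by (rule nn_integral_invariant[OF sys, of "\<lambda>x. ennreal ((norm (f x))\<^sup>2)"]) measurable
    have "ennreal (real L) * V = (\<Sum>j<L. V)" by (simp add: ennreal_of_nat_eq_real_of_nat)
    also have "\<dots> = (\<Sum>j<L. (\<integral>\<^sup>+ x. ennreal ((norm (?A ((T ^^ j) x)))\<^sup>2) \<partial>M))" by (simp only: iterA)
    also have "\<dots> = (\<integral>\<^sup>+ x. (\<Sum>j<L. ennreal ((norm (?A ((T ^^ j) x)))\<^sup>2)) \<partial>M)"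
      by (subst nn_integral_sum) (auto intro!: measurable_compose[OF measurable_funpow[OF T]])
    also have "\<dots> \<le> (\<integral>\<^sup>+ x. ennreal (B\<^sup>2) * (\<Sum>j<L + n + 1. ennreal ((norm (f ((T ^^ j) x)))\<^sup>2)) \<partial>M)"
    proof (rule nn_integral_mono)
      fix x
      have A: "(norm (?A ((T ^^ j) x)))\<^sup>2 = (norm (\<Sum>k=1..n. c k * f ((T ^^ (j + k)) x)))\<^sup>2 / (real n)\<^sup>2" for j
      proof -
        have "(T ^^ k) ((T ^^ j) x) = (T ^^ (j + k)) x" for k
          by (simp only: add.commute[of j k] funpow_add o_apply)
        then show ?thesis by (simp add: orbit_average_def norm_divide power_divide)
      qed
      have "(\<Sum>j<L. (norm (?A ((T ^^ j) x)))\<^sup>2) = (\<Sum>j<L. (norm (\<Sum>k=1..n. c k * f ((T ^^ (j + k)) x)))\<^sup>2) / (real n)\<^sup>2"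
        by (simp only: A sum_divide_distrib)
      also have "\<dots> \<le> ((B * real n)\<^sup>2 * (\<Sum>j<L + n + 1. (norm (f ((T ^^ j) x)))\<^sup>2)) / (real n)\<^sup>2"
        by (intro divide_right_mono convolution_square_bound[where F = "\<lambda>j. f ((T ^^ j) x)"] B) simp
      also have "\<dots> = B\<^sup>2 * (\<Sum>j<L + n + 1. (norm (f ((T ^^ j) x)))\<^sup>2)"
        using n by (simp add: power_mult_distrib)
      finally have "ennreal (\<Sum>j<L. (norm (?A ((T ^^ j) x)))\<^sup>2) \<le> ennreal (B\<^sup>2 * (\<Sum>j<L + n + 1. (norm (f ((T ^^ j) x)))\<^sup>2))"
        by (rule ennreal_leI)
      then show "(\<Sum>j<L. ennreal ((norm (?A ((T ^^ j) x)))\<^sup>2)) \<le> ennreal (B\<^sup>2) * (\<Sum>j<L + n + 1. ennreal ((norm (f ((T ^^ j) x)))\<^sup>2))"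
        by (simp only: sum_ennreal ennreal_mult zero_le_power2 sum_nonneg)
    qed
    also have "\<dots> = ennreal (B\<^sup>2) * (\<Sum>j<L + n + 1. (\<integral>\<^sup>+ x. ennreal ((norm (f ((T ^^ j) x)))\<^sup>2) \<partial>M))"
      by (subst nn_integral_cmult, measurable) (subst nn_integral_sum, auto)
    also have "\<dots> = ennreal (B\<^sup>2) * (of_nat (L + n + 1) * I)" by (simp only: iterf sum_constant card_lessThan)
    also have "\<dots> = ennreal (B\<^sup>2 * (real L + real (n + 1))) * I"
    proof -
      have "(of_nat (L + n + 1) :: ennreal) = ennreal (real L + real (n + 1))"
        by (simp only: ennreal_of_nat_eq_real_of_nat of_nat_add add.assoc)
      moreover have "ennreal (B\<^sup>2 * (real L + real (n + 1))) = ennreal (B\<^sup>2) * ennreal (real L + real (n + 1))"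
        by (rule ennreal_mult) auto
      ultimately show ?thesis by (simp only: mult.assoc)
    qed
    finally show "ennreal (real L) * V \<le> ennreal (B\<^sup>2 * (real L + real (n + 1))) * I" .
  qed (use B in auto)
  then show ?thesis by (simp only: V_def I_def)
qed

lemma sum_periodic_blocks:
  fixes c :: "nat \<Rightarrow> complex"
  assumes per: "\<And>k i. c (k + i * Q) = c k"
  shows "(\<Sum>k=1..m * Q. c k * f ((T ^^ k) x)) = (\<Sum>i<m. \<Sum>k=1..Q. c k * f ((T ^^ k) (((T ^^ Q) ^^ i) x)))"
proof (induction m)
  case (Suc m)
  have "{1..Suc m * Q} = {1..m * Q} \<union> {m * Q + 1..m * Q + Q}" by auto
  then have "(\<Sum>k=1..Suc m * Q. c k * f ((T ^^ k) x)) =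
      (\<Sum>k=1..m * Q. c k * f ((T ^^ k) x)) + (\<Sum>k=m * Q + 1..m * Q + Q. c k * f ((T ^^ k) x))"
    by (simp only:) (subst sum.union_disjoint, auto)
  also have "(\<Sum>k=m * Q + 1..m * Q + Q. c k * f ((T ^^ k) x)) = (\<Sum>k=1..Q. c k * f ((T ^^ k) (((T ^^ Q) ^^ m) x)))"
  proof (rule sum.reindex_bij_witness[where i = "\<lambda>k. k + m * Q" and j = "\<lambda>k. k - m * Q"])
    fix k assume "k \<in> {m * Q + 1..m * Q + Q}"
    then have k: "k = (k - m * Q) + m * Q" by simp
    have "c k = c (k - m * Q)" using per[of "k - m * Q" m] k by simp
    moreover have "(T ^^ k) x = (T ^^ (k - m * Q)) (((T ^^ Q) ^^ m) x)"
      by (subst k, subst funpow_add) (simp add: funpow_mult mult.commute)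
    ultimately show "c (k - m * Q) * f ((T ^^ (k - m * Q)) (((T ^^ Q) ^^ m) x)) = c k * f ((T ^^ k) x)" by simp
  qed auto
  finally show ?case using Suc by simp
qed simp

text \<open>Complete periods form an ergodic average of \<open>T\<^sup>Q\<close>; less than one period remains.\<close>
lemma orbit_average_periodic_split:
  fixes c :: "nat \<Rightarrow> complex"
  assumes per: "\<And>k i. c (k + i * Q) = c k" and Q: "Q > 0"
  shows "orbit_average T f c n x =
    (of_nat (n div Q) * of_nat Q / of_nat n) * ((\<Sum>i<n div Q. orbit_average T f c Q (((T ^^ Q) ^^ i) x)) / of_nat (n div Q))
    + (\<Sum>k\<in>{n div Q * Q<..n}. c k * f ((T ^^ k) x)) / of_nat n"
proof -
  have "{1..n} = {1..w} \<union> {w<..n}" if "w \<le> n" for w :: nat using that by auto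
  from this[of "n div Q * Q"] have "{1..n} = {1..n div Q * Q} \<union> {n div Q * Q<..n}" by simp
  then have "(\<Sum>k=1..n. c k * f ((T ^^ k) x)) =
      (\<Sum>k=1..n div Q * Q. c k * f ((T ^^ k) x)) + (\<Sum>k\<in>{n div Q * Q<..n}. c k * f ((T ^^ k) x))"
    by (simp only:) (subst sum.union_disjoint, auto)
  also have "(\<Sum>k=1..n div Q * Q. c k * f ((T ^^ k) x)) = of_nat Q * (\<Sum>i<n div Q. orbit_average T f c Q (((T ^^ Q) ^^ i) x))"
    unfolding sum_periodic_blocks[OF per] orbit_average_def using Q by (simp add: sum_divide_distrib[symmetric])
  finally show ?thesis
    unfolding orbit_average_def[of T f c n x]
    by (cases "n div Q = 0") (simp_all add: add_divide_distrib)
qed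

section \<open>The maximal function of a component in the mean square\<close>

text \<open>Rounding up keeps \<open>lacunary \<rho> j \<ge> \<rho>\<^sup>j\<close>, so sums and counts over the sequence compare with those over the
  powers of \<open>\<rho>\<close>.\<close>
definition lacunary :: "real \<Rightarrow> nat \<Rightarrow> nat" where
  "lacunary \<rho> j = nat \<lceil>\<rho> ^ j\<rceil>"

definition component_average :: "('a \<Rightarrow> 'a) \<Rightarrow> ('a \<Rightarrow> complex) \<Rightarrow> nat \<Rightarrow> nat \<Rightarrow> 'a \<Rightarrow> complex" where
  "component_average T f s n = orbit_average T f (ramanujan_component s (floor_sqrt n)) n"

definition component_max :: "real \<Rightarrow> ('a \<Rightarrow> 'a) \<Rightarrow> ('a \<Rightarrow> complex) \<Rightarrow> nat \<Rightarrow> 'a \<Rightarrow> ennreal" where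
  "component_max \<rho> T f s x = (SUP j. ennreal (norm (component_average T f s (lacunary \<rho> j) x)))"

lemma measurable_component_average:
  assumes "T \<in> M \<rightarrow>\<^sub>M M" "f \<in> borel_measurable M"
  shows "(\<lambda>x. component_average T f s n x) \<in> borel_measurable M"
  unfolding component_average_def by (rule measurable_orbit_average[OF assms])

lemma measurable_component_max:
  assumes "T \<in> M \<rightarrow>\<^sub>M M" "f \<in> borel_measurable M"
  shows "component_max \<rho> T f s \<in> borel_measurable M"
  using measurable_component_average[OF assms, measurable]
  unfolding component_max_def[abs_def] by measurable

lemma lacunary_ge: "\<rho> ^ j \<le> real (lacunary \<rho> j)"
  unfolding lacunary_def by (rule real_nat_ceiling_ge)

lemma lacunary_pos: "\<rho> > 1 \<Longrightarrow> lacunary \<rho> j \<ge> 1"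
  using lacunary_ge[of \<rho> j] one_le_power[of \<rho> j] by linarith

text \<open>The component \<open>s\<close> enters only when \<open>\<lfloor>\<surd>n\<rfloor> \<ge> 2\<^sup>s\<close>, which is the range in which the bound for exponential
  sums is valid.\<close>
lemma component_average_eq_0:
  assumes "n < 4 ^ s"
  shows "component_average T f s n x = 0"
proof -
  have "floor_sqrt n < 2 ^ s"
  proof (rule ccontr)
    assume "\<not> floor_sqrt n < 2 ^ s"
    then have "(2 ^ s)\<^sup>2 \<le> n" by (simp add: le_floor_sqrt_iff[symmetric])
    moreover have "(2 ^ s)\<^sup>2 = (4 ^ s :: nat)" by (simp add: power2_eq_square power_mult_distrib[symmetric])
    ultimately show False using assms by simp
  qed
  then show ?thesis by (simp add: component_average_def orbit_average_def ramanujan_component_eq_0)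
qed

lemma component_average_L2:
  assumes sys: "dynamical_system M T" and f: "f \<in> borel_measurable M" and n: "4 ^ s \<le> n"
  shows "(\<integral>\<^sup>+ x. ennreal ((norm (component_average T f s n x))\<^sup>2) \<partial>M) \<le> ennreal ((block_gain s)\<^sup>2) * (\<integral>\<^sup>+ x. ennreal ((norm (f x))\<^sup>2) \<partial>M)"
proof -
  have "n \<ge> 1" using n one_le_power[of "4::nat" s] by linarith
  then show ?thesis unfolding component_average_def
    using norm_ramanujan_component_exponential_sum_le[OF n] by (intro orbit_average_L2 sys f block_gain_pos) auto
qed

text \<open>A common multiple of all denominators below \<open>2\<^sup>s\<^sup>+\<^sup>1\<close>; the factorial is a crude choice, but its logarithm
  exceeds that of the least common multiple only by a factor \<open>O(s)\<close>.\<close>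
definition component_period :: "nat \<Rightarrow> nat" where
  "component_period s = fact (2 ^ Suc s)"

text \<open>Beyond the period, the cut-off of the component still depends on \<open>n\<close>; taking the maximum over all \<open>2\<^sup>s\<close>
  cut-offs removes this dependence.\<close>
definition block_average_max :: "('a \<Rightarrow> 'a) \<Rightarrow> ('a \<Rightarrow> complex) \<Rightarrow> nat \<Rightarrow> 'a \<Rightarrow> ennreal" where
  "block_average_max T f s x = Max ((\<lambda>u. ergodic_max (T ^^ component_period s)
     (\<lambda>y. norm (orbit_average T f (ramanujan_block s u) (component_period s) y)) x) ` {2^s..<2^Suc s})"

text \<open>The contribution of the last incomplete period, with \<open>2\<^sup>s\<close> as a bound for the block.\<close>
definition orbit_tail :: "('a \<Rightarrow> 'a) \<Rightarrow> ('a \<Rightarrow> complex) \<Rightarrow> nat \<Rightarrow> nat \<Rightarrow> 'a \<Rightarrow> real" where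
  "orbit_tail T f s n x = 2 ^ s * (\<Sum>k\<in>{n div component_period s * component_period s<..n}. norm (f ((T ^^ k) x))) / real n"

lemma component_period_pos: "component_period s > 0"
  by (simp add: component_period_def)

lemma component_period_ge: "4 ^ s \<le> component_period s"
proof (induction s)
  case (Suc s)
  have "2 \<le> (2 ^ Suc s :: nat)" "0 < (2 ^ s :: nat)" by auto
  then have "4 * component_period s \<le> (2 ^ Suc s + 1) * (2 ^ Suc s + 2) * component_period s"
  proof (intro mult_right_mono)
    have "(2::nat) * 2 \<le> (2 ^ Suc s + 1) * (2 ^ Suc s + 2)" by (intro mult_mono) auto
    then show "4 \<le> (2 ^ Suc s + 1 :: nat) * (2 ^ Suc s + 2)" by simp
  qed auto
  also have "\<dots> = fact (Suc (Suc (2 ^ Suc s)))"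
    by (simp only: fact_Suc component_period_def of_nat_id) (simp add: algebra_simps)
  also have "\<dots> \<le> (fact (2 ^ Suc (Suc s)) :: nat)"
  proof (rule fact_mono)
    have "(1::nat) \<le> 2 ^ s" by simp
    then show "Suc (Suc (2 ^ Suc s)) \<le> (2::nat) ^ Suc (Suc s)" by (simp only: power_Suc)
  qed
  finally show ?case using Suc by (simp add: component_period_def)
qed (simp add: component_period_def)

text \<open>A component is a convex combination of blocks with cut-offs \<open>u\<close>, and each of these is an ergodic average
  of \<open>T\<^sup>Q\<close> applied to the average of the block over one period, up to the tail. Cut-offs below \<open>2\<^sup>s\<close> give
  \<open>0\<close>, those above the dyadic range the full block.\<close>
lemma component_average_le_large:
  assumes n: "n \<ge> 1"
  shows "ennreal (norm (component_average T f s n x)) \<le> block_average_max T f s x + ennreal (orbit_tail T f s n x)"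
proof -
  define Q where "Q = component_period s"
  define N where "N = floor_sqrt n"
  let ?U = "{2^s..<2^Suc s} :: nat set"
  let ?tail = "orbit_tail T f s n x"
  define D where "D = block_average_max T f s x"
  have Q: "Q > 0" by (simp add: Q_def component_period_pos)
  have tail0: "?tail \<ge> 0" unfolding orbit_tail_def by (auto intro!: mult_nonneg_nonneg sum_nonneg divide_nonneg_nonneg)
  have tail: "norm ((\<Sum>k\<in>{n div Q * Q<..n}. ramanujan_block s u k * f ((T ^^ k) x)) / of_nat n) \<le> ?tail" for u
  proof -
    have "norm (\<Sum>k\<in>{n div Q * Q<..n}. ramanujan_block s u k * f ((T ^^ k) x)) \<le> (\<Sum>k\<in>{n div Q * Q<..n}. 2 ^ s * norm (f ((T ^^ k) x)))"
      by (rule sum_norm_le) (simp add: norm_mult norm_ramanujan_block_le_pow mult_right_mono)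
    then show ?thesis
      by (simp add: orbit_tail_def Q_def norm_divide sum_distrib_left divide_right_mono)
  qed
  show ?thesis
  proof (cases "D = \<infinity>")
    case False
    define d where "d = enn2real D"
    have d: "D = ennreal d" "d \<ge> 0" using False by (auto simp: d_def less_top)
    have blk: "norm (orbit_average T f (ramanujan_block s u) n x) \<le> d + ?tail" if u: "u \<in> ?U" for u
    proof -
      let ?g = "orbit_average T f (ramanujan_block s u) Q"
      let ?S = "\<Sum>i<n div Q. ?g (((T ^^ Q) ^^ i) x)"
      have "norm ((of_nat (n div Q) * of_nat Q / of_nat n :: complex) * (?S / of_nat (n div Q))) \<le> d"
      proof (cases "n div Q = 0")
        case F: False
        have "norm (of_nat (n div Q) * of_nat Q / of_nat n :: complex) = real (n div Q * Q) / real n"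
          by (simp add: norm_divide norm_mult)
        also have "\<dots> \<le> 1"
        proof -
          have "real (n div Q * Q) \<le> real n" by (simp only: of_nat_le_iff div_times_less_eq_dividend)
          then show ?thesis using n by simp
        qed
        finally have 1: "norm (of_nat (n div Q) * of_nat Q / of_nat n :: complex) \<le> 1" .
        have "norm (?S / of_nat (n div Q)) \<le> (\<Sum>i<n div Q. norm (?g (((T ^^ Q) ^^ i) x))) / real (n div Q)"
          by (simp add: norm_divide divide_right_mono norm_sum)
        then have "ennreal (norm (?S / of_nat (n div Q))) \<le> ennreal ((\<Sum>i<n div Q. norm (?g (((T ^^ Q) ^^ i) x))) / real (n div Q))"
          by (rule ennreal_leI)
        also have "\<dots> \<le> ergodic_max (T ^^ Q) (\<lambda>y. norm (?g y)) x"
          by (rule ergodic_max_ge) (use F in simp)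
        also have "\<dots> \<le> D" unfolding D_def block_average_max_def Q_def by (rule Max_ge) (use u in auto)
        finally have 2: "norm (?S / of_nat (n div Q)) \<le> d" using d by simp
        show ?thesis unfolding norm_mult using mult_mono[OF 1 2] d by simp
      qed (use d in simp)
      then show ?thesis
        unfolding orbit_average_periodic_split[OF ramanujan_block_periodic[folded component_period_def], OF component_period_pos,
            where T = T and f = f and n = n and x = x]
        using tail[of u] unfolding Q_def by (intro order_trans[OF norm_triangle_ineq add_mono])
    qed
    have blk': "norm (orbit_average T f (ramanujan_block s u) n x) \<le> d + ?tail" for u
    proof -
      consider "u < 2 ^ s" | "u \<in> ?U" | "u \<ge> 2 ^ Suc s" by force
      then show ?thesis
      proof cases
        case 1
        then show ?thesis using d tail0 by (simp add: orbit_average_def ramanujan_block_eq_0)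
      next
        case 3
        have "{2^s..<2^Suc s} \<inter> {..u} = {2^s..<2^Suc s} \<inter> {..2 ^ Suc s - 1}" using 3 by auto
        then have "ramanujan_block s u = ramanujan_block s (2 ^ Suc s - 1)"
          by (intro ext) (simp only: ramanujan_block_def)
        moreover have "2 ^ Suc s - 1 \<in> ?U" using one_le_power[of "2::nat" s] by auto
        ultimately show ?thesis using blk by simp
      qed (use blk in auto)
    qed
    have "component_average T f s n x = (\<Sum>m=1..N. orbit_average T f (ramanujan_block s (N div m)) n x / of_nat m) / of_real (harm N)"
      unfolding component_average_def orbit_average_def ramanujan_component_def N_def[symmetric]
        sum_divide_distrib sum_distrib_right by (subst sum.swap) (simp add: mult_ac)
    also have "norm \<dots> \<le> d + ?tail" by (rule norm_harmonic_mean_le) (use blk' d tail0 in auto)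
    finally show ?thesis using d tail0 by (simp add: D_def[symmetric] ennreal_plus[symmetric] ennreal_leI del: ennreal_plus)
  qed (simp add: D_def)
qed

lemma ennreal_powr_2: "ennreal_powr (ennreal y) 2 = ennreal (y\<^sup>2)" if "y \<ge> 0"
  using that by (simp add: ennreal_powr_ennreal)

lemma ennreal_powr_2_add_le: "ennreal_powr (a + b) 2 \<le> 2 * ennreal_powr a 2 + 2 * ennreal_powr b 2"
proof (cases "a = \<infinity> \<or> b = \<infinity>")
  case True
  then show ?thesis by (auto simp: ennreal_powr_def ennreal_mult_top)
next
  case False
  then obtain u v where uv: "a = ennreal u" "0 \<le> u" "b = ennreal v" "0 \<le> v" by (cases a; cases b) auto
  have "(u + v)\<^sup>2 \<le> 2 * u\<^sup>2 + 2 * v\<^sup>2" using sum_squares_bound[of u v] by (simp add: power2_sum)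
  then have "ennreal ((u + v)\<^sup>2) \<le> ennreal (2 * u\<^sup>2 + 2 * v\<^sup>2)" by (rule ennreal_leI)
  also have "\<dots> = 2 * ennreal (u\<^sup>2) + 2 * ennreal (v\<^sup>2)" by (simp add: ennreal_mult)
  finally show ?thesis using uv by (simp add: ennreal_powr_2 flip: ennreal_plus)
qed

text \<open>The maximum over the cut-offs is estimated by an \<open>\<ell>\<^sup>2\<close>-sum, which costs \<open>2\<^sup>s\<close> in the square; the square of the
  gain is \<open>O(s\<^sup>2 4\<^sup>-\<^sup>s)\<close>, so the decay survives.\<close>
lemma block_average_max_L2:
  assumes sys: "dynamical_system M T" and f[measurable]: "f \<in> borel_measurable M"
  shows "(\<integral>\<^sup>+ x. ennreal_powr (block_average_max T f s x) 2 \<partial>M) \<le>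
    ennreal (2 ^ s * ergodic_const 2 * (block_gain s)\<^sup>2) * (\<integral>\<^sup>+ x. ennreal ((norm (f x))\<^sup>2) \<partial>M)"
proof -
  define Q where "Q = component_period s"
  let ?U = "{2^s..<2^Suc s} :: nat set"
  let ?I = "\<integral>\<^sup>+ x. ennreal ((norm (f x))\<^sup>2) \<partial>M"
  define g where "g u y = norm (orbit_average T f (ramanujan_block s u) Q y)" for u y
  have sysQ: "dynamical_system M (T ^^ Q)" by (rule dynamical_system_funpow[OF sys])
  have gm[measurable]: "g u \<in> borel_measurable M" for u
    unfolding g_def using measurable_orbit_average[OF dynamical_systemD(2)[OF sys] f, measurable] by measurable
  have [measurable]: "ergodic_max (T ^^ Q) (g u) \<in> borel_measurable M" for u
    by (rule measurable_ergodic_max[OF dynamical_systemD(2)[OF sysQ]]) measurable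
  have ec: "ergodic_const 2 \<ge> 0" by (simp add: ergodic_const_def)
  have "(\<integral>\<^sup>+ x. ennreal_powr (block_average_max T f s x) 2 \<partial>M) \<le> (\<integral>\<^sup>+ x. (\<Sum>u\<in>?U. ennreal_powr (ergodic_max (T ^^ Q) (g u) x) 2) \<partial>M)"
  proof (rule nn_integral_mono)
    fix x
    have ne: "(\<lambda>u. ergodic_max (T ^^ Q) (g u) x) ` ?U \<noteq> {}" by simp
    have "block_average_max T f s x \<in> (\<lambda>u. ergodic_max (T ^^ Q) (g u) x) ` ?U"
      unfolding block_average_max_def Q_def[symmetric] g_def[symmetric] by (rule Max_in) (use ne in auto)
    then obtain u where u: "u \<in> ?U" "block_average_max T f s x = ergodic_max (T ^^ Q) (g u) x" by auto
    show "ennreal_powr (block_average_max T f s x) 2 \<le> (\<Sum>u\<in>?U. ennreal_powr (ergodic_max (T ^^ Q) (g u) x) 2)"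
      unfolding u(2) by (rule member_le_sum[OF u(1)]) auto
  qed
  also have "\<dots> = (\<Sum>u\<in>?U. (\<integral>\<^sup>+ x. ennreal_powr (ergodic_max (T ^^ Q) (g u) x) 2 \<partial>M))"
    by (rule nn_integral_sum) measurable
  also have "\<dots> \<le> (\<Sum>u\<in>?U. ennreal (ergodic_const 2 * (block_gain s)\<^sup>2) * ?I)"
  proof (rule sum_mono)
    fix u
    have "(\<integral>\<^sup>+ x. ennreal_powr (ergodic_max (T ^^ Q) (g u) x) 2 \<partial>M) \<le> ennreal (ergodic_const 2) * (\<integral>\<^sup>+ x. ennreal (g u x powr 2) \<partial>M)"
      by (rule ergodic_max_strong[OF sysQ gm]) (auto simp: g_def)
    also have "(\<integral>\<^sup>+ x. ennreal (g u x powr 2) \<partial>M) = (\<integral>\<^sup>+ x. ennreal ((norm (orbit_average T f (ramanujan_block s u) Q x))\<^sup>2) \<partial>M)"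
      by (simp add: g_def)
    also have "\<dots> \<le> ennreal ((block_gain s)\<^sup>2) * ?I"
      by (rule orbit_average_L2[OF sys f block_gain_pos norm_ramanujan_block_exponential_sum_le])
         (use component_period_ge[of s] component_period_pos[of s] in \<open>auto simp: Q_def\<close>)
    finally show "(\<integral>\<^sup>+ x. ennreal_powr (ergodic_max (T ^^ Q) (g u) x) 2 \<partial>M) \<le> ennreal (ergodic_const 2 * (block_gain s)\<^sup>2) * ?I"
      using ec by (simp add: ennreal_mult mult.assoc mult_left_mono)
  qed
  also have "\<dots> = ennreal (2 ^ s * ergodic_const 2 * (block_gain s)\<^sup>2) * ?I"
    using ec by (simp add: ennreal_mult mult.assoc ennreal_of_nat_eq_real_of_nat flip: ennreal_power)
  finally show ?thesis .
qed

lemma orbit_tail_L2: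
  assumes sys: "dynamical_system M T" and f[measurable]: "f \<in> borel_measurable M"
  shows "(\<integral>\<^sup>+ x. ennreal ((orbit_tail T f s n x)\<^sup>2) \<partial>M) \<le>
    ennreal ((2 ^ s * real (component_period s) / real n)\<^sup>2) * (\<integral>\<^sup>+ x. ennreal ((norm (f x))\<^sup>2) \<partial>M)"
proof -
  define Q where "Q = component_period s"
  let ?K = "{n div Q * Q<..n}"
  let ?I = "\<integral>\<^sup>+ x. ennreal ((norm (f x))\<^sup>2) \<partial>M"
  note [measurable] = measurable_iterate[OF dynamical_systemD(2)[OF sys] f]
  have card: "card ?K \<le> Q"
    using mod_less_divisor[OF component_period_pos[of s], of n] by (simp add: Q_def minus_div_mult_eq_mod)
  have cr: "real (card ?K) \<le> real Q" using card by (simp only: of_nat_le_iff)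
  have cn: "(2 ^ s / real n)\<^sup>2 * real Q \<ge> 0" by simp
  have "(\<integral>\<^sup>+ x. ennreal ((orbit_tail T f s n x)\<^sup>2) \<partial>M) \<le>
      (\<integral>\<^sup>+ x. ennreal ((2 ^ s / real n)\<^sup>2 * real Q) * (\<Sum>k\<in>?K. ennreal ((norm (f ((T ^^ k) x)))\<^sup>2)) \<partial>M)"
  proof (rule nn_integral_mono)
    fix x
    have "(\<Sum>k\<in>?K. norm (f ((T ^^ k) x)))\<^sup>2 \<le> real (card ?K) * (\<Sum>k\<in>?K. (norm (f ((T ^^ k) x)))\<^sup>2)"
      using Cauchy_Schwarz_ineq_sum[of "\<lambda>_. 1" "\<lambda>k. norm (f ((T ^^ k) x))" ?K] by simp
    also have "\<dots> \<le> real Q * (\<Sum>k\<in>?K. (norm (f ((T ^^ k) x)))\<^sup>2)"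
      by (intro mult_right_mono sum_nonneg cr) auto
    finally have "(2 ^ s / real n)\<^sup>2 * (\<Sum>k\<in>?K. norm (f ((T ^^ k) x)))\<^sup>2 \<le> (2 ^ s / real n)\<^sup>2 * (real Q * (\<Sum>k\<in>?K. (norm (f ((T ^^ k) x)))\<^sup>2))"
      by (rule mult_left_mono) simp
    then have "(orbit_tail T f s n x)\<^sup>2 \<le> (2 ^ s / real n)\<^sup>2 * real Q * (\<Sum>k\<in>?K. (norm (f ((T ^^ k) x)))\<^sup>2)"
      by (simp add: orbit_tail_def Q_def power_mult_distrib power_divide mult_ac)
    then have "ennreal ((orbit_tail T f s n x)\<^sup>2) \<le> ennreal ((2 ^ s / real n)\<^sup>2 * real Q * (\<Sum>k\<in>?K. (norm (f ((T ^^ k) x)))\<^sup>2))"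
      by (rule ennreal_leI)
    also have "\<dots> = ennreal ((2 ^ s / real n)\<^sup>2 * real Q) * (\<Sum>k\<in>?K. ennreal ((norm (f ((T ^^ k) x)))\<^sup>2))"
      using cn by (subst ennreal_mult) (auto simp: sum_ennreal intro!: sum_nonneg)
    finally show "ennreal ((orbit_tail T f s n x)\<^sup>2) \<le> ennreal ((2 ^ s / real n)\<^sup>2 * real Q) * (\<Sum>k\<in>?K. ennreal ((norm (f ((T ^^ k) x)))\<^sup>2))" .
  qed
  also have "\<dots> = ennreal ((2 ^ s / real n)\<^sup>2 * real Q) * (\<Sum>k\<in>?K. (\<integral>\<^sup>+ x. ennreal ((norm (f ((T ^^ k) x)))\<^sup>2) \<partial>M))"
    by (subst nn_integral_cmult, measurable) (subst nn_integral_sum, auto)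
  also have "\<dots> = ennreal ((2 ^ s / real n)\<^sup>2 * real Q) * (of_nat (card ?K) * ?I)"
    using nn_integral_invariant[OF sys, of "\<lambda>x. ennreal ((norm (f x))\<^sup>2)"] by simp
  also have "\<dots> \<le> ennreal ((2 ^ s / real n)\<^sup>2 * real Q) * (ennreal (real Q) * ?I)"
    unfolding ennreal_of_nat_eq_real_of_nat by (intro mult_left_mono mult_right_mono ennreal_leI cr) auto
  also have "\<dots> = ennreal ((2 ^ s * real Q / real n)\<^sup>2) * ?I"
  proof -
    have "(2 ^ s / real n)\<^sup>2 * real Q * real Q = (2 ^ s * real Q / real n)\<^sup>2"
      by (simp add: power2_eq_square field_simps)
    then show ?thesis using cn by (simp only: mult.assoc[symmetric] ennreal_mult[symmetric] of_nat_0_le_iff)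
  qed
  finally show ?thesis by (simp only: Q_def)
qed

lemma ennreal_powr_SUP_le:
  assumes "\<And>j. j \<in> J \<Longrightarrow> ennreal_powr (a j) p \<le> S" "p > 0"
  shows "ennreal_powr (SUP j\<in>J. a j) p \<le> S"
proof -
  have "a j \<le> ennreal_powr S (1 / p)" if "j \<in> J" for j
  proof -
    have "a j = ennreal_powr (ennreal_powr (a j) p) (1 / p)"
      using assms(2) by (simp add: ennreal_powr_powr ennreal_powr_1)
    also have "\<dots> \<le> ennreal_powr S (1 / p)" using assms that by (intro ennreal_powr_mono) auto
    finally show ?thesis .
  qed
  then have "(SUP j\<in>J. a j) \<le> ennreal_powr S (1 / p)" by (rule SUP_least)
  then have "ennreal_powr (SUP j\<in>J. a j) p \<le> ennreal_powr (ennreal_powr S (1 / p)) p"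
    using assms(2) by (intro ennreal_powr_mono) auto
  then show ?thesis using assms(2) by (simp add: ennreal_powr_powr ennreal_powr_1)
qed

text \<open>The scales at which no use is made of periodicity. The threshold is chosen so large that the
  squared norms of the tails at the remaining scales sum up to \<open>O(2\<^sup>-\<^sup>s)\<close>.\<close>
definition short_scales :: "real \<Rightarrow> nat \<Rightarrow> nat set" where
  "short_scales \<rho> s = {j. lacunary \<rho> j < 8 ^ s * (component_period s)\<^sup>2}"

lemma ln_component_period_le: "ln (real (component_period s)) \<le> 2 * 2 ^ s * (real s + 1)"
proof -
  have "real (component_period s) \<le> real ((2 ^ Suc s) ^ (2 ^ Suc s))"
    unfolding component_period_def of_nat_le_iff using fact_le_power[of "2 ^ Suc s", where 'a = nat]
    by (simp only: of_nat_id)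
  then have "ln (real (component_period s)) \<le> ln ((2 ^ Suc s) ^ (2 ^ Suc s))"
    using component_period_pos[of s] by (subst ln_le_cancel_iff) auto
  also have "\<dots> = 2 ^ Suc s * (real (Suc s) * ln 2)"
    by (simp add: ln_realpow ln_mult algebra_simps)
  also have "\<dots> \<le> 2 ^ Suc s * (real (Suc s) * 1)"
    using ln_le_minus_one[of 2] by (intro mult_left_mono) auto
  finally show ?thesis by (simp add: algebra_simps)
qed

text \<open>The threshold has logarithm \<open>O(s 2\<^sup>s)\<close>, and \<open>lacunary \<rho> j \<ge> \<rho>\<^sup>j\<close>.\<close>
lemma short_scales_card:
  assumes "\<rho> > 1"
  shows "finite (short_scales \<rho> s)" "real (card (short_scales \<rho> s)) \<le> (1 + 7 / ln \<rho>) * (2 ^ s * (real s + 1))"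
proof -
  define \<Theta> where "\<Theta> = real (8 ^ s * (component_period s)\<^sup>2)"
  have per: "real (component_period s) > 0" using component_period_pos[of s] by simp
  have \<Theta>: "\<Theta> > 0" using per by (simp add: \<Theta>_def)
  have l: "ln \<rho> > 0" using assms by simp
  have "ln \<Theta> = real s * ln 8 + 2 * ln (real (component_period s))"
    using per by (simp add: \<Theta>_def ln_mult ln_realpow)
  also have "\<dots> \<le> real s * 3 + 2 * (2 * 2 ^ s * (real s + 1))"
  proof (intro add_mono mult_left_mono ln_component_period_le)
    have "ln (8::real) = ln (2 ^ 3)" by simp
    also have "\<dots> = 3 * ln 2" by (subst ln_realpow) auto
    finally show "ln (8::real) \<le> 3" using ln_le_minus_one[of 2] by simp
  qed auto
  also have "\<dots> \<le> 7 * (2 ^ s * (real s + 1))"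
  proof -
    have "real s + 1 \<le> 2 ^ s * (real s + 1)" by simp
    then show ?thesis by (simp add: algebra_simps)
  qed
  finally have ln\<Theta>: "ln \<Theta> \<le> 7 * (2 ^ s * (real s + 1))" .
  have sub: "short_scales \<rho> s \<subseteq> {..<nat \<lceil>ln \<Theta> / ln \<rho>\<rceil>}"
  proof
    fix j assume "j \<in> short_scales \<rho> s"
    then have "real (lacunary \<rho> j) < \<Theta>" by (simp only: short_scales_def mem_Collect_eq \<Theta>_def of_nat_less_iff)
    then have "\<rho> ^ j < \<Theta>" using lacunary_ge[of \<rho> j] by linarith
    then have "ln (\<rho> ^ j) < ln \<Theta>" using assms \<Theta> by (subst ln_less_cancel_iff) auto
    then have "real j * ln \<rho> < ln \<Theta>" using assms by (simp add: ln_realpow)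
    then have "real j < ln \<Theta> / ln \<rho>" using l by (simp add: field_simps)
    then show "j \<in> {..<nat \<lceil>ln \<Theta> / ln \<rho>\<rceil>}" by simp linarith
  qed
  then show "finite (short_scales \<rho> s)" by (rule finite_subset) simp
  have "\<Theta> \<ge> 1"
  proof -
    have "1 \<le> 8 ^ s * (component_period s)\<^sup>2" using component_period_pos[of s] by (simp add: Suc_le_eq)
    then show ?thesis unfolding \<Theta>_def by linarith
  qed
  then have nn: "ln \<Theta> / ln \<rho> \<ge> 0" using l by simp
  have "real (card (short_scales \<rho> s)) \<le> real (nat \<lceil>ln \<Theta> / ln \<rho>\<rceil>)"
    using card_mono[OF _ sub] by simp
  also have "\<dots> \<le> ln \<Theta> / ln \<rho> + 1" using nn by linarith
  also have "\<dots> \<le> 7 * (2 ^ s * (real s + 1)) / ln \<rho> + 2 ^ s * (real s + 1)"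
  proof (intro add_mono divide_right_mono ln\<Theta>)
    show "1 \<le> 2 ^ s * (real s + 1)" using mult_mono[of 1 "2 ^ s" 1 "real s + 1"] by simp
  qed (use l in simp)
  finally show "real (card (short_scales \<rho> s)) \<le> (1 + 7 / ln \<rho>) * (2 ^ s * (real s + 1))"
    by (simp add: algebra_simps add_divide_distrib)
qed

text \<open>The three terms account for the short scales, for the complete periods, and for the tails.\<close>
definition component_gain :: "real \<Rightarrow> nat \<Rightarrow> real" where
  "component_gain \<rho> s = (1 + 7 / ln \<rho>) * (2 ^ s * (real s + 1)) * (block_gain s)\<^sup>2
     + 2 * (2 ^ s * ergodic_const 2 * (block_gain s)\<^sup>2) + 2 * (1 / (1 - 1 / \<rho>)) / 2 ^ s"

text \<open>At a short scale the average is one term of an \<open>\<ell>\<^sup>2\<close>-sum over all short scales. At a long scale it is at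
  most the maximal function of the complete periods plus a tail, and the tails are summed over all long
  scales.\<close>
lemma component_max_L2:
  assumes sys: "dynamical_system M T" and f[measurable]: "f \<in> borel_measurable M" and \<rho>: "\<rho> > 1"
  shows "(\<integral>\<^sup>+ x. ennreal_powr (component_max \<rho> T f s x) 2 \<partial>M) \<le> ennreal (component_gain \<rho> s) * (\<integral>\<^sup>+ x. ennreal ((norm (f x))\<^sup>2) \<partial>M)"
proof -
  note T[measurable] = dynamical_systemD(2)[OF sys]
  define I where "I = (\<integral>\<^sup>+ x. ennreal ((norm (f x))\<^sup>2) \<partial>M)"
  define J where "J = short_scales \<rho> s"
  define Q where "Q = component_period s"
  have fin: "finite J" unfolding J_def by (rule short_scales_card[OF \<rho>])
  let ?n = "lacunary \<rho>"
  let ?Y = "\<lambda>j x. ennreal ((norm (component_average T f s (?n j) x))\<^sup>2)"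
  define R where "R j x = (if j \<in> J then 0 else ennreal ((orbit_tail T f s (?n j) x)\<^sup>2))" for j x
  have tail0: "orbit_tail T f s n x \<ge> 0" for n x
    unfolding orbit_tail_def by (auto intro!: mult_nonneg_nonneg sum_nonneg divide_nonneg_nonneg)
  have [measurable]: "?Y j \<in> borel_measurable M" for j
    using measurable_component_average[OF T f, measurable] by measurable
  have [measurable]: "R j \<in> borel_measurable M" for j
    unfolding R_def[abs_def] orbit_tail_def using measurable_iterate[OF T f, measurable] by measurable
  have [measurable]: "block_average_max T f s \<in> borel_measurable M"
  proof -
    have [measurable]: "ergodic_max (T ^^ Q) (\<lambda>y. norm (orbit_average T f c Q y)) \<in> borel_measurable M" for c
      using measurable_orbit_average[OF T f, measurable]
      by (intro measurable_ergodic_max measurable_funpow T) measurable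
    show ?thesis unfolding block_average_max_def[abs_def] Q_def[symmetric]
      by (rule borel_measurable_Max) auto
  qed
  have e2: "ergodic_const 2 \<ge> 0" by (simp add: ergodic_const_def)
  have "(\<integral>\<^sup>+ x. ennreal_powr (component_max \<rho> T f s x) 2 \<partial>M) \<le>
      (\<integral>\<^sup>+ x. (\<Sum>j\<in>J. ?Y j x) + (2 * ennreal_powr (block_average_max T f s x) 2 + 2 * (\<Sum>j. R j x)) \<partial>M)"
  proof (rule nn_integral_mono)
    fix x
    show "ennreal_powr (component_max \<rho> T f s x) 2 \<le> (\<Sum>j\<in>J. ?Y j x) + (2 * ennreal_powr (block_average_max T f s x) 2 + 2 * (\<Sum>j. R j x))"
      unfolding component_max_def
    proof (rule ennreal_powr_SUP_le)
      fix j :: nat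
      show "ennreal_powr (ennreal (norm (component_average T f s (?n j) x))) 2 \<le>
        (\<Sum>j\<in>J. ?Y j x) + (2 * ennreal_powr (block_average_max T f s x) 2 + 2 * (\<Sum>j. R j x))"
      proof (cases "j \<in> J")
        case True
        have "?Y j x \<le> (\<Sum>j\<in>J. ?Y j x)" by (rule member_le_sum[OF True]) (use fin in auto)
        then show ?thesis by (simp add: ennreal_powr_2 add_increasing2)
      next
        case False
        have "ennreal_powr (ennreal (norm (component_average T f s (?n j) x))) 2 \<le>
            ennreal_powr (block_average_max T f s x + ennreal (orbit_tail T f s (?n j) x)) 2"
          by (intro ennreal_powr_mono component_average_le_large lacunary_pos \<rho>) simp
        also have "\<dots> \<le> 2 * ennreal_powr (block_average_max T f s x) 2 + 2 * R j x"
          using False by (intro order_trans[OF ennreal_powr_2_add_le]) (simp add: R_def ennreal_powr_2 tail0)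
        also have "R j x \<le> (\<Sum>j. R j x)"
          using sum_le_suminf[of "\<lambda>j. R j x" "{j}"] by simp
        finally show ?thesis by (simp add: add_increasing add_left_mono mult_left_mono)
      qed
    qed simp
  qed
  also have "\<dots> = (\<Sum>j\<in>J. (\<integral>\<^sup>+ x. ?Y j x \<partial>M)) + (2 * (\<integral>\<^sup>+ x. ennreal_powr (block_average_max T f s x) 2 \<partial>M) + 2 * (\<Sum>j. (\<integral>\<^sup>+ x. R j x \<partial>M)))"
  proof -
    have "(\<integral>\<^sup>+ x. (\<Sum>j\<in>J. ?Y j x) \<partial>M) = (\<Sum>j\<in>J. (\<integral>\<^sup>+ x. ?Y j x \<partial>M))"
      by (rule nn_integral_sum) measurable
    then show ?thesis
      by (simp add: nn_integral_add nn_integral_cmult nn_integral_suminf del: sum_ennreal)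
  qed
  also have "\<dots> \<le> ennreal ((1 + 7 / ln \<rho>) * (2 ^ s * (real s + 1)) * (block_gain s)\<^sup>2) * I +
      (2 * (ennreal (2 ^ s * ergodic_const 2 * (block_gain s)\<^sup>2) * I) + 2 * (ennreal (1 / (1 - 1 / \<rho>) / 2 ^ s) * I))"
  proof (intro add_mono mult_left_mono)
    have "(\<Sum>j\<in>J. (\<integral>\<^sup>+ x. ?Y j x \<partial>M)) \<le> (\<Sum>j\<in>J. ennreal ((block_gain s)\<^sup>2) * I)"
    proof (rule sum_mono)
      fix j
      show "(\<integral>\<^sup>+ x. ?Y j x \<partial>M) \<le> ennreal ((block_gain s)\<^sup>2) * I"
      proof (cases "4 ^ s \<le> ?n j")
        case True
        then show ?thesis unfolding I_def by (rule component_average_L2[OF sys f])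
      next
        case False
        then show ?thesis by (simp add: component_average_eq_0)
      qed
    qed
    also have "\<dots> = ennreal (real (card J) * (block_gain s)\<^sup>2) * I"
      by (simp add: ennreal_mult ennreal_of_nat_eq_real_of_nat mult.assoc)
    also have "\<dots> \<le> ennreal ((1 + 7 / ln \<rho>) * (2 ^ s * (real s + 1)) * (block_gain s)\<^sup>2) * I"
      unfolding J_def by (intro mult_right_mono ennreal_leI short_scales_card \<rho>) auto
    finally show "(\<Sum>j\<in>J. (\<integral>\<^sup>+ x. ?Y j x \<partial>M)) \<le> \<dots>" .
    show "(\<integral>\<^sup>+ x. ennreal_powr (block_average_max T f s x) 2 \<partial>M) \<le> ennreal (2 ^ s * ergodic_const 2 * (block_gain s)\<^sup>2) * I"
      unfolding I_def by (rule block_average_max_L2[OF sys f])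
    have "(\<Sum>j. (\<integral>\<^sup>+ x. R j x \<partial>M)) \<le> (\<Sum>j. ennreal ((1 / \<rho>) ^ j / 2 ^ s) * I)"
    proof (rule suminf_le)
      fix j
      show "(\<integral>\<^sup>+ x. R j x \<partial>M) \<le> ennreal ((1 / \<rho>) ^ j / 2 ^ s) * I"
      proof (cases "j \<in> J")
        case False
        \<comment> \<open>One factor \<open>1/n\<close> of the squared tail is estimated by the threshold, the other one by \<open>\<rho>\<^sup>-\<^sup>j\<close>.\<close>
        define n where "n = real (?n j)"
        have "8 ^ s * (component_period s)\<^sup>2 \<le> ?n j" using False by (simp add: J_def short_scales_def not_less)
        then have "real (8 ^ s * (component_period s)\<^sup>2) \<le> n" unfolding n_def by (simp only: of_nat_le_iff)
        then have n1: "8 ^ s * (real Q)\<^sup>2 \<le> n" by (simp add: Q_def)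
        have n2: "\<rho> ^ j \<le> n" unfolding n_def by (rule lacunary_ge)
        have pos: "\<rho> ^ j > 0" "n > 0" "real Q > 0" using \<rho> n2 less_le_trans[OF zero_less_power n2] component_period_pos[of s] by (auto simp: Q_def)
        have "2 ^ s * (4 ^ s * (real Q)\<^sup>2) * \<rho> ^ j \<le> n * n"
          using n1 n2 pos by (intro mult_mono) (auto simp: power_mult_distrib[symmetric] mult.assoc[symmetric])
        then have le: "(2 ^ s * real Q / n)\<^sup>2 \<le> (1 / \<rho>) ^ j / 2 ^ s"
        proof -
          have "(2 ^ s * real Q)\<^sup>2 = 4 ^ s * (real Q)\<^sup>2" by (simp add: power2_eq_square power_mult_distrib[symmetric])
          then show ?thesis using pos \<open>_ \<le> n * n\<close>
            by (simp add: power_divide divide_simps power2_eq_square[of n] mult_ac)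
        qed
        have "(\<integral>\<^sup>+ x. R j x \<partial>M) \<le> ennreal ((2 ^ s * real Q / n)\<^sup>2) * I"
          using False orbit_tail_L2[OF sys f, of s "?n j"] by (simp add: R_def Q_def n_def I_def)
        also have "\<dots> \<le> ennreal ((1 / \<rho>) ^ j / 2 ^ s) * I" by (intro mult_right_mono ennreal_leI le) simp
        finally show ?thesis .
      qed (simp add: R_def)
    qed auto
    also have "\<dots> = (\<Sum>j. ennreal ((1 / \<rho>) ^ j / 2 ^ s)) * I" by (rule ennreal_suminf_multc)
    also have "(\<Sum>j. ennreal ((1 / \<rho>) ^ j / 2 ^ s)) = ennreal (1 / (1 - 1 / \<rho>) / 2 ^ s)"
    proof (rule suminf_ennreal_eq)
      show "(\<lambda>j. (1 / \<rho>) ^ j / 2 ^ s) sums (1 / (1 - 1 / \<rho>) / 2 ^ s)"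
        by (intro sums_divide geometric_sums) (use \<rho> in simp)
    qed (use \<rho> in simp)
    finally show "(\<Sum>j. (\<integral>\<^sup>+ x. R j x \<partial>M)) \<le> ennreal (1 / (1 - 1 / \<rho>) / 2 ^ s) * I" .
  qed auto
  also have "\<dots> = ennreal (component_gain \<rho> s) * I"
  proof -
    have "0 \<le> (1 + 7 / ln \<rho>) * (2 ^ s * (real s + 1)) * (block_gain s)\<^sup>2" "0 \<le> 2 ^ s * ergodic_const 2 * (block_gain s)\<^sup>2"
      "0 \<le> 1 / (1 - 1 / \<rho>) / 2 ^ s"
      using \<rho> e2 by (auto intro!: mult_nonneg_nonneg add_nonneg_nonneg divide_nonneg_nonneg)
    moreover have "ennreal A * I + (2 * (ennreal B * I) + 2 * (ennreal C * I)) = ennreal (A + 2 * B + 2 * C) * I"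
      if "0 \<le> A" "0 \<le> B" "0 \<le> C" for A B C
      using that by (simp add: ennreal_mult distrib_right add.assoc mult.assoc)
    ultimately show ?thesis by (simp add: component_gain_def)
  qed
  finally show ?thesis by (simp only: I_def)
qed

lemma component_gain_bound:
  assumes "\<rho> > 1"
  obtains C where "C > 0" "\<And>s. component_gain \<rho> s \<le> C * (3 / 4) ^ s"
proof -
  define D where "D = 1 + 7 / ln \<rho>"
  define E where "E = 2 * ergodic_const 2"
  define F where "F = 2 * (1 / (1 - 1 / \<rho>))"
  \<comment> \<open>Splitting \<open>2\<^sup>-\<^sup>s\<close> as \<open>(2/3)\<^sup>s (3/4)\<^sup>s\<close> leaves room for the polynomial factors.\<close>
  define u where "u s = (D * ((real s + 1) * (16 * real s + 26)\<^sup>2) + E * (16 * real s + 26)\<^sup>2 + F) * (2 / 3) ^ s" for s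
  have eq: "component_gain \<rho> s = u s * (3 / 4) ^ s" for s
  proof -
    define x where "x = (2::real) ^ s"
    define P where "P = 16 * real s + 26"
    have x: "x > 0" by (simp add: x_def)
    have "component_gain \<rho> s = D * (x * (real s + 1)) * (P / x)\<^sup>2 + x * E * (P / x)\<^sup>2 + F / x"
      by (simp add: component_gain_def block_gain_def D_def E_def F_def x_def P_def)
    also have "\<dots> = (D * ((real s + 1) * P\<^sup>2) + E * P\<^sup>2 + F) * (1 / x)"
      using x by (simp add: power2_eq_square field_simps)
    also have "1 / x = (2 / 3) ^ s * (3 / 4) ^ s"
      by (simp add: x_def power_mult_distrib[symmetric] power_one_over)
    finally show ?thesis by (simp add: u_def P_def)
  qed
  have "u \<longlonglongrightarrow> 0" unfolding u_def by real_asymp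
  then have "Bseq u" by (rule convergent_imp_Bseq[OF convergentI])
  then obtain K where "K > 0" "\<And>s. norm (u s) \<le> K" by (auto elim: BseqE)
  then have "u s \<le> K" for s by (metis abs_le_D1 real_norm_def)
  then show ?thesis using \<open>K > 0\<close> by (intro that[of K]) (auto simp: eq intro!: mult_right_mono)
qed

section \<open>The maximal function of a component near the exponent one\<close>

text \<open>The component is dominated by \<open>harm (2\<^sup>s\<^sup>+\<^sup>1)\<close> times the number of divisors \<open>d \<le> 2\<^sup>s\<^sup>+\<^sup>1\<close>, and the average
  over the multiples of \<open>d\<close> up to \<open>n\<close> is \<open>1/d\<close> times an ergodic average of \<open>T\<^sup>d\<close>.\<close>
lemma component_average_le_ergodic_max:
  assumes n: "n \<ge> 1"
  shows "ennreal (norm (component_average T f s n x)) \<le>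
    ennreal (harm (2 ^ Suc s)) * (\<Sum>d=1..2 ^ Suc s. ennreal (1 / real d) * ergodic_max (T ^^ d) (\<lambda>y. norm (f ((T ^^ d) y))) x)"
proof -
  define D :: nat where "D = 2 ^ Suc s"
  define H :: real where "H = harm D"
  have H0: "H \<ge> 0" by (simp add: H_def harm_nonneg)
  let ?a = "\<lambda>k. norm (f ((T ^^ k) x))"
  define b where "b d = (\<Sum>k=1..n. if d dvd k then ?a k else 0) / real n" for d
  have b0: "b d \<ge> 0" for d unfolding b_def by (intro divide_nonneg_nonneg sum_nonneg) auto
  have "norm (component_average T f s n x) \<le> (\<Sum>k=1..n. H * real (divisors_upto D k) * ?a k) / real n"
    unfolding component_average_def orbit_average_def norm_divide norm_of_nat
  proof (intro divide_right_mono sum_norm_le)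
    fix k
    show "norm (ramanujan_component s (floor_sqrt n) k * f ((T ^^ k) x)) \<le> H * real (divisors_upto D k) * ?a k"
      using norm_ramanujan_component_le[of s "floor_sqrt n" k] by (simp add: norm_mult mult_right_mono H_def D_def)
  qed simp
  also have "(\<Sum>k=1..n. H * real (divisors_upto D k) * ?a k) = H * (\<Sum>d=1..D. \<Sum>k=1..n. if d dvd k then ?a k else 0)"
  proof -
    have "H * real (divisors_upto D k) * ?a k = (\<Sum>d=1..D. H * (if d dvd k then ?a k else 0))" for k
      unfolding divisors_upto_conv_sum sum_distrib_left sum_distrib_right by (intro sum.cong) auto
    then show ?thesis unfolding sum_distrib_left by (simp only:) (rule sum.swap)
  qed
  also have "\<dots> / real n = H * (\<Sum>d=1..D. b d)" by (simp add: b_def sum_divide_distrib[symmetric])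
  finally have "ennreal (norm (component_average T f s n x)) \<le> ennreal (H * (\<Sum>d=1..D. b d))" by (rule ennreal_leI)
  also have "\<dots> = ennreal H * (\<Sum>d=1..D. ennreal (b d))"
    using H0 b0 by (simp add: ennreal_mult sum_nonneg sum_ennreal)
  also have "\<dots> \<le> ennreal H * (\<Sum>d=1..D. ennreal (1 / real d) * ergodic_max (T ^^ d) (\<lambda>y. norm (f ((T ^^ d) y))) x)"
  proof (intro mult_left_mono sum_mono)
    fix d assume "d \<in> {1..D}"
    then have d: "d \<ge> 1" by simp
    define m where "m = n div d"
    show "ennreal (b d) \<le> ennreal (1 / real d) * ergodic_max (T ^^ d) (\<lambda>y. norm (f ((T ^^ d) y))) x"
    proof (cases "m = 0")
      case True
      then have "n < d" using d by (simp add: m_def div_eq_0_iff)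
      then have "\<not> d dvd k" if "k \<in> {1..n}" for k using that dvd_imp_le[of d k] by auto
      then have "b d = 0" unfolding b_def by simp
      then show ?thesis by simp
    next
      case False
      have "(T ^^ (d * Suc i)) x = (T ^^ d) (((T ^^ d) ^^ i) x)" for i
        by (simp add: funpow_mult[symmetric] del: mult_Suc_right)
      then have "(\<Sum>k=1..n. if d dvd k then ?a k else 0) = (\<Sum>i<m. norm (f ((T ^^ d) (((T ^^ d) ^^ i) x))))"
        unfolding m_def by (subst sum_multiples[OF d]) (simp del: mult_Suc_right)
      then have beq: "b d = (real m / real n) * ((\<Sum>i<m. norm (f ((T ^^ d) (((T ^^ d) ^^ i) x)))) / real m)"
        using False by (simp add: b_def)
      have "m * d \<le> n" by (simp add: m_def)
      then have "real m * real d \<le> real n" by (metis of_nat_le_iff of_nat_mult)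
      then have "real m / real n \<le> 1 / real d" using d n by (simp add: field_simps)
      then have "b d \<le> 1 / real d * ((\<Sum>i<m. norm (f ((T ^^ d) (((T ^^ d) ^^ i) x)))) / real m)"
        unfolding beq by (intro mult_right_mono divide_nonneg_nonneg sum_nonneg) auto
      then have "ennreal (b d) \<le> ennreal (1 / real d) * ennreal ((\<Sum>i<m. norm (f ((T ^^ d) (((T ^^ d) ^^ i) x)))) / real m)"
        by (subst ennreal_mult[symmetric]) (auto intro!: ennreal_leI divide_nonneg_nonneg sum_nonneg)
      also have "\<dots> \<le> ennreal (1 / real d) * ergodic_max (T ^^ d) (\<lambda>y. norm (f ((T ^^ d) y))) x"
        by (intro mult_left_mono ergodic_max_ge) (use False in auto)
      finally show ?thesis .
    qed
  qed simp
  finally show ?thesis by (simp only: H_def D_def)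
qed

text \<open>A weighted mean of maximal functions of the powers of \<open>T\<close>, all of which satisfy the same maximal
  inequality. The total weight is \<open>O(s)\<close>, hence the polynomial growth.\<close>
lemma component_max_Lp:
  assumes sys: "dynamical_system M T" and f[measurable]: "f \<in> borel_measurable M" and \<rho>: "\<rho> > 1" and a: "a > 1"
  shows "(\<integral>\<^sup>+ x. ennreal_powr (component_max \<rho> T f s x) a \<partial>M) \<le>
    ennreal ((real s + 2) powr (2 * a) * ergodic_const a) * (\<integral>\<^sup>+ x. ennreal (norm (f x) powr a) \<partial>M)"
proof -
  define D :: nat where "D = 2 ^ Suc s"
  define H :: real where "H = harm D"
  define Y where "Y d = ergodic_max (T ^^ d) (\<lambda>y. norm (f ((T ^^ d) y)))" for d
  let ?I = "\<integral>\<^sup>+ x. ennreal (norm (f x) powr a) \<partial>M"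
  have H: "H > 0" by (simp add: H_def D_def)
  have ec: "ergodic_const a \<ge> 0" using a by (simp add: ergodic_const_def)
  note T[measurable] = dynamical_systemD(2)[OF sys]
  have fm[measurable]: "(\<lambda>y. norm (f ((T ^^ d) y))) \<in> borel_measurable M" for d
    using measurable_iterate[OF T f, of d] by measurable
  have [measurable]: "Y d \<in> borel_measurable M" for d
    unfolding Y_def by (intro measurable_ergodic_max measurable_funpow T fm)
  have Yint: "(\<integral>\<^sup>+ x. ennreal_powr (Y d x) a \<partial>M) \<le> ennreal (ergodic_const a) * ?I" for d
  proof -
    have "(\<integral>\<^sup>+ x. ennreal_powr (Y d x) a \<partial>M) \<le> ennreal (ergodic_const a) * (\<integral>\<^sup>+ x. ennreal (norm (f ((T ^^ d) x)) powr a) \<partial>M)"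
      unfolding Y_def by (intro ergodic_max_strong dynamical_system_funpow sys fm a) simp
    also have "(\<integral>\<^sup>+ x. ennreal (norm (f ((T ^^ d) x)) powr a) \<partial>M) = ?I"
      by (rule nn_integral_invariant[OF sys, of "\<lambda>x. ennreal (norm (f x) powr a)"]) measurable
    finally show ?thesis .
  qed
  have sumw: "(\<Sum>d=1..D. 1 / real d) = H" by (simp add: H_def harm_def divide_inverse)
  have "(\<integral>\<^sup>+ x. ennreal_powr (component_max \<rho> T f s x) a \<partial>M) \<le>
      (\<integral>\<^sup>+ x. ennreal (H powr a * H powr (a - 1)) * (\<Sum>d=1..D. ennreal (1 / real d) * ennreal_powr (Y d x) a) \<partial>M)"
  proof (rule nn_integral_mono)
    fix x
    have "component_max \<rho> T f s x \<le> ennreal H * (\<Sum>d=1..D. ennreal (1 / real d) * Y d x)"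
      unfolding component_max_def H_def D_def Y_def
      by (intro SUP_least component_average_le_ergodic_max lacunary_pos \<rho>)
    then have "ennreal_powr (component_max \<rho> T f s x) a \<le> ennreal_powr (ennreal H * (\<Sum>d=1..D. ennreal (1 / real d) * Y d x)) a"
      using a by (intro ennreal_powr_mono) auto
    also have "\<dots> = ennreal (H powr a) * ennreal_powr (\<Sum>d=1..D. ennreal (1 / real d) * Y d x) a"
      using a H by (intro ennreal_powr_mult) auto
    also have "\<dots> \<le> ennreal (H powr a) * (ennreal ((\<Sum>d=1..D. 1 / real d) powr (a - 1)) * (\<Sum>d=1..D. ennreal (1 / real d) * ennreal_powr (Y d x) a))"
      using a by (intro mult_left_mono weighted_power_mean_ennreal) (auto simp: D_def)
    also have "\<dots> = ennreal (H powr a * H powr (a - 1)) * (\<Sum>d=1..D. ennreal (1 / real d) * ennreal_powr (Y d x) a)"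
      by (simp only: sumw ennreal_mult powr_ge_zero mult.assoc)
    finally show "ennreal_powr (component_max \<rho> T f s x) a \<le> \<dots>" .
  qed
  also have "\<dots> = ennreal (H powr a * H powr (a - 1)) * (\<Sum>d=1..D. ennreal (1 / real d) * (\<integral>\<^sup>+ x. ennreal_powr (Y d x) a \<partial>M))"
    by (subst nn_integral_cmult, measurable) (subst nn_integral_sum, auto simp: nn_integral_cmult)
  also have "\<dots> \<le> ennreal (H powr a * H powr (a - 1)) * (\<Sum>d=1..D. ennreal (1 / real d) * (ennreal (ergodic_const a) * ?I))"
    by (intro mult_left_mono sum_mono Yint) auto
  also have "\<dots> = ennreal (H powr a * H powr (a - 1)) * (ennreal H * (ennreal (ergodic_const a) * ?I))"
    by (simp only: sum_distrib_right[symmetric] sumw[symmetric]) (subst sum_ennreal, auto)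
  also have "\<dots> = ennreal (H powr (2 * a) * ergodic_const a) * ?I"
  proof -
    have "H powr (2 * a) = H powr a * H powr (a - 1) * H"
    proof -
      have "H powr (2 * a) = H powr (a + (a - 1) + 1)" by simp
      also have "\<dots> = H powr a * H powr (a - 1) * H powr 1" by (simp only: powr_add)
      finally show ?thesis using H by simp
    qed
    then show ?thesis using H ec by (simp only: ennreal_mult powr_ge_zero mult_nonneg_nonneg less_imp_le mult.assoc)
  qed
  also have "\<dots> \<le> ennreal ((real s + 2) powr (2 * a) * ergodic_const a) * ?I"
  proof (intro mult_right_mono ennreal_leI powr_mono2)
    show "H \<le> real s + 2" using harm_pow2_le[of "Suc s"] by (simp add: H_def D_def)
  qed (use a H ec in auto)
  finally show ?thesis .
qed

section \<open>Geometric decay by interpolation\<close>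

lemma component_max_add_le:
  "component_max \<rho> T (\<lambda>x. f x + g x) s x \<le> component_max \<rho> T f s x + component_max \<rho> T g s x"
  unfolding component_max_def
proof (rule SUP_least)
  fix j :: nat
  have "component_average T (\<lambda>x. f x + g x) s (lacunary \<rho> j) x =
      component_average T f s (lacunary \<rho> j) x + component_average T g s (lacunary \<rho> j) x"
    by (simp add: component_average_def orbit_average_def distrib_left sum.distrib add_divide_distrib)
  then have "ennreal (norm (component_average T (\<lambda>x. f x + g x) s (lacunary \<rho> j) x)) \<le>
      ennreal (norm (component_average T f s (lacunary \<rho> j) x)) + ennreal (norm (component_average T g s (lacunary \<rho> j) x))"
    by (simp add: norm_triangle_ineq flip: ennreal_plus)
  also have "\<dots> \<le> (SUP j. ennreal (norm (component_average T f s (lacunary \<rho> j) x))) + (SUP j. ennreal (norm (component_average T g s (lacunary \<rho> j) x)))"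
    by (intro add_mono SUP_upper) auto
  finally show "ennreal (norm (component_average T (\<lambda>x. f x + g x) s (lacunary \<rho> j) x)) \<le> \<dots>" .
qed

text \<open>Split \<open>f\<close> at height \<open>c l\<close>, use the \<open>L\<^sup>a\<close> bound for the large part and the \<open>L\<^sup>2\<close> bound for the small part.\<close>
lemma component_max_interpolated:
  assumes sys: "dynamical_system M T" and f[measurable]: "f \<in> borel_measurable M" and \<rho>: "\<rho> > 1"
    and ap: "1 < a" "a < p" "p < 2" and c: "c > 0"
  shows "(\<integral>\<^sup>+ x. ennreal_powr (component_max \<rho> T f s x) p \<partial>M) \<le>
    ennreal (2 powr a * ((real s + 2) powr (2 * a) * ergodic_const a) * c powr (a - p) * p / (p - a)
      + 4 * \<bar>component_gain \<rho> s\<bar> * c powr (2 - p) * p / (2 - p)) * (\<integral>\<^sup>+ x. ennreal (norm (f x) powr p) \<partial>M)"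
proof (rule interpolation)
  note T[measurable] = dynamical_systemD(2)[OF sys]
  define A where "A = (real s + 2) powr (2 * a) * ergodic_const a"
  define E where "E = \<bar>component_gain \<rho> s\<bar>"
  have A0: "A \<ge> 0" using ap by (simp add: A_def ergodic_const_def)
  have E0: "E \<ge> 0" by (simp add: E_def)
  fix l :: real assume l: "l > 0"
  define f1 where "f1 x = (if c * l < norm (f x) then f x else 0)" for x
  define f2 where "f2 x = (if norm (f x) \<le> c * l then f x else 0)" for x
  have [measurable]: "f1 \<in> borel_measurable M" "f2 \<in> borel_measurable M"
    unfolding f1_def f2_def by measurable
  have m[measurable]: "component_max \<rho> T f s \<in> borel_measurable M" "component_max \<rho> T f1 s \<in> borel_measurable M" "component_max \<rho> T f2 s \<in> borel_measurable M"
    by (rule measurable_component_max[OF T]; measurable)+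
  have split: "component_max \<rho> T f s x \<le> component_max \<rho> T f1 s x + component_max \<rho> T f2 s x" for x
  proof -
    have "f = (\<lambda>x. f1 x + f2 x)" by (auto simp: f1_def f2_def)
    then show ?thesis using component_max_add_le[of \<rho> T f1 f2 s x] by simp
  qed
  let ?S = "\<lambda>h. {x \<in> space M. ennreal (l / 2) < component_max \<rho> T h s x}"
  have "emeasure M {x \<in> space M. ennreal l < component_max \<rho> T f s x} \<le> emeasure M (?S f1 \<union> ?S f2)"
  proof (rule emeasure_mono)
    show "{x \<in> space M. ennreal l < component_max \<rho> T f s x} \<subseteq> ?S f1 \<union> ?S f2"
    proof (rule subsetI, rule ccontr)
      fix x assume x: "x \<in> {x \<in> space M. ennreal l < component_max \<rho> T f s x}" "x \<notin> ?S f1 \<union> ?S f2"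
      then have "component_max \<rho> T f1 s x \<le> ennreal (l / 2)" "component_max \<rho> T f2 s x \<le> ennreal (l / 2)" by auto
      then have "component_max \<rho> T f1 s x + component_max \<rho> T f2 s x \<le> ennreal (l / 2) + ennreal (l / 2)" by (rule add_mono)
      also have "\<dots> = ennreal l" using l by (simp flip: ennreal_plus)
      finally show False using x(1) split[of x] by (simp add: not_le[symmetric]) (meson order_trans)
    qed
  qed measurable
  also have "\<dots> \<le> emeasure M (?S f1) + emeasure M (?S f2)" by (rule emeasure_subadditive) measurable
  also have "\<dots> \<le> ennreal (2 powr a * A * l powr (-a)) * (\<integral>\<^sup>+ x. ennreal (norm (f x) powr a) * indicator {x. c * l < norm (f x)} x \<partial>M) +
      ennreal (4 * E * l powr (-2)) * (\<integral>\<^sup>+ x. ennreal (norm (f x) powr 2) * indicator {x. norm (f x) \<le> c * l} x \<partial>M)"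
  proof (rule add_mono)
    have "emeasure M (?S f1) \<le> ennreal ((l / 2) powr (-a)) * (\<integral>\<^sup>+ x. ennreal_powr (component_max \<rho> T f1 s x) a \<partial>M)"
      by (rule chebyshev_powr) (use l ap in auto)
    also have "\<dots> \<le> ennreal ((l / 2) powr (-a)) * (ennreal A * (\<integral>\<^sup>+ x. ennreal (norm (f1 x) powr a) \<partial>M))"
      unfolding A_def by (intro mult_left_mono component_max_Lp sys \<rho> ap) auto
    also have "(\<integral>\<^sup>+ x. ennreal (norm (f1 x) powr a) \<partial>M) = (\<integral>\<^sup>+ x. ennreal (norm (f x) powr a) * indicator {x. c * l < norm (f x)} x \<partial>M)"
      by (intro nn_integral_cong) (auto simp: f1_def indicator_def)
    also have "ennreal ((l / 2) powr (-a)) * (ennreal A * (\<integral>\<^sup>+ x. ennreal (norm (f x) powr a) * indicator {x. c * l < norm (f x)} x \<partial>M)) =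
      ennreal (2 powr a * A * l powr (-a)) * (\<integral>\<^sup>+ x. ennreal (norm (f x) powr a) * indicator {x. c * l < norm (f x)} x \<partial>M)"
    proof -
      have "(l / 2) powr (-a) * A = 2 powr a * A * l powr (-a)"
        using l by (simp add: powr_divide powr_minus field_simps)
      then show ?thesis using A0 by (simp only: mult.assoc[symmetric] ennreal_mult[symmetric] powr_ge_zero)
    qed
    finally show "emeasure M (?S f1) \<le> \<dots>" .
    have "emeasure M (?S f2) \<le> ennreal ((l / 2) powr (-2)) * (\<integral>\<^sup>+ x. ennreal_powr (component_max \<rho> T f2 s x) 2 \<partial>M)"
      by (rule chebyshev_powr) (use l in auto)
    also have "\<dots> \<le> ennreal ((l / 2) powr (-2)) * (ennreal E * (\<integral>\<^sup>+ x. ennreal ((norm (f2 x))\<^sup>2) \<partial>M))"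
      by (intro mult_left_mono order_trans[OF component_max_L2[OF sys _ \<rho>]] mult_right_mono ennreal_leI) (auto simp: E_def)
    also have "(\<integral>\<^sup>+ x. ennreal ((norm (f2 x))\<^sup>2) \<partial>M) = (\<integral>\<^sup>+ x. ennreal (norm (f x) powr 2) * indicator {x. norm (f x) \<le> c * l} x \<partial>M)"
      by (intro nn_integral_cong) (auto simp: f2_def indicator_def)
    also have "ennreal ((l / 2) powr (-2)) * (ennreal E * (\<integral>\<^sup>+ x. ennreal (norm (f x) powr 2) * indicator {x. norm (f x) \<le> c * l} x \<partial>M)) =
      ennreal (4 * E * l powr (-2)) * (\<integral>\<^sup>+ x. ennreal (norm (f x) powr 2) * indicator {x. norm (f x) \<le> c * l} x \<partial>M)"
    proof -
      have "(l / 2) powr (-2) * E = 4 * E * l powr (-2)"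
        using l by (simp add: powr_minus_divide power_divide field_simps)
      then show ?thesis using E0 by (simp only: mult.assoc[symmetric] ennreal_mult[symmetric] powr_ge_zero)
    qed
    finally show "emeasure M (?S f2) \<le> \<dots>" .
  qed
  finally show "emeasure M {x \<in> space M. ennreal l < component_max \<rho> T f s x} \<le>
    ennreal (2 powr a * ((real s + 2) powr (2 * a) * ergodic_const a) * l powr (-a)) * (\<integral>\<^sup>+ x. ennreal (norm (f x) powr a) * indicator {x. c * l < norm (f x)} x \<partial>M) +
      ennreal (4 * \<bar>component_gain \<rho> s\<bar> * l powr (-2)) * (\<integral>\<^sup>+ x. ennreal (norm (f x) powr 2) * indicator {x. norm (f x) \<le> c * l} x \<partial>M)"
    by (simp only: A_def E_def)
qed (use ap c dynamical_systemD[OF sys] measurable_component_max[OF dynamical_systemD(2)[OF sys] f] in \<open>auto simp: ergodic_const_def\<close>)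

text \<open>For \<open>p < 2\<close>, the polynomial growth in \<open>L\<^sup>a\<close> and the geometric decay in \<open>L\<^sup>2\<close> are balanced by letting \<open>c\<close> grow
  geometrically with \<open>s\<close>, so slowly that the second term still decays.\<close>
lemma component_max_decay:
  assumes \<rho>: "\<rho> > 1" and p: "1 < p" "p \<le> 2"
  shows "\<exists>C>0. \<exists>\<eta>>0. \<eta> < 1 \<and> (\<forall>s (M :: 'a measure) T f. dynamical_system M T \<longrightarrow> f \<in> borel_measurable M \<longrightarrow>
    (\<integral>\<^sup>+ x. ennreal_powr (component_max \<rho> T f s x) p \<partial>M) \<le> ennreal (C * \<eta> ^ s) * (\<integral>\<^sup>+ x. ennreal (norm (f x) powr p) \<partial>M))"
proof -
  obtain C where C: "C > 0" "\<And>s. component_gain \<rho> s \<le> C * (3 / 4) ^ s" using component_gain_bound[OF \<rho>] by blast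
  show ?thesis
  proof (cases "p = 2")
    case True
    show ?thesis
    proof (intro exI conjI allI impI)
      fix s :: nat and M :: "'a measure" and T and f :: "'a \<Rightarrow> complex" assume sys: "dynamical_system M T" "f \<in> borel_measurable M"
      have "(\<integral>\<^sup>+ x. ennreal_powr (component_max \<rho> T f s x) 2 \<partial>M) \<le> ennreal (component_gain \<rho> s) * (\<integral>\<^sup>+ x. ennreal ((norm (f x))\<^sup>2) \<partial>M)"
        by (rule component_max_L2[OF sys \<rho>])
      also have "\<dots> \<le> ennreal (C * (3 / 4) ^ s) * (\<integral>\<^sup>+ x. ennreal ((norm (f x))\<^sup>2) \<partial>M)"
        by (intro mult_right_mono ennreal_leI C) simp
      finally show "(\<integral>\<^sup>+ x. ennreal_powr (component_max \<rho> T f s x) p \<partial>M) \<le> ennreal (C * (3 / 4) ^ s) * (\<integral>\<^sup>+ x. ennreal (norm (f x) powr p) \<partial>M)"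
        using True by simp
    qed (use C in auto)
  next
    case False
    then have p2: "p < 2" using p by simp
    \<comment> \<open>Any exponent strictly between \<open>1\<close> and \<open>p\<close> would do.\<close>
    define a where "a = (1 + p) / 2"
    have a: "1 < a" "a < p" using p by (auto simp: a_def)
    \<comment> \<open>With the ratio \<open>c\<close> below, the first term carries the factor \<open>(3/4)\<^sup>2\<^sup>\<delta>\<^sup>s\<close>: one half of it absorbs the
      polynomial growth, the other half remains as \<open>\<eta>\<^sup>s\<close>.\<close>
    define \<delta> where "\<delta> = (p - a) / 4"
    have \<delta>: "\<delta> > 0" "\<delta> \<le> p / 4" using a by (auto simp: \<delta>_def)
    define \<eta> where "\<eta> = (3 / 4 :: real) powr \<delta>"
    have \<eta>: "0 < \<eta>" "\<eta> < 1" using \<delta> powr_less_mono'[of "3/4" 0 \<delta>] by (auto simp: \<eta>_def)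
    define K1 where "K1 = 2 powr a * ergodic_const a * p / (p - a)"
    define K2 where "K2 = 4 * C * p / (2 - p)"
    have K: "K1 > 0" "K2 > 0" using a p p2 C by (auto simp: K1_def K2_def ergodic_const_def)
    have "(\<lambda>s. (real s + 2) powr (2 * a) * (3 / 4) powr (\<delta> * real s)) \<longlonglongrightarrow> 0"
    proof -
      define \<beta> where "\<beta> = - ln (3 / 4 :: real) * \<delta>"
      have \<beta>: "\<beta> > 0" using \<delta> by (simp add: \<beta>_def mult_neg_pos)
      have "(\<lambda>s. (real s + 2) powr (2 * a) * exp (- (\<beta> * real s))) \<longlonglongrightarrow> 0" using \<beta> a by real_asymp
      then show ?thesis by (simp add: powr_def[of "3 / 4"] \<beta>_def mult_ac)
    qed
    then have "Bseq (\<lambda>s. (real s + 2) powr (2 * a) * (3 / 4) powr (\<delta> * real s))" by (rule convergent_imp_Bseq[OF convergentI])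
    then obtain B where B: "B > 0" "\<And>s. norm ((real s + 2) powr (2 * a) * (3 / 4) powr (\<delta> * real s)) \<le> B" by (auto elim: BseqE)
    show ?thesis
    proof (intro exI conjI allI impI)
      show "0 < K1 * B + K2" using K B by (simp add: add_pos_pos)
      fix s :: nat and M :: "'a measure" and T and f :: "'a \<Rightarrow> complex" assume sys: "dynamical_system M T" "f \<in> borel_measurable M"
      define c where "c = (3 / 4 :: real) powr (- (real s / 2))"
      have c: "c > 0" by (simp add: c_def)
      have \<eta>s: "\<eta> ^ s = (3 / 4) powr (\<delta> * real s)" unfolding \<eta>_def by (simp add: powr_power mult.commute)
      have t1: "(real s + 2) powr (2 * a) * c powr (a - p) \<le> B * \<eta> ^ s"
      proof -
        have "c powr (a - p) = (3 / 4) powr (\<delta> * real s + \<delta> * real s)"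
          unfolding c_def powr_powr by (rule arg_cong[of _ _ "\<lambda>t. (3 / 4) powr t"]) (simp add: \<delta>_def field_simps)
        also have "\<dots> = (3 / 4) powr (\<delta> * real s) * \<eta> ^ s" by (simp only: powr_add \<eta>s)
        finally have "(real s + 2) powr (2 * a) * c powr (a - p) = ((real s + 2) powr (2 * a) * (3 / 4) powr (\<delta> * real s)) * \<eta> ^ s"
          by simp
        also have "\<dots> \<le> B * \<eta> ^ s" using B(2)[of s] \<eta> by (intro mult_right_mono) (auto simp: abs_le_iff)
        finally show ?thesis .
      qed
      have t2: "\<bar>component_gain \<rho> s\<bar> * c powr (2 - p) \<le> C * \<eta> ^ s"
      proof -
        have "component_gain \<rho> s \<ge> 0"
          unfolding component_gain_def using \<rho>
          by (intro add_nonneg_nonneg mult_nonneg_nonneg divide_nonneg_nonneg) (auto simp: ergodic_const_def)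
        then have "\<bar>component_gain \<rho> s\<bar> * c powr (2 - p) \<le> (C * (3 / 4) ^ s) * c powr (2 - p)"
          using C(2)[of s] by (intro mult_right_mono) auto
        also have "(3 / 4 :: real) ^ s = (3 / 4) powr real s" by (simp add: powr_realpow)
        also have "C * (3 / 4) powr real s * c powr (2 - p) = C * (3 / 4) powr (p / 2 * real s)"
        proof -
          have "(3 / 4 :: real) powr real s * c powr (2 - p) = (3 / 4) powr (real s + - (real s / 2) * (2 - p))"
            unfolding c_def powr_powr powr_add ..
          also have "real s + - (real s / 2) * (2 - p) = p / 2 * real s" by (simp add: field_simps)
          finally show ?thesis by simp
        qed
        also have "(3 / 4 :: real) powr (p / 2 * real s) \<le> (3 / 4) powr (\<delta> * real s)"
        proof (rule powr_mono')
          show "\<delta> * real s \<le> p / 2 * real s" using \<delta> by (intro mult_right_mono) auto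
        qed auto
        finally show ?thesis using C by (simp add: \<eta>s mult_left_mono)
      qed
      have "(\<integral>\<^sup>+ x. ennreal_powr (component_max \<rho> T f s x) p \<partial>M) \<le>
        ennreal (2 powr a * ((real s + 2) powr (2 * a) * ergodic_const a) * c powr (a - p) * p / (p - a)
        + 4 * \<bar>component_gain \<rho> s\<bar> * c powr (2 - p) * p / (2 - p)) * (\<integral>\<^sup>+ x. ennreal (norm (f x) powr p) \<partial>M)"
        by (rule component_max_interpolated[OF sys \<rho> a p2 c])
      also have "\<dots> \<le> ennreal ((K1 * B + K2) * \<eta> ^ s) * (\<integral>\<^sup>+ x. ennreal (norm (f x) powr p) \<partial>M)"
      proof (intro mult_right_mono ennreal_leI)
        have "2 powr a * ((real s + 2) powr (2 * a) * ergodic_const a) * c powr (a - p) * p / (p - a) = K1 * ((real s + 2) powr (2 * a) * c powr (a - p))"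
          by (simp add: K1_def)
        also have "\<dots> \<le> K1 * (B * \<eta> ^ s)" using t1 K by (intro mult_left_mono) auto
        finally have 1: "2 powr a * ((real s + 2) powr (2 * a) * ergodic_const a) * c powr (a - p) * p / (p - a) \<le> K1 * (B * \<eta> ^ s)" .
        have "4 * \<bar>component_gain \<rho> s\<bar> * c powr (2 - p) * p / (2 - p) = (4 * p / (2 - p)) * (\<bar>component_gain \<rho> s\<bar> * c powr (2 - p))"
          by simp
        also have "\<dots> \<le> (4 * p / (2 - p)) * (C * \<eta> ^ s)" using t2 p p2 by (intro mult_left_mono) auto
        also have "\<dots> = K2 * \<eta> ^ s" by (simp add: K2_def)
        finally show "2 powr a * ((real s + 2) powr (2 * a) * ergodic_const a) * c powr (a - p) * p / (p - a)
          + 4 * \<bar>component_gain \<rho> s\<bar> * c powr (2 - p) * p / (2 - p) \<le> (K1 * B + K2) * \<eta> ^ s"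
          using 1 by (simp add: distrib_right)
      qed simp
      finally show "(\<integral>\<^sup>+ x. ennreal_powr (component_max \<rho> T f s x) p \<partial>M) \<le> ennreal ((K1 * B + K2) * \<eta> ^ s) * (\<integral>\<^sup>+ x. ennreal (norm (f x) powr p) \<partial>M)" .
    qed (use \<eta> in auto)
  qed
qed

text \<open>The weights \<open>w\<^sub>s\<close> decay so slowly that \<open>w\<^sub>s\<^sup>-\<^sup>p\<close> uses up only half of the exponential decay.\<close>
lemma component_sum_Lp:
  assumes \<rho>: "\<rho> > 1" and p: "1 < p" "p \<le> 2"
  shows "\<exists>C>0. \<forall>(M :: 'a measure) T f. dynamical_system M T \<longrightarrow> f \<in> borel_measurable M \<longrightarrow>
    (\<integral>\<^sup>+ x. ennreal_powr (\<Sum>s. component_max \<rho> T f s x) p \<partial>M) \<le> ennreal C * (\<integral>\<^sup>+ x. ennreal (norm (f x) powr p) \<partial>M)"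
proof -
  obtain C \<eta> where C: "C > 0" "0 < \<eta>" "\<eta> < 1" and decay: "\<And>s (M :: 'a measure) T f. dynamical_system M T \<Longrightarrow> f \<in> borel_measurable M \<Longrightarrow>
    (\<integral>\<^sup>+ x. ennreal_powr (component_max \<rho> T f s x) p \<partial>M) \<le> ennreal (C * \<eta> ^ s) * (\<integral>\<^sup>+ x. ennreal (norm (f x) powr p) \<partial>M)"
    using component_max_decay[OF \<rho> p, where 'a = 'a] by blast
  \<comment> \<open>This makes \<open>\<theta>\<^sup>-\<^sup>p\<^sup>s \<eta>\<^sup>s\<close> equal to \<open>\<surd>\<eta>\<^sup>s\<close>.\<close>
  define \<theta> where "\<theta> = \<eta> powr (1 / (2 * p))"
  have \<theta>: "0 < \<theta>" "\<theta> < 1" using C p powr_less_mono'[of \<eta> 0 "1 / (2 * p)"] by (auto simp: \<theta>_def)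
  define w where "w s = (1 - \<theta>) * \<theta> ^ s" for s :: nat
  have w: "w s > 0" for s using \<theta> by (simp add: w_def)
  have sumw: "(\<Sum>s. ennreal (w s)) \<le> 1"
  proof -
    have "w sums ((1 - \<theta>) * (1 / (1 - \<theta>)))" unfolding w_def by (intro sums_mult geometric_sums) (use \<theta> in simp)
    then have "w sums 1" using \<theta> by simp
    then have "(\<Sum>s. ennreal (w s)) = ennreal 1" by (intro suminf_ennreal_eq) (auto intro: less_imp_le[OF w])
    then show ?thesis by simp
  qed
  define r where "r = sqrt \<eta>"
  have r: "0 < r" "r < 1" using C by (auto simp: r_def)
  have wp: "w s powr (-p) * (C * \<eta> ^ s) = (1 - \<theta>) powr (-p) * C * r ^ s" for s
  proof -
    have "(\<theta> ^ s) powr (-p) * \<eta> ^ s = r ^ s"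
    proof -
      have "(\<theta> ^ s) powr (-p) = \<eta> powr (- (real s / 2))"
        using C p by (simp add: \<theta>_def powr_power powr_powr)
      moreover have "\<eta> ^ s = \<eta> powr real s" using C by (simp add: powr_realpow)
      moreover have "r ^ s = \<eta> powr (real s / 2)" using C by (simp add: r_def powr_half_sqrt[symmetric] powr_power)
      ultimately show ?thesis using C by (simp add: powr_add[symmetric])
    qed
    then show ?thesis using \<theta> by (simp add: w_def powr_mult mult_ac)
  qed
  define D where "D = (1 - \<theta>) powr (-p) * C * (1 / (1 - r))"
  show ?thesis
  proof (intro exI[of _ D] conjI allI impI)
    show "D > 0" using \<theta> C r by (simp add: D_def)
    fix M :: "'a measure" and T and f :: "'a \<Rightarrow> complex" assume sys: "dynamical_system M T" and f[measurable]: "f \<in> borel_measurable M"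
    have [measurable]: "component_max \<rho> T f s \<in> borel_measurable M" for s
      by (rule measurable_component_max[OF dynamical_systemD(2)[OF sys] f])
    let ?I = "\<integral>\<^sup>+ x. ennreal (norm (f x) powr p) \<partial>M"
    have "(\<integral>\<^sup>+ x. ennreal_powr (\<Sum>s. component_max \<rho> T f s x) p \<partial>M) \<le>
        (\<integral>\<^sup>+ x. (\<Sum>s. ennreal (w s powr (-p)) * ennreal_powr (component_max \<rho> T f s x) p) \<partial>M)"
      by (intro nn_integral_mono ennreal_powr_suminf_le w sumw) (use p in auto)
    also have "\<dots> = (\<Sum>s. ennreal (w s powr (-p)) * (\<integral>\<^sup>+ x. ennreal_powr (component_max \<rho> T f s x) p \<partial>M))"
      by (simp add: nn_integral_suminf nn_integral_cmult)
    also have "\<dots> \<le> (\<Sum>s. ennreal ((1 - \<theta>) powr (-p) * C * r ^ s) * ?I)"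
    proof (rule suminf_le)
      fix s
      have "ennreal (w s powr (-p)) * (\<integral>\<^sup>+ x. ennreal_powr (component_max \<rho> T f s x) p \<partial>M) \<le> ennreal (w s powr (-p)) * (ennreal (C * \<eta> ^ s) * ?I)"
        by (intro mult_left_mono decay sys f) simp
      also have "\<dots> = ennreal (w s powr (-p) * (C * \<eta> ^ s)) * ?I"
        using C by (subst ennreal_mult) (auto simp: mult.assoc)
      finally show "ennreal (w s powr (-p)) * (\<integral>\<^sup>+ x. ennreal_powr (component_max \<rho> T f s x) p \<partial>M) \<le> ennreal ((1 - \<theta>) powr (-p) * C * r ^ s) * ?I"
        by (simp only: wp)
    qed auto
    also have "\<dots> = (\<Sum>s. ennreal ((1 - \<theta>) powr (-p) * C * r ^ s)) * ?I" by (rule ennreal_suminf_multc)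
    also have "(\<Sum>s. ennreal ((1 - \<theta>) powr (-p) * C * r ^ s)) = ennreal D"
    proof (rule suminf_ennreal_eq)
      show "(\<lambda>s. (1 - \<theta>) powr (-p) * C * r ^ s) sums D" unfolding D_def by (intro sums_mult geometric_sums) (use r in simp)
    qed (use C r in auto)
    finally show "(\<integral>\<^sup>+ x. ennreal_powr (\<Sum>s. component_max \<rho> T f s x) p \<partial>M) \<le> ennreal D * ?I" .
  qed
qed

section \<open>The divisor function and its truncation\<close>

lemma div_real_bounds:
  assumes "a \<ge> 1"
  shows "real n / real a - 1 \<le> real (n div a)" "real (n div a) \<le> real n / real a"
proof -
  have n: "real n = real (n div a) * real a + real (n mod a)" by (metis div_mult_mod_eq of_nat_add of_nat_mult)
  have "real (n mod a) < real a" using assms by simp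
  then show "real n / real a - 1 \<le> real (n div a)" "real (n div a) \<le> real n / real a"
    using assms n by (auto simp: field_simps)
qed

lemma n_harm_conv_sum: "real n * harm N = (\<Sum>a=1..N. real n / real a)"
  by (simp add: harm_def sum_distrib_left divide_inverse)

lemma sum_divisors_upto: "(\<Sum>k=1..n. real (divisors_upto N k)) = (\<Sum>a=1..N. real (n div a))"
  unfolding divisors_upto_conv_sum
  by (subst sum.swap, intro sum.cong refl, subst sum_multiples) auto

lemma divisor_count_conv_upto:
  assumes "1 \<le> k" "k \<le> n"
  shows "divisor_count k = divisors_upto n k"
proof -
  have "{d. d dvd k} = {a \<in> {1..n}. a dvd k}"
    using assms by (auto dest: dvd_imp_le intro: Nat.gr0I simp: Suc_le_eq)
  then show ?thesis by (simp add: divisor_count_def divisors_upto_def)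
qed

abbreviation divisor_weight :: "nat \<Rightarrow> real" where
  "divisor_weight k \<equiv> real (divisor_count k)"

lemma weight_sum_divisor: "weight_sum divisor_weight n = (\<Sum>a=1..n. real (n div a))"
proof -
  have "weight_sum divisor_weight n = (\<Sum>k=1..n. real (divisors_upto n k))"
    unfolding weight_sum_def by (intro sum.cong refl) (simp add: divisor_count_conv_upto[of _ n])
  then show ?thesis by (simp only: sum_divisors_upto)
qed

lemma weight_sum_divisor_bounds:
  shows "real n / 2 * harm n \<le> weight_sum divisor_weight n"
    and "real n * (harm n - 1) \<le> weight_sum divisor_weight n"
    and "weight_sum divisor_weight n \<le> real n * harm n"
proof -
  note h = n_harm_conv_sum[of n n]
  have lo: "real n / real a - 1 \<le> real (n div a)" "real (n div a) \<le> real n / real a" "real (n div a) \<ge> 1" if "a \<in> {1..n}" for a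
  proof -
    have "n div a \<ge> 1" using that by (simp add: Suc_le_eq div_greater_zero_iff)
    then show "real (n div a) \<ge> 1" by simp
  qed (use div_real_bounds[of a n] that in auto)
  have "real n / 2 * harm n = (\<Sum>a=1..n. (real n / real a) / 2)" using h by (subst sum_divide_distrib[symmetric]) simp
  also have "\<dots> \<le> (\<Sum>a=1..n. real (n div a))"
    by (intro sum_mono) (use lo in force)
  finally show "real n / 2 * harm n \<le> weight_sum divisor_weight n" by (simp only: weight_sum_divisor)
  have "real n * (harm n - 1) = (\<Sum>a=1..n. real n / real a - 1)"
    using h by (simp add: sum_subtractf right_diff_distrib)
  also have "\<dots> \<le> (\<Sum>a=1..n. real (n div a))" by (intro sum_mono lo)
  finally show "real n * (harm n - 1) \<le> weight_sum divisor_weight n" by (simp only: weight_sum_divisor)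
  have "(\<Sum>a=1..n. real (n div a)) \<le> (\<Sum>a=1..n. real n / real a)" by (intro sum_mono lo)
  then show "weight_sum divisor_weight n \<le> real n * harm n" by (simp only: weight_sum_divisor h)
qed

lemma weight_sum_divisor_pos: "n \<ge> 1 \<Longrightarrow> weight_sum divisor_weight n > 0"
proof -
  assume "n \<ge> 1"
  then have "0 < real n / 2 * harm n" by simp
  then show ?thesis using weight_sum_divisor_bounds(1)[of n] by linarith
qed

lemma weight_sequence_divisor: "weight_sequence divisor_weight"
  unfolding weight_sequence_def
proof (intro conjI allI impI)
  fix n :: nat assume "1 \<le> n"
  then show "weight_sum divisor_weight n \<noteq> 0" using weight_sum_divisor_pos by force
next
  have "real n \<le> weight_sum divisor_weight n" for n
  proof -
    have "1 \<le> real (divisor_count k)" if "k \<in> {1..n}" for k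
    proof -
      have "card {1::nat} \<le> card {d. d dvd k}" using that by (intro card_mono) auto
      then show ?thesis by (simp add: divisor_count_def)
    qed
    then have "(\<Sum>k=1..n. 1) \<le> weight_sum divisor_weight n" unfolding weight_sum_def by (intro sum_mono) auto
    then show ?thesis by simp
  qed
  then show "filterlim (weight_sum divisor_weight) at_top sequentially"
    by (intro filterlim_at_top_mono[OF filterlim_real_sequentially]) auto
qed

text \<open>If \<open>d > N\<close> divides \<open>k \<le> n\<close>, then the complementary divisor \<open>k div d\<close> is at most \<open>N\<close>.\<close>
lemma divisor_count_le_small_divisors:
  assumes "1 \<le> k" "k \<le> n"
  shows "divisor_count k \<le> 2 * divisors_upto (floor_sqrt n) k"
proof -
  define N where "N = floor_sqrt n"
  let ?S = "{a \<in> {1..N}. a dvd k}"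
  let ?L = "{d. d dvd k \<and> N < d}"
  have fin: "finite ?S" "finite {d. d dvd k}" using assms by auto
  have "{d. d dvd k} \<subseteq> ?S \<union> ?L" using assms by (auto intro: Nat.gr0I simp: Suc_le_eq)
  then have "card {d. d dvd k} \<le> card (?S \<union> ?L)" using fin by (intro card_mono) auto
  also have "\<dots> \<le> card ?S + card ?L" by (rule card_Un_le)
  also have "card ?L \<le> card ?S"
  proof (rule card_inj_on_le[where f = "\<lambda>d. k div d"])
    show "inj_on (\<lambda>d. k div d) ?L"
      using assms by (intro inj_onI) (metis (no_types, lifting) dvd_div_mult_self dvd_mult_div_cancel mem_Collect_eq mult_cancel1 mult_eq_0_iff not_one_le_zero)
    show "(\<lambda>d. k div d) ` ?L \<subseteq> ?S"
    proof safe
      fix d assume d: "d dvd k" "N < d"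
      then obtain b where k: "k = d * b" by auto
      then have b: "b \<ge> 1" "k div d = b" using assms d by (auto simp: Suc_le_eq intro: Nat.gr0I)
      have "b \<le> N"
      proof (rule ccontr)
        assume "\<not> b \<le> N"
        then have "(Suc N)\<^sup>2 \<le> d * b" unfolding power2_eq_square using d by (intro mult_mono) auto
        moreover have "n < (Suc N)\<^sup>2" unfolding N_def by (rule Suc_floor_sqrt_power2_gt)
        ultimately show False using k assms by simp
      qed
      then show "k div d \<in> {1..N}" "k div d dvd k" using b k by auto
    qed
  qed (use fin in auto)
  finally show ?thesis by (simp add: divisor_count_def divisors_upto_def N_def)
qed

lemma truncated_average_conv_components:
  assumes "floor_sqrt n < 2 ^ S"
  shows "orbit_average T f (\<lambda>k. of_nat (divisors_upto (floor_sqrt n) k) / of_real (harm (floor_sqrt n))) n x = (\<Sum>s<S. component_average T f s n x)"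
  unfolding orbit_average_def component_average_def sum_ramanujan_components[OF assms, symmetric]
  by (simp add: sum_distrib_right sum_divide_distrib) (rule sum.swap)

text \<open>By positivity it suffices to consider \<open>\<bar>f\<bar>\<close>, and to pass from \<open>n\<close> to the next power of two \<open>m < 2 n\<close>. There
  \<open>d(k) \<le> 2 divisors_upto N k\<close>, while the normalizing sum is at least \<open>m/4 harm N\<close>, which explains the
  factor \<open>8\<close>.\<close>
lemma maximal_function_le_components:
  "maximal_function divisor_weight T f x \<le> 8 * (\<Sum>s. component_max 2 T (\<lambda>y. of_real (norm (f y))) s x)"
  unfolding maximal_function_def
proof (rule SUP_least)
  fix n :: nat assume "n \<in> {1..}"
  then have n: "n \<ge> 1" by simp
  define h :: "'a \<Rightarrow> complex" where "h y = of_real (norm (f y))" for y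
  let ?a = "\<lambda>k. norm (f ((T ^^ k) x))"
  obtain j where j: "n \<le> 2 ^ j" "2 ^ j < 2 * n"
  proof -
    define j where "j = (LEAST j. n \<le> 2 ^ j)"
    have ex: "n \<le> 2 ^ n" by (rule less_imp_le[OF less_exp])
    have le: "n \<le> 2 ^ j" unfolding j_def by (rule LeastI[of "\<lambda>j. n \<le> 2 ^ j", OF ex])
    have "2 ^ j < 2 * n"
    proof (cases j)
      case 0 then show ?thesis using n by simp
    next
      case (Suc i)
      then have "\<not> n \<le> 2 ^ i" using not_less_Least[of i "\<lambda>j. n \<le> 2 ^ j"] by (simp add: j_def)
      then show ?thesis using Suc by simp
    qed
    then show ?thesis using le that by blast
  qed
  define m where "m = (2::nat) ^ j"
  define N where "N = floor_sqrt m"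
  have m: "n \<le> m" "m < 2 * n" "m \<ge> 1" using j by (auto simp: m_def)
  have lac: "lacunary 2 j = m" by (simp add: lacunary_def m_def nat_power_eq)
  have N: "N \<ge> 1" "N \<le> n"
  proof -
    show "N \<ge> 1" using m by (simp add: N_def Suc_le_eq)
    have "N * N \<le> m" using floor_sqrt_power2_le[of m] by (simp only: N_def power2_eq_square)
    show "N \<le> n"
    proof (rule ccontr)
      assume "\<not> N \<le> n"
      then have "Suc n \<le> N" by simp
      from mult_le_mono[OF this this] have "Suc n * Suc n \<le> N * N" .
      then have "Suc n * Suc n < 2 * n" using \<open>N * N \<le> m\<close> m by linarith
      then show False by simp
    qed
  qed
  have W: "real m / 4 * harm N \<le> weight_sum divisor_weight n"
  proof -
    have "real m / 4 * harm N \<le> real n / 2 * harm n"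
      using m N by (intro mult_mono harm_mono) (auto simp: harm_nonneg)
    then show ?thesis using weight_sum_divisor_bounds(1)[of n] by linarith
  qed
  have hN: "harm N > (0::real)" using N by simp
  have W0: "0 < real m / 4 * harm N" using hN m by simp
  define G where "G = (\<Sum>k=1..m. real (divisors_upto N k) * ?a k)"
  have G0: "G \<ge> 0" unfolding G_def by (intro sum_nonneg) auto
  have "norm (\<Sum>k=1..n. of_real (divisor_weight k) * f ((T ^^ k) x)) \<le> (\<Sum>k=1..n. divisor_weight k * ?a k)"
    by (rule sum_norm_le) (simp add: norm_mult)
  also have "\<dots> \<le> (\<Sum>k=1..m. divisor_weight k * ?a k)"
    by (rule sum_mono2) (use m in auto)
  also have "\<dots> \<le> (\<Sum>k=1..m. 2 * real (divisors_upto N k) * ?a k)"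
  proof (intro sum_mono mult_right_mono)
    fix k assume "k \<in> {1..m}"
    then have "divisor_count k \<le> 2 * divisors_upto N k" using divisor_count_le_small_divisors[of k m] by (simp add: N_def)
    then show "divisor_weight k \<le> 2 * real (divisors_upto N k)" by linarith
  qed simp
  also have "\<dots> = 2 * G" by (simp add: G_def sum_distrib_left mult.assoc)
  finally have "norm (weighted_average divisor_weight T f n x) \<le> 2 * G / weight_sum divisor_weight n"
    using weight_sum_divisor_pos[OF n] by (simp add: weighted_average_def norm_divide divide_right_mono)
  also have "\<dots> \<le> 2 * G / (real m / 4 * harm N)"
    by (rule divide_left_mono[OF W _ mult_pos_pos[OF less_le_trans[OF W0 W] W0]]) (use G0 in simp)
  also have "\<dots> = 8 * (G / harm N / real m)" by simp
  finally have le1: "norm (weighted_average divisor_weight T f n x) \<le> 8 * (G / harm N / real m)" .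
  have "of_real (G / harm N / real m) = orbit_average T h (\<lambda>k. of_nat (divisors_upto N k) / of_real (harm N)) m x"
    by (simp add: orbit_average_def G_def h_def sum_divide_distrib)
  also have "\<dots> = (\<Sum>s<Suc N. component_average T h s m x)"
    unfolding N_def by (rule truncated_average_conv_components) (rule less_trans[OF lessI less_exp])
  finally have "norm (of_real (G / harm N / real m) :: complex) \<le> (\<Sum>s<Suc N. norm (component_average T h s m x))"
    by (metis norm_sum)
  then have le2: "G / harm N / real m \<le> (\<Sum>s<Suc N. norm (component_average T h s m x))"
    unfolding norm_of_real by (rule order_trans[OF abs_ge_self])
  have "ennreal (norm (weighted_average divisor_weight T f n x)) \<le> ennreal (8 * (\<Sum>s<Suc N. norm (component_average T h s m x)))"
    using le1 le2 by (intro ennreal_leI) linarith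
  also have "\<dots> = 8 * (\<Sum>s<Suc N. ennreal (norm (component_average T h s m x)))"
    by (subst ennreal_mult) (auto intro!: sum_nonneg simp: sum_ennreal simp del: sum.lessThan_Suc)
  also have "\<dots> \<le> 8 * (\<Sum>s<Suc N. component_max 2 T h s x)"
    unfolding component_max_def lac[symmetric] by (intro mult_left_mono sum_mono SUP_upper) auto
  also have "\<dots> \<le> 8 * (\<Sum>s. component_max 2 T h s x)"
    by (intro mult_left_mono sum_le_suminf) auto
  finally show "ennreal (norm (weighted_average divisor_weight T f n x)) \<le> 8 * (\<Sum>s. component_max 2 T (\<lambda>y. of_real (norm (f y))) s x)"
    unfolding h_def .
qed

section \<open>The dominated ergodic theorem\<close>

lemma maximal_function_Lp_le_2:
  assumes p: "1 < p" "p \<le> 2"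
  shows "\<exists>C>0. \<forall>(M :: 'a measure) T f. dynamical_system M T \<longrightarrow> f \<in> borel_measurable M \<longrightarrow>
    (\<integral>\<^sup>+ x. ennreal_powr (maximal_function divisor_weight T f x) p \<partial>M) \<le> ennreal C * (\<integral>\<^sup>+ x. ennreal (norm (f x) powr p) \<partial>M)"
proof -
  obtain C where C: "C > 0" and bound: "\<And>(M :: 'a measure) T f. dynamical_system M T \<Longrightarrow> f \<in> borel_measurable M \<Longrightarrow>
    (\<integral>\<^sup>+ x. ennreal_powr (\<Sum>s. component_max 2 T f s x) p \<partial>M) \<le> ennreal C * (\<integral>\<^sup>+ x. ennreal (norm (f x) powr p) \<partial>M)"
    using component_sum_Lp[of 2 p, where 'a = 'a] p by auto
  show ?thesis
  proof (intro exI[of _ "8 powr p * C"] conjI allI impI)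
    fix M :: "'a measure" and T and f :: "'a \<Rightarrow> complex"
    assume sys: "dynamical_system M T" and f[measurable]: "f \<in> borel_measurable M"
    let ?h = "\<lambda>y. of_real (norm (f y)) :: complex"
    have h[measurable]: "?h \<in> borel_measurable M" by measurable
    have [measurable]: "component_max 2 T ?h s \<in> borel_measurable M" for s
      by (rule measurable_component_max[OF dynamical_systemD(2)[OF sys] h])
    have "(\<integral>\<^sup>+ x. ennreal_powr (maximal_function divisor_weight T f x) p \<partial>M) \<le>
        (\<integral>\<^sup>+ x. ennreal (8 powr p) * ennreal_powr (\<Sum>s. component_max 2 T ?h s x) p \<partial>M)"
    proof (rule nn_integral_mono)
      fix x
      have "ennreal_powr (maximal_function divisor_weight T f x) p \<le> ennreal_powr (ennreal 8 * (\<Sum>s. component_max 2 T ?h s x)) p"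
        using maximal_function_le_components[of T f x] p by (intro ennreal_powr_mono) auto
      then show "ennreal_powr (maximal_function divisor_weight T f x) p \<le> ennreal (8 powr p) * ennreal_powr (\<Sum>s. component_max 2 T ?h s x) p"
        using p by (subst (asm) ennreal_powr_mult) auto
    qed
    also have "\<dots> = ennreal (8 powr p) * (\<integral>\<^sup>+ x. ennreal_powr (\<Sum>s. component_max 2 T ?h s x) p \<partial>M)"
      by (rule nn_integral_cmult) measurable
    also have "\<dots> \<le> ennreal (8 powr p) * (ennreal C * (\<integral>\<^sup>+ x. ennreal (norm (?h x) powr p) \<partial>M))"
      by (intro mult_left_mono bound sys h) simp
    also have "\<dots> = ennreal (8 powr p * C) * (\<integral>\<^sup>+ x. ennreal (norm (f x) powr p) \<partial>M)"
      using C by (simp add: ennreal_mult mult.assoc)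
    finally show "(\<integral>\<^sup>+ x. ennreal_powr (maximal_function divisor_weight T f x) p \<partial>M) \<le> \<dots>" .
  qed (use C in simp)
qed

text \<open>Jensen's inequality for the probability weights \<open>d(k) / \<Sum> d(k)\<close>.\<close>
lemma maximal_function_powr_le:
  assumes q: "q \<ge> 1"
  shows "ennreal_powr (maximal_function divisor_weight T f x) q \<le> maximal_function divisor_weight T (\<lambda>y. of_real (norm (f y) powr q)) x"
  unfolding maximal_function_def
proof (rule ennreal_powr_SUP_le)
  fix n :: nat assume "n \<in> {1..}"
  then have n: "n \<ge> 1" by simp
  define W where "W = weight_sum divisor_weight n"
  have W: "W > 0" using weight_sum_divisor_pos[OF n] by (simp add: W_def)
  have Wsum: "W = (\<Sum>k=1..n. divisor_weight k)" by (simp add: W_def weight_sum_def)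
  let ?a = "\<lambda>k. norm (f ((T ^^ k) x))"
  have "norm (\<Sum>k=1..n. of_real (divisor_weight k) * f ((T ^^ k) x)) \<le> (\<Sum>k=1..n. divisor_weight k * ?a k)"
    by (rule sum_norm_le) (simp add: norm_mult)
  then have "norm (weighted_average divisor_weight T f n x) \<le> (\<Sum>k=1..n. divisor_weight k * ?a k) / W"
    using W by (simp add: weighted_average_def W_def[symmetric] norm_divide divide_right_mono)
  then have "norm (weighted_average divisor_weight T f n x) powr q \<le> ((\<Sum>k=1..n. divisor_weight k * ?a k) / W) powr q"
    using q by (intro powr_mono2) auto
  also have "\<dots> = (\<Sum>k=1..n. divisor_weight k * ?a k) powr q / W powr q"
    by (rule powr_divide)
  also have "\<dots> \<le> (W powr (q - 1) * (\<Sum>k=1..n. divisor_weight k * ?a k powr q)) / W powr q"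
    unfolding Wsum using q by (intro divide_right_mono weighted_power_mean) auto
  also have "\<dots> = (\<Sum>k=1..n. divisor_weight k * ?a k powr q) / W"
    using W by (simp add: powr_diff)
  also have "\<dots> = norm (weighted_average divisor_weight T (\<lambda>y. of_real (norm (f y) powr q)) n x)"
  proof -
    have "weighted_average divisor_weight T (\<lambda>y. of_real (norm (f y) powr q)) n x = of_real ((\<Sum>k=1..n. divisor_weight k * ?a k powr q) / W)"
      by (simp add: weighted_average_def W_def)
    then have "norm (weighted_average divisor_weight T (\<lambda>y. of_real (norm (f y) powr q)) n x) = \<bar>(\<Sum>k=1..n. divisor_weight k * ?a k powr q) / W\<bar>"
      by (simp only: norm_of_real)
    then show ?thesis using W by (simp add: sum_nonneg)
  qed
  finally have "ennreal_powr (ennreal (norm (weighted_average divisor_weight T f n x))) q \<le>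
      ennreal (norm (weighted_average divisor_weight T (\<lambda>y. of_real (norm (f y) powr q)) n x))"
    by (simp add: ennreal_powr_ennreal ennreal_leI)
  also have "\<dots> \<le> (SUP n\<in>{1..}. ennreal (norm (weighted_average divisor_weight T (\<lambda>y. of_real (norm (f y) powr q)) n x)))"
    by (rule SUP_upper) (use n in simp)
  finally show "ennreal_powr (ennreal (norm (weighted_average divisor_weight T f n x))) q \<le> \<dots>" .
qed (use q in simp)

theorem maximal_function_Lp:
  assumes p: "1 < p"
  shows "\<exists>C>0. \<forall>(M :: 'a measure) T f. dynamical_system M T \<longrightarrow> f \<in> borel_measurable M \<longrightarrow>
    (\<integral>\<^sup>+ x. ennreal_powr (maximal_function divisor_weight T f x) p \<partial>M) \<le> ennreal C * (\<integral>\<^sup>+ x. ennreal (norm (f x) powr p) \<partial>M)"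
proof (cases "p \<le> 2")
  case True
  then show ?thesis by (intro maximal_function_Lp_le_2 p)
next
  case False
  obtain C where C: "C > 0" and bound: "\<And>(M :: 'a measure) T f. dynamical_system M T \<Longrightarrow> f \<in> borel_measurable M \<Longrightarrow>
    (\<integral>\<^sup>+ x. ennreal_powr (maximal_function divisor_weight T f x) 2 \<partial>M) \<le> ennreal C * (\<integral>\<^sup>+ x. ennreal (norm (f x) powr 2) \<partial>M)"
    using maximal_function_Lp_le_2[of 2, where 'a = 'a] by auto
  show ?thesis
  proof (intro exI[of _ C] conjI allI impI C)
    fix M :: "'a measure" and T and f :: "'a \<Rightarrow> complex"
    assume sys: "dynamical_system M T" and f[measurable]: "f \<in> borel_measurable M"
    let ?h = "\<lambda>y. of_real (norm (f y) powr (p / 2)) :: complex"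
    have h: "?h \<in> borel_measurable M" by measurable
    have "(\<integral>\<^sup>+ x. ennreal_powr (maximal_function divisor_weight T f x) p \<partial>M) \<le> (\<integral>\<^sup>+ x. ennreal_powr (maximal_function divisor_weight T ?h x) 2 \<partial>M)"
    proof (rule nn_integral_mono)
      fix x
      have "ennreal_powr (maximal_function divisor_weight T f x) p = ennreal_powr (ennreal_powr (maximal_function divisor_weight T f x) (p / 2)) 2"
        using p by (simp add: ennreal_powr_powr)
      also have "\<dots> \<le> ennreal_powr (maximal_function divisor_weight T ?h x) 2"
        using False by (intro ennreal_powr_mono maximal_function_powr_le) auto
      finally show "ennreal_powr (maximal_function divisor_weight T f x) p \<le> \<dots>" .
    qed
    also have "\<dots> \<le> ennreal C * (\<integral>\<^sup>+ x. ennreal (norm (?h x) powr 2) \<partial>M)" by (rule bound[OF sys h])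
    also have "(\<integral>\<^sup>+ x. ennreal (norm (?h x) powr 2) \<partial>M) = (\<integral>\<^sup>+ x. ennreal (norm (f x) powr p) \<partial>M)"
    proof -
      have "norm (?h x) powr 2 = norm (f x) powr p" for x
      proof -
        have "norm (?h x) powr 2 = (norm (f x) powr (p / 2)) powr 2" by (simp only: norm_of_real abs_of_nonneg powr_ge_zero)
        also have "\<dots> = norm (f x) powr p" by (simp only: powr_powr) simp
        finally show ?thesis .
      qed
      then show ?thesis by simp
    qed
    finally show "(\<integral>\<^sup>+ x. ennreal_powr (maximal_function divisor_weight T f x) p \<partial>M) \<le> ennreal C * (\<integral>\<^sup>+ x. ennreal (norm (f x) powr p) \<partial>M)" .
  qed
qed

lemma dominated_with_divisor:
  assumes p: "1 < p"
  shows "\<exists>C>0. dominated_with TYPE('a) p divisor_weight C"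
proof -
  obtain C where C: "C > 0" and bound: "\<And>(M :: 'a measure) T f. dynamical_system M T \<Longrightarrow> f \<in> borel_measurable M \<Longrightarrow>
    (\<integral>\<^sup>+ x. ennreal_powr (maximal_function divisor_weight T f x) p \<partial>M) \<le> ennreal C * (\<integral>\<^sup>+ x. ennreal (norm (f x) powr p) \<partial>M)"
    using maximal_function_Lp[OF p, where 'a = 'a] by blast
  have "Lp_norm M p (maximal_function divisor_weight T f) \<le> ennreal (C powr (1 / p)) * Lp_norm M p (\<lambda>x. ennreal (norm (f x)))"
    if "dynamical_system M T" "f \<in> Lp_space M p" for M :: "'a measure" and T f
  proof -
    have f: "f \<in> borel_measurable M" using that by (simp add: Lp_space_def)
    have "Lp_norm M p (maximal_function divisor_weight T f) \<le> ennreal_powr (ennreal C * (\<integral>\<^sup>+ x. ennreal (norm (f x) powr p) \<partial>M)) (1 / p)"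
      unfolding Lp_norm_def using p by (intro ennreal_powr_mono bound that f) auto
    also have "\<dots> = ennreal (C powr (1 / p)) * Lp_norm M p (\<lambda>x. ennreal (norm (f x)))"
      using p C by (simp add: ennreal_powr_mult Lp_norm_def ennreal_powr_ennreal)
    finally show ?thesis .
  qed
  then show ?thesis using C by (intro exI[of _ "C powr (1 / p)"]) (auto simp: dominated_with_def)
qed

section \<open>Convergence of the truncated averages\<close>

text \<open>The difference consists of at most \<open>N\<close> terms, each of which is at most \<open>q/N\<close>.\<close>
lemma harm_diff_div_le:
  assumes "q \<ge> 1"
  shows "harm N - harm (N div q) \<le> (real q :: real)"
proof (cases "N = 0")
  case False
  have "{1..N} = {1..w} \<union> {w<..N}" if "w \<le> N" for w using that by auto
  from this[OF div_le_dividend] have "{1..N} = {1..N div q} \<union> {N div q<..N}" .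
  then have "harm N = harm (N div q) + (\<Sum>m\<in>{N div q<..N}. inverse (real m))"
    unfolding harm_def by (simp only:) (subst sum.union_disjoint, auto)
  also have "(\<Sum>m\<in>{N div q<..N}. inverse (real m)) \<le> (\<Sum>m\<in>{N div q<..N}. real q / real N)"
  proof (rule sum_mono)
    fix m assume "m \<in> {N div q<..N}"
    then have m: "N div q < m" by simp
    then have "N < m * q" using assms by (simp add: div_less_iff_less_mult)
    then have "real N \<le> real m * real q" by (metis less_imp_le of_nat_le_iff of_nat_mult)
    then show "inverse (real m) \<le> real q / real N" using m False by (simp add: field_simps)
  qed
  also have "\<dots> \<le> real N * (real q / real N)"
    unfolding sum_constant by (intro mult_right_mono) auto
  finally show ?thesis using False by simp
qed simp

lemma harm_ratio_tendsto:
  assumes "q \<ge> 1"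
  shows "(\<lambda>N. harm (N div q) / harm N :: real) \<longlonglongrightarrow> 1"
proof -
  have "(\<lambda>N. 1 - harm (N div q) / harm N :: real) \<longlonglongrightarrow> 0"
  proof (rule Lim_null_comparison)
    show "(\<lambda>N. real q / harm N) \<longlonglongrightarrow> 0"
      by (intro real_tendsto_divide_at_top[OF tendsto_const harm_at_top])
    show "\<forall>\<^sub>F N in sequentially. norm (1 - harm (N div q) / harm N :: real) \<le> real q / harm N"
      using eventually_gt_at_top[of 0]
    proof eventually_elim
      case (elim N)
      then have h: "harm N > (0::real)" by simp
      have "1 - harm (N div q) / harm N = (harm N - harm (N div q)) / (harm N :: real)"
        using less_imp_neq[OF h] by (simp add: diff_divide_distrib)
      moreover have "0 \<le> harm N - (harm (N div q) :: real)" using harm_mono[of "N div q" N] by simp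
      ultimately show ?case
        using divide_right_mono[OF harm_diff_div_le[OF assms, of N] less_imp_le[OF h]] by simp
    qed
  qed
  from tendsto_diff[OF tendsto_const[of 1] this] show ?thesis by simp
qed

text \<open>Summing over \<open>m\<close> first displays the coefficient of each Ramanujan sum, which tends to \<open>1/q\<close> as \<open>N\<close> grows.\<close>
lemma ramanujan_component_conv_sum:
  "ramanujan_component s N k = (\<Sum>q\<in>{2^s..<2^Suc s}. of_real (harm (N div q) / harm N) / of_nat q * ramanujan_sum q k)"
proof -
  have "(\<Sum>m=1..N. ramanujan_block s (N div m) k / of_nat m) =
      (\<Sum>m=1..N. \<Sum>q\<in>{2^s..<2^Suc s}. if m \<le> N div q then ramanujan_sum q k / of_nat q * of_real (inverse (real m)) else 0)"
  proof (rule sum.cong[OF refl])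
    fix m assume m: "m \<in> {1..N}"
    have "ramanujan_block s (N div m) k / of_nat m = (\<Sum>q\<in>{2^s..<2^Suc s}. if q \<le> N div m then ramanujan_sum q k / of_nat q / of_nat m else 0)"
      unfolding ramanujan_block_def sum_divide_distrib by (intro sum.mono_neutral_cong_left) auto
    also have "\<dots> = (\<Sum>q\<in>{2^s..<2^Suc s}. if m \<le> N div q then ramanujan_sum q k / of_nat q * of_real (inverse (real m)) else 0)"
    proof (rule sum.cong[OF refl])
      fix q :: nat assume "q \<in> {2^s..<2^Suc s}"
      then have "q > 0" by (auto intro: Nat.gr0I)
      then have "q \<le> N div m \<longleftrightarrow> m \<le> N div q" using m by (simp add: less_eq_div_iff_mult_less_eq mult.commute)
      then show "(if q \<le> N div m then ramanujan_sum q k / of_nat q / of_nat m else 0) =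
        (if m \<le> N div q then ramanujan_sum q k / of_nat q * of_real (inverse (real m)) else 0)"
        by (simp add: divide_inverse)
    qed
    finally show "ramanujan_block s (N div m) k / of_nat m = \<dots>" .
  qed
  also have "\<dots> = (\<Sum>q\<in>{2^s..<2^Suc s}. ramanujan_sum q k / of_nat q * of_real (harm (N div q)))"
  proof (subst sum.swap, rule sum.cong[OF refl])
    fix q :: nat
    have "(\<Sum>m=1..N. if m \<le> N div q then ramanujan_sum q k / of_nat q * of_real (inverse (real m)) else 0) =
      (\<Sum>m=1..N div q. ramanujan_sum q k / of_nat q * of_real (inverse (real m)))"
      using div_le_dividend[of N q] by (intro sum.mono_neutral_cong_right) auto
    also have "\<dots> = ramanujan_sum q k / of_nat q * of_real (harm (N div q))"
      by (simp only: harm_def of_real_sum sum_distrib_left of_real_of_nat_eq of_real_inverse)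
    finally show "(\<Sum>m=1..N. if m \<le> N div q then ramanujan_sum q k / of_nat q * of_real (inverse (real m)) else 0) = \<dots>" .
  qed
  finally show ?thesis
    unfolding ramanujan_component_def by (simp add: sum_divide_distrib mult_ac)
qed

lemma filterlim_nat_div_at_top:
  assumes "Q > 0"
  shows "filterlim (\<lambda>n::nat. n div Q) at_top sequentially"
  unfolding filterlim_at_top
proof
  fix Z
  show "\<forall>\<^sub>F n in sequentially. Z \<le> n div Q"
    using eventually_ge_at_top[of "Z * Q"] by eventually_elim (use assms in \<open>simp add: less_eq_div_iff_mult_less_eq\<close>)
qed

text \<open>Birkhoff's theorem for \<open>T\<^sup>Q\<close> and the average over one period.\<close>
lemma periodic_average_convergent:
  fixes f :: "'a \<Rightarrow> complex"
  assumes sys: "dynamical_system M T" and f[measurable]: "f \<in> borel_measurable M" and bd: "\<And>x. norm (f x) \<le> B"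
    and per: "\<And>k i. c (k + i * Q) = c k" and Q: "Q > 0" and cb: "\<And>k. norm (c k) \<le> C"
  shows "AE x in M. convergent (\<lambda>n. orbit_average T f c n x)"
proof -
  note T = dynamical_systemD(2)[OF sys]
  have B0: "B \<ge> 0" using bd norm_ge_zero order_trans by blast
  have C0: "C \<ge> 0" using cb norm_ge_zero order_trans by blast
  let ?g = "orbit_average T f c Q"
  have gb: "norm (?g x) \<le> C * B" for x
  proof -
    have "norm (\<Sum>k=1..Q. c k * f ((T ^^ k) x)) \<le> (\<Sum>k=1..Q. C * B)"
      by (rule sum_norm_le) (auto simp: norm_mult intro!: mult_mono cb bd C0)
    then show ?thesis using Q by (simp add: orbit_average_def norm_divide field_simps)
  qed
  have "AE x in M. convergent (\<lambda>m. (\<Sum>i<m. ?g (((T ^^ Q) ^^ i) x)) / of_nat m)"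
    by (rule birkhoff_bounded[OF dynamical_system_funpow[OF sys] _ gb]) (rule measurable_orbit_average[OF T f])
  then show ?thesis
  proof eventually_elim
    case (elim x)
    then obtain L where L: "(\<lambda>m. (\<Sum>i<m. ?g (((T ^^ Q) ^^ i) x)) / of_nat m) \<longlonglongrightarrow> L" by (auto simp: convergent_def)
    have L': "(\<lambda>n. (\<Sum>i<n div Q. ?g (((T ^^ Q) ^^ i) x)) / of_nat (n div Q)) \<longlonglongrightarrow> L"
      by (rule filterlim_compose[OF L filterlim_nat_div_at_top[OF Q]])
    have r: "(\<lambda>n. of_nat (n div Q) * of_nat Q / of_nat n :: complex) \<longlonglongrightarrow> 1"
    proof -
      have "(\<lambda>n. real (n div Q) * real Q / real n) \<longlonglongrightarrow> 1"
      proof (rule tendsto_sandwich)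
        show "(\<lambda>n. 1 - real Q / real n) \<longlonglongrightarrow> 1" by real_asymp
        have dr: "real n - real Q \<le> real (n div Q) * real Q" "real (n div Q) * real Q \<le> real n" for n
          using div_real_bounds[of Q n] Q by (auto simp: field_simps)
        show "\<forall>\<^sub>F n in sequentially. 1 - real Q / real n \<le> real (n div Q) * real Q / real n"
          using eventually_gt_at_top[of 0]
        proof eventually_elim
          case (elim n)
          have "(real n - real Q) / real n \<le> real (n div Q) * real Q / real n" by (intro divide_right_mono dr) simp
          then show ?case using elim by (simp add: diff_divide_distrib)
        qed
        show "\<forall>\<^sub>F n in sequentially. real (n div Q) * real Q / real n \<le> 1"
          using eventually_gt_at_top[of 0] by eventually_elim (use dr in simp)
      qed simp
      then have "(\<lambda>n. complex_of_real (real (n div Q) * real Q / real n)) \<longlonglongrightarrow> of_real 1" by (rule tendsto_of_real)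
      then show ?thesis by simp
    qed
    have tail: "(\<lambda>n. (\<Sum>k\<in>{n div Q * Q<..n}. c k * f ((T ^^ k) x)) / of_nat n) \<longlonglongrightarrow> 0"
    proof (rule Lim_null_comparison)
      show "(\<lambda>n. (real Q * (C * B)) / real n) \<longlonglongrightarrow> 0" by (rule lim_const_over_n)
      show "\<forall>\<^sub>F n in sequentially. norm ((\<Sum>k\<in>{n div Q * Q<..n}. c k * f ((T ^^ k) x)) / of_nat n) \<le> (real Q * (C * B)) / real n"
      proof (rule always_eventually, rule allI)
        fix n
        have "norm (\<Sum>k\<in>{n div Q * Q<..n}. c k * f ((T ^^ k) x)) \<le> (\<Sum>k\<in>{n div Q * Q<..n}. C * B)"
          by (rule sum_norm_le) (auto simp: norm_mult intro!: mult_mono cb bd C0)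
        also have "\<dots> = real (card {n div Q * Q<..n}) * (C * B)" by simp
        also have "\<dots> \<le> real Q * (C * B)"
        proof (intro mult_right_mono)
          have "card {n div Q * Q<..n} \<le> Q" using mod_less_divisor[OF Q, of n] by (simp add: minus_div_mult_eq_mod)
          then show "real (card {n div Q * Q<..n}) \<le> real Q" by (simp only: of_nat_le_iff)
        qed (use B0 C0 in simp)
        finally show "norm ((\<Sum>k\<in>{n div Q * Q<..n}. c k * f ((T ^^ k) x)) / of_nat n) \<le> (real Q * (C * B)) / real n"
          by (simp add: norm_divide divide_right_mono)
      qed
    qed
    have "(\<lambda>n. orbit_average T f c n x) \<longlonglongrightarrow> 1 * L + 0"
      unfolding orbit_average_periodic_split[OF per Q, of T f _ x] by (intro tendsto_add tendsto_mult r L' tail)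
    then show ?case by (auto simp: convergent_def)
  qed
qed

lemma filterlim_floor_sqrt: "filterlim floor_sqrt at_top sequentially"
  unfolding filterlim_at_top
proof
  fix Z
  show "\<forall>\<^sub>F n in sequentially. Z \<le> floor_sqrt n"
    using eventually_ge_at_top[of "Z\<^sup>2"] by eventually_elim (rule le_floor_sqrtI)
qed

lemma filterlim_lacunary:
  assumes "\<rho> > 1"
  shows "filterlim (lacunary \<rho>) at_top sequentially"
proof -
  have "filterlim (\<lambda>j. \<rho> ^ j) at_top sequentially" using assms by real_asymp
  then have "filterlim (\<lambda>j. real (lacunary \<rho> j)) at_top sequentially"
    by (rule filterlim_at_top_mono) (auto intro: always_eventually lacunary_ge)
  then show ?thesis by (simp add: filterlim_sequentially_iff_filterlim_real)
qed

lemma component_average_convergent: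
  assumes sys: "dynamical_system M T" and f[measurable]: "f \<in> borel_measurable M" and bd: "\<And>x. norm (f x) \<le> B"
  shows "AE x in M. convergent (\<lambda>n. component_average T f s n x)"
proof -
  let ?U = "{2^s..<2^Suc s} :: nat set"
  have U: "q > 0" if "q \<in> ?U" for q using that by (auto intro: Nat.gr0I)
  have "AE x in M. \<forall>q\<in>?U. convergent (\<lambda>n. orbit_average T f (ramanujan_sum q) n x)"
  proof (rule AE_finite_allI)
    fix q assume "q \<in> ?U"
    then show "AE x in M. convergent (\<lambda>n. orbit_average T f (ramanujan_sum q) n x)"
      using U by (intro periodic_average_convergent[OF sys f bd, where Q = q and C = "real q"]
        ramanujan_sum_periodic norm_ramanujan_sum_le_self) auto
  qed simp
  then show ?thesis
  proof eventually_elim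
    case (elim x)
    have eq: "component_average T f s n x =
      (\<Sum>q\<in>?U. of_real (harm (floor_sqrt n div q) / harm (floor_sqrt n)) / of_nat q * orbit_average T f (ramanujan_sum q) n x)" for n
      unfolding component_average_def orbit_average_def ramanujan_component_conv_sum sum_distrib_right sum_divide_distrib sum_distrib_left
      by (subst sum.swap) (simp add: mult.assoc)
    show ?case unfolding eq
    proof (intro convergent_sum convergent_mult)
      fix q assume q: "q \<in> ?U"
      then have "(\<lambda>n. harm (floor_sqrt n div q) / harm (floor_sqrt n) :: real) \<longlonglongrightarrow> 1"
        using filterlim_compose[OF harm_ratio_tendsto filterlim_floor_sqrt, of q] U[OF q] by simp
      then have "(\<lambda>n. complex_of_real (harm (floor_sqrt n div q) / harm (floor_sqrt n)) / of_nat q) \<longlonglongrightarrow> of_real 1 / of_nat q"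
        by (intro tendsto_divide tendsto_of_real tendsto_const) (use U[OF q] in auto)
      then show "convergent (\<lambda>n. complex_of_real (harm (floor_sqrt n div q) / harm (floor_sqrt n)) / of_nat q)"
        by (rule convergentI)
      show "convergent (\<lambda>n. orbit_average T f (ramanujan_sum q) n x)" using elim q by blast
    qed
  qed
qed

definition truncated_average :: "('a \<Rightarrow> 'a) \<Rightarrow> ('a \<Rightarrow> complex) \<Rightarrow> nat \<Rightarrow> 'a \<Rightarrow> complex" where
  "truncated_average T f n = orbit_average T f (\<lambda>k. of_nat (divisors_upto (floor_sqrt n) k) / of_real (harm (floor_sqrt n))) n"

lemma truncated_average_conv_suminf: "truncated_average T f n x = (\<Sum>s. component_average T f s n x)"
proof -
  define S where "S = Suc (floor_sqrt n)"
  have S: "floor_sqrt n < 2 ^ S" unfolding S_def by (rule less_trans[OF lessI less_exp])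
  have "component_average T f s n x = 0" if "s \<notin> {..<S}" for s
  proof -
    have "(2::nat) ^ S \<le> 2 ^ s" using that by (intro power_increasing) auto
    then have "floor_sqrt n < 2 ^ s" using S by linarith
    then show ?thesis by (simp add: component_average_def orbit_average_def ramanujan_component_eq_0)
  qed
  then have "(\<Sum>s. component_average T f s n x) = (\<Sum>s<S. component_average T f s n x)"
    by (intro suminf_finite) auto
  then show ?thesis unfolding truncated_average_def using truncated_average_conv_components[OF S] by simp
qed

text \<open>Tannery's theorem: the components converge one by one, and their maximal functions form a majorant which
  is summable almost everywhere since its sum is square integrable.\<close>
lemma truncated_average_convergent:
  fixes f :: "'a \<Rightarrow> complex"
  assumes sys: "dynamical_system M T" and f[measurable]: "f \<in> borel_measurable M" and bd: "\<And>x. norm (f x) \<le> B" and \<rho>: "\<rho> > 1"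
  shows "AE x in M. convergent (\<lambda>j. truncated_average T f (lacunary \<rho> j) x)"
proof -
  interpret prob_space M using dynamical_systemD(1)[OF sys] .
  have [measurable]: "component_max \<rho> T f s \<in> borel_measurable M" for s
    by (rule measurable_component_max[OF dynamical_systemD(2)[OF sys] f])
  obtain C where "\<forall>(M :: 'a measure) T f. dynamical_system M T \<longrightarrow> f \<in> borel_measurable M \<longrightarrow>
      (\<integral>\<^sup>+ x. ennreal_powr (\<Sum>s. component_max \<rho> T f s x) 2 \<partial>M) \<le> ennreal C * (\<integral>\<^sup>+ x. ennreal (norm (f x) powr 2) \<partial>M)"
    using component_sum_Lp[OF \<rho>, of 2, where 'a = 'a] by auto
  then have C: "(\<integral>\<^sup>+ x. ennreal_powr (\<Sum>s. component_max \<rho> T f s x) 2 \<partial>M) \<le> ennreal C * (\<integral>\<^sup>+ x. ennreal (norm (f x) powr 2) \<partial>M)"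
    using sys f by blast
  have "(\<integral>\<^sup>+ x. ennreal (norm (f x) powr 2) \<partial>M) \<le> (\<integral>\<^sup>+ x. ennreal (B powr 2) \<partial>M)"
    by (intro nn_integral_mono ennreal_leI powr_mono2 bd) auto
  also have "\<dots> = ennreal (B powr 2)" by (simp add: emeasure_space_1)
  finally have "(\<integral>\<^sup>+ x. ennreal_powr (\<Sum>s. component_max \<rho> T f s x) 2 \<partial>M) \<le> ennreal C * ennreal (B powr 2)"
    using C by (meson mult_left_mono order_trans zero_le)
  then have "(\<integral>\<^sup>+ x. ennreal_powr (\<Sum>s. component_max \<rho> T f s x) 2 \<partial>M) \<noteq> \<infinity>"
    by (auto simp: top_unique ennreal_mult_eq_top_iff)
  then have "AE x in M. ennreal_powr (\<Sum>s. component_max \<rho> T f s x) 2 \<noteq> \<infinity>"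
    by (intro nn_integral_PInf_AE) measurable
  moreover have "AE x in M. \<forall>s. convergent (\<lambda>n. component_average T f s n x)"
    unfolding AE_all_countable using component_average_convergent[OF sys f bd] by blast
  ultimately show ?thesis
  proof eventually_elim
    case (elim x)
    have fin: "(\<Sum>s. component_max \<rho> T f s x) \<noteq> \<infinity>" using elim(1) by (auto simp: ennreal_powr_def)
    have "component_max \<rho> T f s x \<noteq> \<infinity>" for s
      using fin sum_le_suminf[of "\<lambda>s. component_max \<rho> T f s x" "{s}"] by (auto simp: top_unique)
    then have cm: "component_max \<rho> T f s x = ennreal (enn2real (component_max \<rho> T f s x))" for s by (simp add: less_top)
    define m where "m s = enn2real (component_max \<rho> T f s x)" for s
    have m0: "m s \<ge> 0" for s by (simp add: m_def)
    have "summable m"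
    proof (rule summable_suminf_not_top)
      show "(\<Sum>i. ennreal (m i)) \<noteq> \<top>" using fin cm by (simp add: m_def[symmetric])
    qed (rule m0)
    note lac = filterlim_lacunary[OF \<rho>]
    obtain b where b: "\<And>s. (\<lambda>n. component_average T f s n x) \<longlonglongrightarrow> b s" using elim(2) unfolding convergent_def by metis
    have "(\<lambda>j. \<Sum>s. component_average T f s (lacunary \<rho> j) x) \<longlonglongrightarrow> (\<Sum>s. b s)"
    proof (rule tannerys_theorem[THEN conjunct2, THEN conjunct2])
      show "(\<lambda>j. component_average T f s (lacunary \<rho> j) x) \<longlonglongrightarrow> b s" for s
        by (rule filterlim_compose[OF b lac])
      show "\<forall>\<^sub>F (s, j) in at_top \<times>\<^sub>F sequentially. norm (component_average T f s (lacunary \<rho> j) x) \<le> m s"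
      proof (rule always_eventually, clarify)
        fix s j
        have "ennreal (norm (component_average T f s (lacunary \<rho> j) x)) \<le> component_max \<rho> T f s x"
          unfolding component_max_def by (rule SUP_upper) simp
        also have "\<dots> = ennreal (m s)" using cm by (simp add: m_def)
        finally show "norm (component_average T f s (lacunary \<rho> j) x) \<le> m s" using m0 by simp
      qed
    qed (use \<open>summable m\<close> in auto)
    then show ?case unfolding truncated_average_conv_suminf by (rule convergentI)
  qed
qed

section \<open>Convergence along all averages\<close>

text \<open>The divisors \<open>a \<le> N\<close> with \<open>k div a > N\<close> correspond to divisors above \<open>N\<close>.\<close>
lemma double_small_divisors_minus_divisor_count_le:
  assumes "1 \<le> k" "k \<le> n"
  shows "2 * divisors_upto N k \<le> divisor_count k + card {a \<in> {1..N}. a dvd k \<and> k div a \<le> N}"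
proof -
  let ?S = "{a \<in> {1..N}. a dvd k}" and ?E = "{a \<in> {1..N}. a dvd k \<and> k div a \<le> N}"
    and ?F = "{a \<in> {1..N}. a dvd k \<and> N < k div a}" and ?L = "{d. d dvd k \<and> N < d}"
  have fin: "finite {d. d dvd k}" "finite ?L" using assms by auto
  have "card ?S = card (?E \<union> ?F)" by (intro arg_cong[of _ _ card]) auto
  also have "\<dots> = card ?E + card ?F" by (intro card_Un_disjoint) auto
  also have "card ?F \<le> card ?L"
  proof (rule card_inj_on_le[where f = "\<lambda>d. k div d"])
    show "inj_on (\<lambda>d. k div d) ?F"
    proof (rule inj_onI)
      fix a b assume ab: "a \<in> ?F" "b \<in> ?F" "k div a = k div b"
      have "a * (k div a) = k" "b * (k div b) = k" using ab by auto
      then have "a * (k div a) = b * (k div a)" using ab(3) by simp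
      moreover have "k div a \<noteq> 0" using ab by auto
      ultimately show "a = b" by simp
    qed
    show "(\<lambda>d. k div d) ` ?F \<subseteq> ?L" by (auto elim!: dvdE)
  qed (use fin in auto)
  finally have 1: "card ?S \<le> card ?E + card ?L" by simp
  have "{d. d dvd k} = ?S \<union> ?L" using assms by (auto simp: Suc_le_eq intro: Nat.gr0I)
  then have "card {d. d dvd k} = card (?S \<union> ?L)" by (rule arg_cong)
  also have "\<dots> = card ?S + card ?L" using fin by (intro card_Un_disjoint) auto
  finally show ?thesis using 1 by (simp add: divisor_count_def divisors_upto_def)
qed

text \<open>Dirichlet's hyperbola method: the surplus is at most the number of pairs \<open>(a, b)\<close> with \<open>a, b \<le> \<surd>n\<close>.\<close>
lemma sum_divisor_surplus_le:
  "(\<Sum>k=1..n. 2 * real (divisors_upto (floor_sqrt n) k) - real (divisor_count k)) \<le> real n"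
proof -
  define N where "N = floor_sqrt n"
  let ?E = "\<lambda>k. {a \<in> {1..N}. a dvd k \<and> k div a \<le> N}"
  have "(\<Sum>k=1..n. 2 * real (divisors_upto N k) - real (divisor_count k)) \<le> (\<Sum>k=1..n. real (card (?E k)))"
  proof (rule sum_mono)
    fix k assume "k \<in> {1..n}"
    then have "2 * divisors_upto N k \<le> divisor_count k + card (?E k)"
      by (intro double_small_divisors_minus_divisor_count_le[of k n]) auto
    then have "real (2 * divisors_upto N k) \<le> real (divisor_count k + card (?E k))" by (simp only: of_nat_le_iff)
    then show "2 * real (divisors_upto N k) - real (divisor_count k) \<le> real (card (?E k))" by simp
  qed
  also have "\<dots> = real (card (SIGMA k:{1..n}. ?E k))" by (simp add: card_SigmaI)
  also have "card (SIGMA k:{1..n}. ?E k) \<le> card ({1..N} \<times> {1..N})"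
  proof (rule card_inj_on_le[where f = "\<lambda>(k, a). (a, k div a)"])
    show "inj_on (\<lambda>(k, a). (a, k div a)) (SIGMA k:{1..n}. ?E k)"
      by (rule inj_onI) (auto elim!: dvdE)
    show "(\<lambda>(k, a). (a, k div a)) ` (SIGMA k:{1..n}. ?E k) \<subseteq> {1..N} \<times> {1..N}"
      by (auto elim!: dvdE)
  qed auto
  also have "card ({1..N} \<times> {1..N}) = N\<^sup>2" by (simp add: power2_eq_square)
  also have "N\<^sup>2 \<le> n" by (simp add: N_def)
  finally show ?thesis by (simp add: N_def)
qed

text \<open>The hyperbola method once more, now for the total mass; the error is smaller than the main term by a
  factor of order \<open>log n\<close>.\<close>
lemma weight_sum_divisor_asymp:
  "\<bar>weight_sum divisor_weight n - 2 * real n * harm (floor_sqrt n)\<bar> \<le> 3 * real n"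
proof -
  define N where "N = floor_sqrt n"
  have W: "weight_sum divisor_weight n = (\<Sum>k=1..n. real (divisor_count k))" by (simp add: weight_sum_def)
  have up: "(\<Sum>k=1..n. real (divisor_count k)) \<le> (\<Sum>k=1..n. 2 * real (divisors_upto N k))"
  proof (rule sum_mono)
    fix k assume "k \<in> {1..n}"
    then have "divisor_count k \<le> 2 * divisors_upto N k" using divisor_count_le_small_divisors[of k n] by (simp add: N_def)
    then show "real (divisor_count k) \<le> 2 * real (divisors_upto N k)" by linarith
  qed
  have lo: "(\<Sum>k=1..n. 2 * real (divisors_upto N k)) - (\<Sum>k=1..n. real (divisor_count k)) \<le> real n"
    using sum_divisor_surplus_le[of n] by (simp only: sum_subtractf N_def)
  have S: "(\<Sum>k=1..n. 2 * real (divisors_upto N k)) = 2 * (\<Sum>a=1..N. real (n div a))"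
    by (simp only: sum_distrib_left[symmetric] sum_divisors_upto)
  note h = n_harm_conv_sum[of n N]
  have fl: "real n / real a - 1 \<le> real (n div a)" "real (n div a) \<le> real n / real a" if "a \<in> {1..N}" for a
    using div_real_bounds[of a n] that by auto
  have "(\<Sum>a=1..N. real (n div a)) \<le> real n * harm N" unfolding h by (intro sum_mono fl)
  moreover have "real n * harm N - real N \<le> (\<Sum>a=1..N. real (n div a))"
  proof -
    have "real n * harm N - real N = (\<Sum>a=1..N. real n / real a - 1)" by (simp add: h sum_subtractf)
    also have "\<dots> \<le> (\<Sum>a=1..N. real (n div a))" by (intro sum_mono fl)
    finally show ?thesis .
  qed
  moreover have "real N \<le> real n" by (simp add: N_def floor_sqrt_le)
  ultimately show ?thesis using up lo unfolding W S N_def[symmetric] by linarith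
qed

lemma n_over_weight_sum_le:
  assumes "n \<ge> 1"
  shows "real n / weight_sum divisor_weight n \<le> 2 / harm n"
proof -
  have h: "harm n > (0::real)" using assms by simp
  have "real n * harm n \<le> 2 * weight_sum divisor_weight n" using weight_sum_divisor_bounds(1)[of n] by simp
  then show ?thesis using weight_sum_divisor_pos[OF assms] h by (simp add: divide_le_eq) (simp add: field_simps)
qed

lemma weighted_average_truncated:
  assumes n: "n \<ge> 1" and bd: "\<And>x. norm (f x) \<le> B"
  shows "norm (weighted_average divisor_weight T f n x
    - of_real (2 * real n * harm (floor_sqrt n) / weight_sum divisor_weight n) * truncated_average T f n x) \<le> B * (2 / harm n)"
proof -
  define N where "N = floor_sqrt n"
  define W where "W = weight_sum divisor_weight n"
  have W: "W > 0" unfolding W_def by (rule weight_sum_divisor_pos[OF n])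
  have B0: "B \<ge> 0" using bd norm_ge_zero order_trans by blast
  have N1: "N \<ge> 1" using n by (simp add: N_def Suc_le_eq)
  then have hN: "harm N > (0::real)" by simp
  let ?f = "\<lambda>k. f ((T ^^ k) x)"
  have eq1: "of_real (2 * real n * harm N / W) * truncated_average T f n x = (\<Sum>k=1..n. of_real (2 * real (divisors_upto N k)) * ?f k) / of_real W"
  proof -
    have "of_real (2 * real n * harm N / W) * truncated_average T f n x =
        of_real (2 * real n * harm N / W) * ((\<Sum>k=1..n. of_nat (divisors_upto N k) * ?f k) / (of_real (harm N) * of_nat n))"
      by (simp add: truncated_average_def orbit_average_def N_def[symmetric] sum_divide_distrib)
    also have "\<dots> = 2 * (\<Sum>k=1..n. of_nat (divisors_upto N k) * ?f k) / of_real W"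
    proof -
      have "of_real (2 * real n * H / W) * (Z / (of_real H * of_nat n)) = 2 * Z / of_real W" if "H > 0" for H and Z :: complex
        using that n by simp
      from this[OF hN] show ?thesis .
    qed
    finally show ?thesis by (simp add: sum_distrib_left mult.assoc)
  qed
  have eq2: "weighted_average divisor_weight T f n x = (\<Sum>k=1..n. of_real (divisor_weight k) * ?f k) / of_real W"
    by (simp add: weighted_average_def W_def)
  have "weighted_average divisor_weight T f n x - of_real (2 * real n * harm N / W) * truncated_average T f n x =
      (\<Sum>k=1..n. of_real (divisor_weight k - 2 * real (divisors_upto N k)) * ?f k) / of_real W"
    unfolding eq1 eq2
    by (simp only: diff_divide_distrib[symmetric] sum_subtractf[symmetric] left_diff_distrib of_real_diff)
  also have "norm \<dots> \<le> (\<Sum>k=1..n. (2 * real (divisors_upto N k) - divisor_weight k) * B) / W"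
  proof -
    have "norm (\<Sum>k=1..n. of_real (divisor_weight k - 2 * real (divisors_upto N k)) * ?f k) \<le> (\<Sum>k=1..n. (2 * real (divisors_upto N k) - divisor_weight k) * B)"
    proof (rule sum_norm_le)
      fix k assume "k \<in> {1..n}"
      then have "divisor_count k \<le> 2 * divisors_upto N k" using divisor_count_le_small_divisors[of k n] by (simp add: N_def)
      then have "divisor_weight k \<le> 2 * real (divisors_upto N k)" by linarith
      then have "norm (of_real (divisor_weight k - 2 * real (divisors_upto N k)) :: complex) = 2 * real (divisors_upto N k) - divisor_weight k"
        by (simp only: norm_of_real)
      then show "norm (of_real (divisor_weight k - 2 * real (divisors_upto N k)) * ?f k) \<le> (2 * real (divisors_upto N k) - divisor_weight k) * B"
        unfolding norm_mult using mult_left_mono[OF bd[of "(T ^^ k) x"], of "2 * real (divisors_upto N k) - divisor_weight k"]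
          \<open>divisor_weight k \<le> _\<close> by simp
    qed
    then show ?thesis using W by (simp add: norm_divide divide_right_mono)
  qed
  also have "\<dots> \<le> (real n * B) / W"
    using sum_divisor_surplus_le[of n] W B0 by (intro divide_right_mono) (auto simp: sum_distrib_right[symmetric] N_def intro!: mult_right_mono)
  also have "\<dots> = B * (real n / W)" by simp
  also have "\<dots> \<le> B * (2 / harm n)" unfolding W_def by (intro mult_left_mono n_over_weight_sum_le n B0)
  finally show ?thesis by (simp only: N_def W_def)
qed

lemma weight_ratio_tendsto:
  "(\<lambda>n. 2 * real n * harm (floor_sqrt n) / weight_sum divisor_weight n) \<longlonglongrightarrow> 1"
proof -
  have "(\<lambda>n. 1 - 2 * real n * harm (floor_sqrt n) / weight_sum divisor_weight n) \<longlonglongrightarrow> 0"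
  proof (rule Lim_null_comparison)
    show "(\<lambda>n. 3 * (2 / harm n) :: real) \<longlonglongrightarrow> 0"
      by (intro tendsto_mult_right_zero real_tendsto_divide_at_top[OF tendsto_const harm_at_top])
    show "\<forall>\<^sub>F n in sequentially. norm (1 - 2 * real n * harm (floor_sqrt n) / weight_sum divisor_weight n) \<le> 3 * (2 / harm n)"
      using eventually_ge_at_top[of 1]
    proof eventually_elim
      case (elim n)
      define W where "W = weight_sum divisor_weight n"
      have W: "W > 0" unfolding W_def by (rule weight_sum_divisor_pos[OF elim])
      have "norm (1 - 2 * real n * harm (floor_sqrt n) / W) = \<bar>W - 2 * real n * harm (floor_sqrt n)\<bar> / W"
      proof -
        have "1 - 2 * real n * harm (floor_sqrt n) / W = (W - 2 * real n * harm (floor_sqrt n)) / W"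
          using W by (simp add: diff_divide_distrib)
        then show ?thesis using W by (simp add: abs_divide)
      qed
      also have "\<dots> \<le> 3 * real n / W" unfolding W_def[symmetric]
        using weight_sum_divisor_asymp[of n] W by (intro divide_right_mono) (auto simp: W_def)
      also have "\<dots> = 3 * (real n / W)" by simp
      also have "\<dots> \<le> 3 * (2 / harm n)" unfolding W_def by (intro mult_left_mono n_over_weight_sum_le elim) simp
      finally show ?case by (simp only: W_def)
    qed
  qed
  from tendsto_diff[OF tendsto_const[of 1] this] show ?thesis by simp
qed

lemma weighted_average_lacunary_convergent:
  fixes f :: "'a \<Rightarrow> complex"
  assumes bd: "\<And>x. norm (f x) \<le> B" and \<rho>: "\<rho> > 1"
    and conv: "convergent (\<lambda>j. truncated_average T f (lacunary \<rho> j) x)"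
  shows "convergent (\<lambda>j. weighted_average divisor_weight T f (lacunary \<rho> j) x)"
proof -
  obtain L where L: "(\<lambda>j. truncated_average T f (lacunary \<rho> j) x) \<longlonglongrightarrow> L" using conv by (auto simp: convergent_def)
  define u where "u n = weighted_average divisor_weight T f n x" for n
  define v where "v n = of_real (2 * real n * harm (floor_sqrt n) / weight_sum divisor_weight n) * truncated_average T f n x" for n
  have "(\<lambda>n. u n - v n) \<longlonglongrightarrow> 0"
  proof (rule Lim_null_comparison)
    show "(\<lambda>n. B * (2 / harm n)) \<longlonglongrightarrow> 0"
      by (intro tendsto_mult_right_zero real_tendsto_divide_at_top[OF tendsto_const harm_at_top])
    show "\<forall>\<^sub>F n in sequentially. norm (u n - v n) \<le> B * (2 / harm n)"
      using eventually_ge_at_top[of 1]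
      by eventually_elim (simp only: u_def v_def weighted_average_truncated[OF _ bd])
  qed
  then have 1: "(\<lambda>j. u (lacunary \<rho> j) - v (lacunary \<rho> j)) \<longlonglongrightarrow> 0"
    by (rule filterlim_compose[OF _ filterlim_lacunary[OF \<rho>]])
  have 2: "(\<lambda>j. v (lacunary \<rho> j)) \<longlonglongrightarrow> of_real 1 * L"
    unfolding v_def
    by (intro tendsto_mult tendsto_of_real L filterlim_compose[OF weight_ratio_tendsto filterlim_lacunary[OF \<rho>]])
  have "(\<lambda>j. u (lacunary \<rho> j)) \<longlonglongrightarrow> of_real 1 * L" using tendsto_add[OF 1 2] by simp
  then show ?thesis unfolding u_def by (rule convergentI)
qed

text \<open>Both the new terms and the change of the normalization are bounded by the relative growth of the weights.\<close>
lemma weighted_average_slow_variation: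
  assumes bd: "\<And>x. norm (f x) \<le> B" and mn: "1 \<le> m" "m \<le> n"
  shows "norm (weighted_average divisor_weight T f n x - weighted_average divisor_weight T f m x) \<le>
    2 * B * (1 - weight_sum divisor_weight m / weight_sum divisor_weight n)"
proof -
  define W where "W = weight_sum divisor_weight"
  define S where "S n = (\<Sum>k=1..n. of_real (divisor_weight k) * f ((T ^^ k) x))" for n
  have W: "W m > 0" "W n > 0" using weight_sum_divisor_pos mn by (auto simp: W_def)
  have sp: "{1..n} = {1..m} \<union> {m<..n}" using mn by auto
  have Wd: "W n - W m = (\<Sum>k\<in>{m<..n}. divisor_weight k)"
    unfolding W_def weight_sum_def sp by (subst sum.union_disjoint) auto
  have Sd: "S n - S m = (\<Sum>k\<in>{m<..n}. of_real (divisor_weight k) * f ((T ^^ k) x))"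
    unfolding S_def sp by (subst sum.union_disjoint) auto
  have WW: "W m \<le> W n" using Wd sum_nonneg[of "{m<..n}" divisor_weight] by simp
  have t: "norm (\<Sum>k\<in>A. of_real (divisor_weight k) * f ((T ^^ k) x)) \<le> B * (\<Sum>k\<in>A. divisor_weight k)" for A
    unfolding sum_distrib_left
  proof (rule sum_norm_le)
    fix k
    show "norm (of_real (divisor_weight k) * f ((T ^^ k) x)) \<le> B * divisor_weight k"
      using mult_left_mono[OF bd[of "(T ^^ k) x"], of "divisor_weight k"] by (simp add: norm_mult mult.commute)
  qed
  have Sm: "norm (S m) \<le> B * W m" using t[of "{1..m}"] by (simp add: S_def W_def weight_sum_def)
  have Snm: "norm (S n - S m) \<le> B * (W n - W m)" unfolding Sd Wd by (rule t)
  have "S n / of_real (W n) - S m / of_real (W m) = (S n - S m) / of_real (W n) - S m * of_real ((1 / W m) - 1 / W n)"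
    using W by (simp add: field_simps)
  also have "norm \<dots> \<le> norm ((S n - S m) / of_real (W n)) + norm (S m * of_real ((1 / W m) - 1 / W n))"
    by (rule norm_triangle_ineq4)
  also have "\<dots> \<le> B * (W n - W m) / W n + (B * W m) * ((1 / W m) - 1 / W n)"
  proof (rule add_mono)
    show "norm ((S n - S m) / of_real (W n)) \<le> B * (W n - W m) / W n"
      using Snm W by (simp add: norm_divide divide_right_mono)
    have "(1 / W m) - 1 / W n \<ge> 0" using W WW by (simp add: frac_le)
    then show "norm (S m * of_real ((1 / W m) - 1 / W n)) \<le> (B * W m) * ((1 / W m) - 1 / W n)"
      using Sm by (simp only: norm_mult norm_of_real abs_of_nonneg) (intro mult_right_mono)
  qed
  also have "\<dots> = 2 * B * (1 - W m / W n)" using W by (simp add: field_simps)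
  finally show ?thesis by (simp add: weighted_average_def S_def W_def)
qed

lemma harm_le_ln: "n \<ge> 1 \<Longrightarrow> harm n \<le> ln (real n) + 1"
  using decseqD[OF decseq_harm_diff_ln, of 0 "n - 1"] by (simp add: harm_expand)

text \<open>From \<open>n (harm n - 1) \<le> \<Sum>\<^sub>k\<^sub>\<le>\<^sub>n d(k) \<le> n harm n\<close>. The left-hand side tends to \<open>1/\<rho>\<close> as \<open>j\<close> grows.\<close>
lemma weight_sum_ratio_ge:
  assumes \<rho>: "\<rho> > 1" and j: "\<rho> ^ j \<ge> 3"
  defines "y \<equiv> \<rho> ^ j"
  shows "y * (ln y - 1) / ((\<rho> * y + 1) * (ln (\<rho> * y + 1) + 1))
    \<le> weight_sum divisor_weight (lacunary \<rho> j) / weight_sum divisor_weight (lacunary \<rho> (Suc j))"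
proof -
  define m where "m = lacunary \<rho> j"
  define n where "n = lacunary \<rho> (Suc j)"
  have mn: "m \<ge> 1" "n \<ge> 1" using lacunary_pos[OF \<rho>] by (auto simp: m_def n_def)
  have y: "y \<ge> 3" using j by (simp add: y_def)
  have ym: "y \<le> real m" unfolding y_def m_def by (rule lacunary_ge)
  have ny: "real n \<le> \<rho> * y + 1"
  proof -
    have "0 \<le> \<rho> * \<rho> ^ j" using \<rho> by simp
    then show ?thesis unfolding n_def lacunary_def y_def power_Suc by linarith
  qed
  have ln1: "ln y - 1 \<ge> 0"
  proof -
    have "exp 1 \<le> y" using exp_le y by linarith
    then show ?thesis using y by (simp add: ln_ge_iff)
  qed
  have "y * (ln y - 1) \<le> real m * (harm m - 1)"
  proof (intro mult_mono)
    have "ln y \<le> ln (real m + 1)" using ym y by (subst ln_le_cancel_iff) auto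
    then show "ln y - 1 \<le> harm m - 1" using ln_le_harm[of m] by linarith
  qed (use ym ln1 y in auto)
  also have "\<dots> \<le> weight_sum divisor_weight m" by (rule weight_sum_divisor_bounds)
  finally have 1: "y * (ln y - 1) \<le> weight_sum divisor_weight m" .
  have "weight_sum divisor_weight n \<le> real n * harm n" by (rule weight_sum_divisor_bounds)
  also have "\<dots> \<le> (\<rho> * y + 1) * (ln (\<rho> * y + 1) + 1)"
  proof (intro mult_mono ny)
    have "ln (real n) \<le> ln (\<rho> * y + 1)" using ny mn by (subst ln_le_cancel_iff) auto
    then show "harm n \<le> ln (\<rho> * y + 1) + 1" using harm_le_ln[OF mn(2)] by linarith
  qed (use \<rho> y in \<open>auto simp: harm_nonneg\<close>)
  finally have 2: "weight_sum divisor_weight n \<le> (\<rho> * y + 1) * (ln (\<rho> * y + 1) + 1)" .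
  show ?thesis unfolding m_def[symmetric] n_def[symmetric]
    using 1 2 weight_sum_divisor_pos[OF mn(1)] weight_sum_divisor_pos[OF mn(2)] by (intro frac_le) auto
qed

text \<open>Between consecutive terms of the lacunary sequence with ratio \<open>\<rho>\<close> the averages vary by at most about
  \<open>2 B (1 - 1/\<rho>)\<close>, which is arbitrarily small for \<open>\<rho>\<close> close to \<open>1\<close>.\<close>
lemma convergent_from_lacunary:
  fixes f :: "'a \<Rightarrow> complex"
  assumes bd: "\<And>x. norm (f x) \<le> B"
    and conv: "\<And>r::nat. convergent (\<lambda>j. weighted_average divisor_weight T f (lacunary (1 + 1 / (real r + 1)) j) x)"
  shows "convergent (\<lambda>n. weighted_average divisor_weight T f n x)"
proof -
  define a where "a n = weighted_average divisor_weight T f n x" for n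
  define W where "W = weight_sum divisor_weight"
  have B0: "B \<ge> 0" using bd norm_ge_zero order_trans by blast
  have "Cauchy a"
  proof (rule metric_CauchyI)
    fix \<epsilon> :: real assume \<epsilon>: "\<epsilon> > 0"
    \<comment> \<open>For \<open>\<rho> = 1 + 1/(r+1)\<close> one has \<open>1 - 1/\<rho> = 1/(r+2)\<close>.\<close>
    obtain r :: nat where r: "2 * B / (\<epsilon> / 4) < real r" using reals_Archimedean2 by blast
    define \<rho> where "\<rho> = 1 + 1 / (real r + 1)"
    have \<rho>: "\<rho> > 1" by (simp add: \<rho>_def add_pos_pos)
    have \<rho>r: "2 * B * (1 - 1 / \<rho>) < \<epsilon> / 4"
    proof -
      have "1 - 1 / \<rho> = 1 / (real r + 2)" by (simp add: \<rho>_def field_simps)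
      moreover have "2 * B < \<epsilon> / 4 * (real r + 2)" using r \<epsilon> by (simp add: field_simps)
      ultimately show ?thesis by (simp add: divide_less_eq)
    qed
    let ?h = "\<lambda>y. y * (ln y - 1) / ((\<rho> * y + 1) * (ln (\<rho> * y + 1) + 1))"
    have "(?h \<longlongrightarrow> inverse \<rho>) at_top" using \<rho> by real_asymp
    then have "(?h \<longlongrightarrow> 1 / \<rho>) at_top" by (simp only: inverse_eq_divide)
    moreover have pw: "filterlim (\<lambda>j. \<rho> ^ j) at_top sequentially" using \<rho> by real_asymp
    ultimately have "(\<lambda>j. ?h (\<rho> ^ j)) \<longlonglongrightarrow> 1 / \<rho>" by (rule filterlim_compose)
    then have "(\<lambda>j. 2 * B * (1 - ?h (\<rho> ^ j))) \<longlonglongrightarrow> 2 * B * (1 - 1 / \<rho>)"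
      by (rule tendsto_mult[OF tendsto_const tendsto_diff[OF tendsto_const]])
    then have "\<forall>\<^sub>F j in sequentially. 2 * B * (1 - ?h (\<rho> ^ j)) < \<epsilon> / 4" using \<rho>r by (rule order_tendstoD)
    moreover have "\<forall>\<^sub>F j in sequentially. \<rho> ^ j \<ge> 3" using pw by (simp add: filterlim_at_top)
    ultimately have "\<forall>\<^sub>F j in sequentially. 2 * B * (1 - W (lacunary \<rho> j) / W (lacunary \<rho> (Suc j))) < \<epsilon> / 4"
    proof eventually_elim
      case (elim j)
      have "2 * B * (1 - W (lacunary \<rho> j) / W (lacunary \<rho> (Suc j))) \<le> 2 * B * (1 - ?h (\<rho> ^ j))"
        using weight_sum_ratio_ge[OF \<rho> elim(2)] B0 unfolding W_def by (intro mult_left_mono) auto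
      then show ?case using elim(1) by linarith
    qed
    then obtain J1 where J1: "\<And>j. j \<ge> J1 \<Longrightarrow> 2 * B * (1 - W (lacunary \<rho> j) / W (lacunary \<rho> (Suc j))) < \<epsilon> / 4"
      by (auto simp: eventually_sequentially)
    have "Cauchy (\<lambda>j. a (lacunary \<rho> j))" using conv[of r] unfolding a_def \<rho>_def by (rule convergent_Cauchy)
    then obtain J2 where J2: "\<And>i j. i \<ge> J2 \<Longrightarrow> j \<ge> J2 \<Longrightarrow> dist (a (lacunary \<rho> i)) (a (lacunary \<rho> j)) < \<epsilon> / 4"
      using \<epsilon> by (meson metric_CauchyD divide_pos_pos zero_less_numeral)
    define J where "J = max J1 J2"
    have lmono: "lacunary \<rho> i \<le> lacunary \<rho> j" if "i \<le> j" for i j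
      unfolding lacunary_def using \<rho> that by (intro nat_mono ceiling_mono power_increasing) auto
    have near: "\<exists>j\<ge>J. dist (a n) (a (lacunary \<rho> j)) < \<epsilon> / 4" if n: "n \<ge> lacunary \<rho> J" for n
    proof -
      define i where "i = (LEAST i. n < lacunary \<rho> i)"
      have "\<forall>\<^sub>F i in sequentially. n < lacunary \<rho> i"
        using filterlim_lacunary[OF \<rho>] unfolding filterlim_at_top
        by (auto dest!: spec[of _ "Suc n"] simp: Suc_le_eq)
      then have "\<exists>i. n < lacunary \<rho> i" by (rule eventually_happens'[OF sequentially_bot])
      then have i: "n < lacunary \<rho> i" unfolding i_def by (rule LeastI_ex)
      have "i > J"
      proof (rule ccontr)
        assume "\<not> J < i"
        then have "lacunary \<rho> i \<le> lacunary \<rho> J" by (intro lmono) simp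
        then show False using i n by linarith
      qed
      then obtain j where j: "i = Suc j" "j \<ge> J" by (cases i) auto
      have jn: "lacunary \<rho> j \<le> n" using not_less_Least[of j "\<lambda>i. n < lacunary \<rho> i"] j by (simp add: i_def not_less)
      have l1: "1 \<le> lacunary \<rho> j" by (rule lacunary_pos[OF \<rho>])
      have "norm (a n - a (lacunary \<rho> j)) \<le> 2 * B * (1 - W (lacunary \<rho> j) / W n)"
        unfolding a_def W_def by (rule weighted_average_slow_variation[OF bd l1 jn])
      also have "\<dots> \<le> 2 * B * (1 - W (lacunary \<rho> j) / W (lacunary \<rho> (Suc j)))"
      proof -
        have pos: "W (lacunary \<rho> j) > 0" "W n > 0" using weight_sum_divisor_pos l1 jn by (auto simp: W_def)
        have "W n \<le> W (lacunary \<rho> (Suc j))" unfolding W_def weight_sum_def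
          using i j by (intro sum_mono2) auto
        then have "W (lacunary \<rho> j) / W (lacunary \<rho> (Suc j)) \<le> W (lacunary \<rho> j) / W n"
          using pos by (intro divide_left_mono) auto
        then show ?thesis using B0 by (intro mult_left_mono) auto
      qed
      also have "\<dots> < \<epsilon> / 4" using J1 j by (simp add: J_def)
      finally show ?thesis using j by (auto simp: dist_norm)
    qed
    show "\<exists>M. \<forall>m\<ge>M. \<forall>n\<ge>M. dist (a m) (a n) < \<epsilon>"
    proof (intro exI allI impI)
      fix m n assume "m \<ge> lacunary \<rho> J" "n \<ge> lacunary \<rho> J"
      then obtain i j where ij: "i \<ge> J" "j \<ge> J" "dist (a m) (a (lacunary \<rho> i)) < \<epsilon> / 4" "dist (a n) (a (lacunary \<rho> j)) < \<epsilon> / 4"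
        using near by meson
      have "dist (a m) (a n) \<le> dist (a m) (a (lacunary \<rho> i)) + dist (a (lacunary \<rho> i)) (a (lacunary \<rho> j)) + dist (a n) (a (lacunary \<rho> j))"
        using dist_triangle[of "a m" "a n" "a (lacunary \<rho> i)"] dist_triangle[of "a (lacunary \<rho> i)" "a n" "a (lacunary \<rho> j)"]
        by (simp add: dist_commute)
      moreover have "dist (a (lacunary \<rho> i)) (a (lacunary \<rho> j)) < \<epsilon> / 4" using J2 ij by (simp add: J_def)
      ultimately show "dist (a m) (a n) < \<epsilon>" using ij \<epsilon> by linarith
    qed
  qed
  then show ?thesis unfolding a_def by (rule Cauchy_convergent)
qed

lemma weighted_average_bounded_convergent:
  fixes f :: "'a \<Rightarrow> complex"
  assumes sys: "dynamical_system M T" and f: "f \<in> borel_measurable M" and bd: "\<And>x. norm (f x) \<le> B"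
  shows "AE x in M. convergent (\<lambda>n. weighted_average divisor_weight T f n x)"
proof -
  have "AE x in M. \<forall>r::nat. convergent (\<lambda>j. truncated_average T f (lacunary (1 + 1 / (real r + 1)) j) x)"
    unfolding AE_all_countable by (intro allI truncated_average_convergent[OF sys f bd]) (simp add: add_pos_pos)
  then show ?thesis
  proof eventually_elim
    case (elim x)
    show ?case
      by (rule convergent_from_lacunary[OF bd], rule weighted_average_lacunary_convergent[OF bd])
         (use elim in \<open>auto simp: add_pos_pos\<close>)
  qed
qed

section \<open>The good weight property\<close>

text \<open>The Banach principle. Truncate \<open>f\<close> at height \<open>K\<close>: the averages of the bounded part converge, and the
  maximal functions of the unbounded parts have infimum \<open>0\<close> almost everywhere, since their \<open>L\<^sup>p\<close> norms tend
  to \<open>0\<close>.\<close>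
theorem weighted_average_convergent:
  fixes f :: "'a \<Rightarrow> complex"
  assumes sys: "dynamical_system M T" and f: "f \<in> Lp_space M p" and p: "p > 1"
  shows "AE x in M. convergent (\<lambda>n. weighted_average divisor_weight T f n x)"
proof -
  have fm[measurable]: "f \<in> borel_measurable M" and fin: "Lp_norm M p (\<lambda>x. ennreal (norm (f x))) < \<infinity>"
    using f by (auto simp: Lp_space_def)
  define low where "low K x = (if norm (f x) \<le> real K then f x else 0)" for K :: nat and x
  define high where "high K x = (if norm (f x) \<le> real K then 0 else f x)" for K :: nat and x
  have lm[measurable]: "low K \<in> borel_measurable M" for K unfolding low_def by measurable
  have hm[measurable]: "high K \<in> borel_measurable M" for K unfolding high_def by measurable
  have mm[measurable]: "maximal_function divisor_weight T (high K) \<in> borel_measurable M" for K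
    by (rule measurable_maximal_function[OF dynamical_systemD(2)[OF sys] hm])
  obtain C where C: "C > 0" and "\<forall>(M :: 'a measure) T f. dynamical_system M T \<longrightarrow> f \<in> borel_measurable M \<longrightarrow>
    (\<integral>\<^sup>+ x. ennreal_powr (maximal_function divisor_weight T f x) p \<partial>M) \<le> ennreal C * (\<integral>\<^sup>+ x. ennreal (norm (f x) powr p) \<partial>M)"
    using maximal_function_Lp[OF p, where 'a = 'a] by blast
  then have bound: "(\<integral>\<^sup>+ x. ennreal_powr (maximal_function divisor_weight T (high K) x) p \<partial>M) \<le> ennreal C * (\<integral>\<^sup>+ x. ennreal (norm (high K x) powr p) \<partial>M)" for K
    using sys hm by blast
  have I: "(\<integral>\<^sup>+ x. ennreal (norm (f x) powr p) \<partial>M) < \<infinity>"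
    using fin by (auto simp: Lp_norm_def ennreal_powr_ennreal ennreal_powr_def less_top split: if_splits)
  have dec: "decseq (\<lambda>K x. ennreal (norm (high K x) powr p))"
    by (intro antimonoI le_funI) (auto simp: high_def)
  have hfin: "(\<integral>\<^sup>+ x. ennreal (norm (high K x) powr p) \<partial>M) < \<infinity>" for K
    by (rule le_less_trans[OF nn_integral_mono I]) (auto simp: high_def)
  have "(INF K. (\<integral>\<^sup>+ x. ennreal (norm (high K x) powr p) \<partial>M)) = (\<integral>\<^sup>+ x. (INF K. ennreal (norm (high K x) powr p)) \<partial>M)"
    by (rule nn_integral_monotone_convergence_INF_decseq[OF dec _ hfin, symmetric]) measurable
  also have "\<dots> = (\<integral>\<^sup>+ x. 0 \<partial>M)"
  proof (rule nn_integral_cong)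
    fix x
    obtain K :: nat where "norm (f x) \<le> real K" using real_arch_simple by blast
    then have "ennreal (norm (high K x) powr p) = 0" by (simp add: high_def)
    moreover have "(INF K. ennreal (norm (high K x) powr p)) \<le> ennreal (norm (high K x) powr p)"
      by (rule INF_lower) simp
    ultimately have "(INF K. ennreal (norm (high K x) powr p)) \<le> 0" by simp
    then show "(INF K. ennreal (norm (high K x) powr p)) = 0" by simp
  qed
  finally have INF0: "(INF K. (\<integral>\<^sup>+ x. ennreal (norm (high K x) powr p) \<partial>M)) = 0" by simp
  define V where "V = (\<integral>\<^sup>+ x. (INF K. ennreal_powr (maximal_function divisor_weight T (high K) x) p) \<partial>M)"
  have "ennreal (1 / C) * V \<le> (INF K. (\<integral>\<^sup>+ x. ennreal (norm (high K x) powr p) \<partial>M))"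
  proof (rule INF_greatest)
    fix K
    have "V \<le> (\<integral>\<^sup>+ x. ennreal_powr (maximal_function divisor_weight T (high K) x) p \<partial>M)"
      unfolding V_def by (intro nn_integral_mono INF_lower) simp
    also note bound
    finally have "ennreal (1 / C) * V \<le> ennreal (1 / C) * (ennreal C * (\<integral>\<^sup>+ x. ennreal (norm (high K x) powr p) \<partial>M))"
      by (intro mult_left_mono) auto
    then show "ennreal (1 / C) * V \<le> (\<integral>\<^sup>+ x. ennreal (norm (high K x) powr p) \<partial>M)"
      using C by (simp add: mult.assoc[symmetric] ennreal_mult[symmetric])
  qed
  then have "V = 0" using C by (simp add: INF0)
  then have "(\<integral>\<^sup>+ x. (INF K. ennreal_powr (maximal_function divisor_weight T (high K) x) p) \<partial>M) = 0"
    by (simp only: V_def)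
  then have "AE x in M. (INF K. ennreal_powr (maximal_function divisor_weight T (high K) x) p) = 0"
    by (subst (asm) nn_integral_0_iff_AE) measurable
  moreover have "AE x in M. \<forall>K. convergent (\<lambda>n. weighted_average divisor_weight T (low K) n x)"
    unfolding AE_all_countable
  proof
    fix K
    show "AE x in M. convergent (\<lambda>n. weighted_average divisor_weight T (low K) n x)"
      by (rule weighted_average_bounded_convergent[OF sys lm, of K "real K"]) (simp add: low_def)
  qed
  ultimately show ?thesis
  proof eventually_elim
    case (elim x)
    let ?a = "\<lambda>g n. weighted_average divisor_weight T g n x"
    have "Cauchy (?a f)"
    proof (rule metric_CauchyI)
      fix \<epsilon> :: real assume \<epsilon>: "\<epsilon> > 0"
      have "(INF K. ennreal_powr (maximal_function divisor_weight T (high K) x) p) < ennreal ((\<epsilon> / 3) powr p)"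
        using elim(1) \<epsilon> by simp
      then obtain K where K: "ennreal_powr (maximal_function divisor_weight T (high K) x) p < ennreal ((\<epsilon> / 3) powr p)"
        by (auto simp: INF_less_iff)
      have hi: "norm (?a (high K) n) < \<epsilon> / 3" if "n \<ge> 1" for n
      proof (rule ccontr)
        assume "\<not> norm (?a (high K) n) < \<epsilon> / 3"
        then have "ennreal (\<epsilon> / 3) \<le> ennreal (norm (?a (high K) n))" by (intro ennreal_leI) simp
        also have "\<dots> \<le> maximal_function divisor_weight T (high K) x"
          unfolding maximal_function_def by (rule SUP_upper) (use that in simp)
        finally have "ennreal_powr (ennreal (\<epsilon> / 3)) p \<le> ennreal_powr (maximal_function divisor_weight T (high K) x) p"
          using p by (intro ennreal_powr_mono) auto
        then show False using K \<epsilon> by (simp add: ennreal_powr_ennreal)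
      qed
      have add: "?a f n = ?a (low K) n + ?a (high K) n" for n
      proof -
        have "f y = low K y + high K y" for y by (simp add: low_def high_def)
        then show ?thesis
          unfolding weighted_average_def by (simp add: distrib_left sum.distrib add_divide_distrib)
      qed
      have "Cauchy (?a (low K))" using elim(2) by (intro convergent_Cauchy) blast
      from CauchyD[OF this, of "\<epsilon> / 3"] \<epsilon>
      obtain N where N: "\<forall>m\<ge>N. \<forall>n\<ge>N. norm (?a (low K) m - ?a (low K) n) < \<epsilon> / 3" by auto
      show "\<exists>M. \<forall>m\<ge>M. \<forall>n\<ge>M. dist (?a f m) (?a f n) < \<epsilon>"
      proof (intro exI[of _ "max N 1"] allI impI)
        fix m n assume mn: "m \<ge> max N 1" "n \<ge> max N 1"
        have split: "?a f m - ?a f n = (?a (low K) m - ?a (low K) n) + (?a (high K) m - ?a (high K) n)" by (simp add: add)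
        have "norm (?a f m - ?a f n) \<le> norm (?a (low K) m - ?a (low K) n) + (norm (?a (high K) m) + norm (?a (high K) n))"
          unfolding split by (intro norm_triangle_le add_left_mono norm_triangle_ineq4)
        moreover have "norm (?a (low K) m - ?a (low K) n) < \<epsilon> / 3" using N mn by simp
        moreover have "norm (?a (high K) m) < \<epsilon> / 3" "norm (?a (high K) n) < \<epsilon> / 3" using hi mn by auto
        ultimately show "dist (?a f m) (?a f n) < \<epsilon>" by (simp add: dist_norm)
      qed
    qed
    then show ?case by (rule Cauchy_convergent)
  qed
qed

theorem theorem1p1:
  fixes p :: real
  assumes "p > 1"
  shows "good_weight_dominated TYPE('a) p (\<lambda>k. real (divisor_count k)) \<and>
         good_weight_pointwise TYPE('a) p (\<lambda>k. real (divisor_count k))"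
proof
  obtain C where "C > 0" "dominated_with TYPE(nat \<Rightarrow> complex) p divisor_weight C"
    using dominated_with_divisor[OF assms, where 'a = "nat \<Rightarrow> complex"] by blast
  then show "good_weight_dominated TYPE('a) p (\<lambda>k. real (divisor_count k))"
    by (intro good_weight_dominatedI weight_sequence_divisor)
  show "good_weight_pointwise TYPE('a) p (\<lambda>k. real (divisor_count k))"
    unfolding good_weight_pointwise_def
    using weight_sequence_divisor weighted_average_convergent assms by blast
qed

end
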